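(* Let $0<q<1$ and let $C_k:\mathrm{Pol}(\mathbb{C})_q\times\mathrm{Pol}(\mathbb{C})_q\to\mathrm{Pol}(\mathbb{C})_q$, $k\in\mathbb{N}$, be the bilinear maps determined by the formal asymptotic expansion (Berezin quantization) $$\widehat{f_1}\cdot\widehat{f_2}=\widehat{f_1f_2}+\sum_{k=1}^\infty q^{4\alpha k}\,\widehat{C_k(f_1,f_2)},\qquad f_1,f_2\in\mathrm{Pol}(\mathbb{C})_q .$$ Then for every $k\in\mathbb{N}$ the bilinear operator $C_k$ is of the form $$C_k(f_1,f_2)=\sum_{i,j,n,m=0}^{N}a_{ijnm}\left(\left(\frac{\partial^{(r)}}{\partial z^*}\right)^if_1\right)z^{*j}z^n\left(\left(\frac{\partial^{(l)}}{\partial z}\right)^mf_2\right)$$ for some $N=N(k)$ and $a_{ijnm}=a_{ijnm}(k)\in\mathbb{C}$, and $C_k$ is extendable by continuity to a $q$-bidifferential operator $C_k:D(U)_q\times D(U)_q\to D(U)_q$ (i.e. a bilinear operator of this same form on $D(U)_q$).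
   Context: Functions. $\mathrm{Pol}(\mathbb{C})_q$ is the unital $*$-algebra with generator $z$ and relation $z^*z=q^2zz^*+1-q^2$; put $y=1-zz^*$, so $z^*y=q^2yz^*$, $zy=q^{-2}yz$. Every $f\in\mathrm{Pol}(\mathbb{C})_q$ has unique finite decompositions $f=\sum a_{ij}z^iz^{*j}$ ($a_{ij}\in\mathbb{C}$) and $f=\sum_{m>0}z^m\psi_m(y)+\psi_0(y)+\sum_{m>0}\psi_{-m}(y)z^{*m}$ with polynomials $\psi_m$. Give $\mathrm{Pol}(\mathbb{C})_q$ the weakest topology in which all functionals $f\mapsto\psi_m(q^{2n})$ ($m\in\mathbb{Z}$, $n\in\mathbb{Z}_+$) are continuous. Its completion $D(U)_q'$ is the space of formal series of the latter form with $\psi_m$ arbitrary functions on $q^{2\mathbb{Z}_+}=\{q^{2n}:n\in\mathbb{Z}_+\}$. $D(U)_q\subset D(U)'_q$ is the subspace of finite functions: those with only finitely many non-zero numbers $\psi_m(q^{2n})$. By continuity of multiplication in each argument, $D(U)_q$ is a $*$-algebra, which can be multiplied by elements of $\mathrm{Pol}(\mathbb{C})_q$ on both sides. Derivatives. $\Omega_q(\mathbb{C})$ is the $*$-algebra generated by $z,dz$ with relations $1-z^*z=q^2(1-zz^* )$, $dz\,z^*=q^{-2}z^*dz$, $dz\,z=q^2z\,dz$, $dz\,dz^*=-q^{-2}dz^*dz$, $dz\,dz=0$ and those obtained by applying $*$ (in particular $dz^*z=q^2z\,dz^*$, $dz^*z^*=q^{-2}z^*dz^*$). It is bigraded by $\deg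 z=\deg z^*=(0,0)$, $\deg dz=(1,0)$, $\deg dz^*=(0,1)$; $d$ is the linear map with $z\mapsto dz$, $z^*\mapsto dz^*$, $dz\mapsto0$, $dz^*\mapsto0$ satisfying the graded Leibniz rule, and $d=\partial+\overline\partial$ with $\partial$ of bidegree $(1,0)$ and $\overline\partial$ of bidegree $(0,1)$. For a function $f$, the partial derivatives are defined by $\partial f=dz\cdot\frac{\partial^{(l)}f}{\partial z}$ and $\overline\partial f=\frac{\partial^{(r)}f}{\partial z^*}\,dz^*$. They extend by continuity to $D(U)'_q$ and act on $D(U)_q$. A bilinear operator on $D(U)_q$ of the form displayed in the claim is called $q$-bidifferential. Quantization. For $\alpha>0$ let $\int_{U_q}f\,d\nu_\alpha=(1-q^{4\alpha})\sum_{n\in\mathbb{Z}_+}\psi_0(q^{2n})q^{4\alpha n}$ for $f\in\mathrm{Pol}(\mathbb{C})_q$, let $\|f\|_\alpha=\left(\int_{U_q}f^*f\,d\nu_\alpha\right)^{1/2}$, let $L^2_{q,\alpha}$ be the completion of $\mathrm{Pol}(\mathbb{C})_q$ in this norm, and $H^2_{q,\alpha}\subset L^2_{q,\alpha}$ the linear span of the monomials $z^j$, $j\in\mathbb{Z}_+$. Let $\widehat z$ be the operator of multiplication by $z$ in $H^2_{q,\alpha}$ and $\widehat z^*$ its conjugate; explicitly $\widehat z:z^m\mapsto z^{m+1}$, $\widehat z^*:1\mapsto0$, $\widehat z^*:z^m\mapsto\frac{1-q^{2m}}{1-q^{4\alpha+2m}}z^{m-1}$ for $m\ge1$. They satisfy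 $$\widehat z^*\widehat z=q^2\widehat z\widehat z^*+1-q^2+q^{4\alpha}\frac{1-q^2}{1-q^{4\alpha}}(1-\widehat z\widehat z^* )(1-\widehat z^*\widehat z).$$ For $f=\sum a_{ij}z^iz^{*j}$ put $\widehat f=\sum a_{ij}\widehat z^i\widehat z^{*j}$. The formal asymptotic expansion in the claim is the expansion in powers of the formal parameter $t=q^{4\alpha}$ (for instance, an identity of power series in $t$ for all matrix entries in the basis $\{z^m\}$), obtained by repeatedly using the commutation relation $\widehat z^*\widehat z=q^2\widehat z\widehat z^*+1-q^2+q^{4\alpha}\frac{1-q^2}{1-q^{4\alpha}}(1-\widehat z\widehat z^* )(1-\widehat z^*\widehat z)$; it determines the $C_k$ uniquely. *)

theory Defs
  imports
    "HOL-Analysis.Analysis"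
    "HOL-Library.Poly_Mapping"
    "HOL-Library.Function_Algebras"
    "HOL-Computational_Algebra.Computational_Algebra"
begin

section \<open>Algebras given by generators and relations\<close>

text \<open>The wrapper makes words a monoid (written additively), so that finitely supported
  functions on words form the free unital complex algebra.\<close>

datatype 'g fword = Word (letters: "'g list")

instantiation fword :: (type) monoid_add
begin

definition zero_fword_def: "0 = Word []"

definition plus_fword_def: "u + v = Word (letters u @ letters v)"

instance
  by standard (simp_all add: zero_fword_def plus_fword_def)

end

type_synonym 'g free_alg = "'g fword \<Rightarrow>\<^sub>0 complex"

definition gen :: "'g \<Rightarrow> 'g free_alg" where
  "gen x = Poly_Mapping.single (Word [x]) 1"

definition const :: "complex \<Rightarrow> 'g free_alg" where
  "const c = Poly_Mapping.single 0 c"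

inductive_set two_sided_ideal :: "'a::ring_1 set \<Rightarrow> 'a set" for R :: "'a set" where
  zero: "0 \<in> two_sided_ideal R"
| gens: "r \<in> R \<Longrightarrow> a * r * b \<in> two_sided_ideal R"
| add: "x \<in> two_sided_ideal R \<Longrightarrow> y \<in> two_sided_ideal R \<Longrightarrow> x + y \<in> two_sided_ideal R"


section \<open>The algebra of polynomials on the quantum plane\<close>

datatype pgen = Z | Zs

definition pol_ideal :: "real \<Rightarrow> pgen free_alg set" where
  "pol_ideal q = two_sided_ideal
     {gen Zs * gen Z - const (of_real (q^2)) * gen Z * gen Zs - const (of_real (1 - q^2))}"

text \<open>Every class modulo \<^const>\<open>pol_ideal\<close> has exactly one representative of the form
  \<open>\<Sum> a\<^sub>i\<^sub>j z\<^sup>i z*\<^sup>j\<close>. An element of \<open>Pol(\<complex>)\<^sub>q\<close> is represented by its coefficients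
  \<open>(i, j) \<mapsto> a\<^sub>i\<^sub>j\<close>; the dependence on \<open>q\<close> sits in the product \<open>pmul\<close>.\<close>

type_synonym pol = "(nat \<times> nat) \<Rightarrow>\<^sub>0 complex"

definition mono :: "nat \<Rightarrow> nat \<Rightarrow> pol" where
  "mono i j = Poly_Mapping.single (i, j) 1"

definition pscale :: "complex \<Rightarrow> pol \<Rightarrow> pol" where
  "pscale c f = Poly_Mapping.map (\<lambda>x. c * x) f"

text \<open>\<open>normal_form x y f\<close> is \<open>\<Sum> a\<^sub>i\<^sub>j x\<^sup>i y\<^sup>j\<close> in a free algebra having \<open>x\<close> and \<open>y\<close> among its
  generators.\<close>

definition normal_form :: "'g \<Rightarrow> 'g \<Rightarrow> pol \<Rightarrow> 'g free_alg" where
  "normal_form x y f =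
     (\<Sum>(i, j)\<in>Poly_Mapping.keys f. const (Poly_Mapping.lookup f (i, j)) * gen x ^ i * gen y ^ j)"

definition pmul :: "real \<Rightarrow> pol \<Rightarrow> pol \<Rightarrow> pol" where
  "pmul q f g =
     (THE h. normal_form Z Zs f * normal_form Z Zs g - normal_form Z Zs h \<in> pol_ideal q)"

text \<open>The value of a polynomial at \<open>y = 1 - z z*\<close>.\<close>

definition at_y :: "complex poly \<Rightarrow> pgen free_alg" where
  "at_y p = (\<Sum>i\<le>degree p. const (coeff p i) * (1 - gen Z * gen Zs) ^ i)"

text \<open>The polynomials \<open>\<psi>\<^sub>m\<close> (\<open>m \<in> \<int>\<close>) of the decomposition
  \<open>f = \<Sum>\<^bsub>m>0\<^esub> z\<^sup>m \<psi>\<^sub>m(y) + \<psi>\<^sub>0(y) + \<Sum>\<^bsub>m>0\<^esub> \<psi>\<^bsub>-m\<^esub>(y) z*\<^sup>m\<close>.\<close>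

definition psi :: "real \<Rightarrow> pol \<Rightarrow> int \<Rightarrow> complex poly" where
  "psi q f = (THE \<psi>. finite {m. \<psi> m \<noteq> 0} \<and>
     normal_form Z Zs f
     - (\<Sum>m | \<psi> m \<noteq> 0. if 0 \<le> m then gen Z ^ nat m * at_y (\<psi> m)
                                 else at_y (\<psi> m) * gen Zs ^ nat (- m))
     \<in> pol_ideal q)"


section \<open>The differential calculus\<close>

text \<open>\<open>Fn Z\<close>, \<open>Fn Zs\<close>, \<open>Df Z\<close>, \<open>Df Zs\<close> stand for \<open>z\<close>, \<open>z*\<close>, \<open>dz\<close>, \<open>dz*\<close>.\<close>

datatype fgen = Fn pgen | Df pgen

definition form_ideal :: "real \<Rightarrow> fgen free_alg set" where
  "form_ideal q =
    (let z = gen (Fn Z); zs = gen (Fn Zs); dz = gen (Df Z); dzs = gen (Df Zs);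
         p = const (of_real (q^2)); p' = const (of_real (1 / q^2))
     in two_sided_ideal
       {(1 - zs * z) - p * (1 - z * zs),
        dz * zs - p' * zs * dz, dzs * z - p * z * dzs,
        dz * z - p * z * dz, dzs * zs - p' * zs * dzs,
        dz * dzs + p' * dzs * dz,
        dz * dz, dzs * dzs})"

text \<open>The differential on the free algebra, by the graded Leibniz rule. It maps
  \<^const>\<open>form_ideal\<close> into itself and so induces the differential of \<open>\<Omega>\<^sub>q(\<complex>)\<close>.\<close>

fun ext_d_word :: "fgen list \<Rightarrow> fgen free_alg" where
  "ext_d_word [] = 0"
| "ext_d_word (Fn x # w) = gen (Df x) * Poly_Mapping.single (Word w) 1 + gen (Fn x) * ext_d_word w"
| "ext_d_word (Df x # w) = - (gen (Df x) * ext_d_word w)"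

definition ext_d :: "fgen free_alg \<Rightarrow> fgen free_alg" where
  "ext_d \<omega> = (\<Sum>w\<in>Poly_Mapping.keys \<omega>. const (Poly_Mapping.lookup \<omega> w) * ext_d_word (letters w))"

text \<open>\<open>df = dz \<cdot> g + h \<cdot> dz*\<close> in \<open>\<Omega>\<^sub>q(\<complex>)\<close>. The summands have bidegrees (1,0) and (0,1), so they
  are the components \<open>\<partial>f\<close> and \<open>\<partial>\<close>-bar \<open>f\<close> of \<open>df\<close>, and \<open>g\<close> and \<open>h\<close> are the left and the right
  partial derivative.\<close>

definition partials :: "real \<Rightarrow> pol \<Rightarrow> pol \<Rightarrow> pol \<Rightarrow> bool" where
  "partials q f g h \<longleftrightarrow>
     ext_d (normal_form (Fn Z) (Fn Zs) f)
     - (gen (Df Z) * normal_form (Fn Z) (Fn Zs) g + normal_form (Fn Z) (Fn Zs) h * gen (Df Zs))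
     \<in> form_ideal q"

definition dl_z :: "real \<Rightarrow> pol \<Rightarrow> pol" where
  "dl_z q f = (THE g. \<exists>h. partials q f g h)"

definition dr_zs :: "real \<Rightarrow> pol \<Rightarrow> pol" where
  "dr_zs q f = (THE h. \<exists>g. partials q f g h)"


section \<open>Generalized and finite functions on the quantum disc\<close>

text \<open>A formal series in \<open>D(U)\<^sub>q'\<close> is represented by the numbers \<open>m n \<mapsto> \<psi>\<^sub>m(q\<^sup>2\<^sup>n)\<close>. The topology
  of pointwise convergence, carried by the function type, restricts along \<open>emb\<close> to the topology
  of \<open>Pol(\<complex>)\<^sub>q\<close>.\<close>

type_synonym gfun = "int \<Rightarrow> nat \<Rightarrow> complex"

definition emb :: "real \<Rightarrow> pol \<Rightarrow> gfun" where
  "emb q f = (\<lambda>m n. poly (psi q f m) (of_real (q ^ (2 * n))))"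

definition fin_funs :: "gfun set" where
  "fin_funs = {f. finite {(m, n). f m n \<noteq> 0}}"

definition gscale :: "complex \<Rightarrow> gfun \<Rightarrow> gfun" where
  "gscale c f = (\<lambda>m n. c * f m n)"

definition cont_ext :: "real \<Rightarrow> (pol \<Rightarrow> pol) \<Rightarrow> gfun \<Rightarrow> gfun" where
  "cont_ext q F = (THE G. continuous_on UNIV G \<and> (\<forall>f. G (emb q f) = emb q (F f)))"

text \<open>Extension by continuity in each argument separately. The product of \<open>Pol(\<complex>)\<^sub>q\<close> is not
  jointly continuous, and products of two arbitrary elements of \<open>D(U)\<^sub>q'\<close> are not defined, hence
  one argument is required to be a polynomial or a finite function. As \<open>Pol(\<complex>)\<^sub>q\<close> is dense,
  \<open>B f g\<close> is determined by \<open>C\<close> whenever \<open>f\<close> or \<open>g\<close> is such; other values of \<open>B\<close> are irrelevant.\<close>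

definition sep_cont_ext :: "real \<Rightarrow> (pol \<Rightarrow> pol \<Rightarrow> pol) \<Rightarrow> (gfun \<Rightarrow> gfun \<Rightarrow> gfun) \<Rightarrow> bool" where
  "sep_cont_ext q C B \<longleftrightarrow>
     (\<forall>f g. B (emb q f) (emb q g) = emb q (C f g)) \<and>
     (\<forall>f \<in> range (emb q) \<union> fin_funs. continuous_on UNIV (\<lambda>g. B f g)) \<and>
     (\<forall>g \<in> range (emb q) \<union> fin_funs. continuous_on UNIV (\<lambda>f. B f g))"

text \<open>The product extended by continuity; only used when one factor is a polynomial or a finite
  function.\<close>

definition gmul :: "real \<Rightarrow> gfun \<Rightarrow> gfun \<Rightarrow> gfun" where
  "gmul q = (SOME B. sep_cont_ext q (pmul q) B)"

definition gdl_z :: "real \<Rightarrow> gfun \<Rightarrow> gfun" where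
  "gdl_z q = cont_ext q (dl_z q)"

definition gdr_zs :: "real \<Rightarrow> gfun \<Rightarrow> gfun" where
  "gdr_zs q = cont_ext q (dr_zs q)"


section \<open>Bidifferential operators\<close>

definition bilinear_on ::
    "'a::ab_group_add set \<Rightarrow> (complex \<Rightarrow> 'a \<Rightarrow> 'a) \<Rightarrow> ('a \<Rightarrow> 'a \<Rightarrow> 'a) \<Rightarrow> bool" where
  "bilinear_on S sc B \<longleftrightarrow>
     (\<forall>f\<in>S. \<forall>g\<in>S. \<forall>h\<in>S. \<forall>c.
        B (f + sc c g) h = B f h + sc c (B g h) \<and>
        B h (f + sc c g) = B h f + sc c (B h g))"

text \<open>\<open>zs_z q j n\<close> is the element \<open>z*\<^sup>j z\<^sup>n\<close> of \<open>Pol(\<complex>)\<^sub>q\<close>.\<close>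

definition zs_z :: "real \<Rightarrow> nat \<Rightarrow> nat \<Rightarrow> pol" where
  "zs_z q j n = pmul q (mono 0 j) (mono n 0)"

definition bidiff_pol ::
    "real \<Rightarrow> nat \<Rightarrow> (nat \<Rightarrow> nat \<Rightarrow> nat \<Rightarrow> nat \<Rightarrow> complex) \<Rightarrow> pol \<Rightarrow> pol \<Rightarrow> pol" where
  "bidiff_pol q N a f1 f2 =
     (\<Sum>i\<le>N. \<Sum>j\<le>N. \<Sum>n\<le>N. \<Sum>m\<le>N. pscale (a i j n m)
        (pmul q (pmul q ((dr_zs q ^^ i) f1) (zs_z q j n)) ((dl_z q ^^ m) f2)))"

definition bidiff_fin ::
    "real \<Rightarrow> nat \<Rightarrow> (nat \<Rightarrow> nat \<Rightarrow> nat \<Rightarrow> nat \<Rightarrow> complex) \<Rightarrow> gfun \<Rightarrow> gfun \<Rightarrow> gfun" where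
  "bidiff_fin q N a f1 f2 =
     (\<Sum>i\<le>N. \<Sum>j\<le>N. \<Sum>n\<le>N. \<Sum>m\<le>N. gscale (a i j n m)
        (gmul q (gmul q ((gdr_zs q ^^ i) f1) (emb q (zs_z q j n))) ((gdl_z q ^^ m) f2)))"


section \<open>Berezin quantization\<close>

text \<open>\<open>H\<^sup>2\<^bsub>q,\<alpha>\<^esub>\<close> is the linear span of the monomials \<open>z\<^sup>m\<close>; its elements are represented as
  polynomials, so that multiplication by \<open>z\<close> is \<open>pCons 0\<close>.\<close>

definition hat_z :: "complex poly \<Rightarrow> complex poly" where
  "hat_z p = pCons 0 p"

definition hat_zs :: "real \<Rightarrow> real \<Rightarrow> complex poly \<Rightarrow> complex poly" where
  "hat_zs q \<alpha> p = (\<Sum>m=1..degree p.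
     monom (coeff p m * of_real ((1 - q ^ (2 * m)) / (1 - q powr (4 * \<alpha> + 2 * real m)))) (m - 1))"

definition hat :: "real \<Rightarrow> real \<Rightarrow> pol \<Rightarrow> complex poly \<Rightarrow> complex poly" where
  "hat q \<alpha> f p = (\<Sum>(i, j)\<in>Poly_Mapping.keys f.
     smult (Poly_Mapping.lookup f (i, j)) ((hat_z ^^ i) ((hat_zs q \<alpha> ^^ j) p)))"

definition entry :: "(complex poly \<Rightarrow> complex poly) \<Rightarrow> nat \<Rightarrow> nat \<Rightarrow> complex" where
  "entry T m n = coeff (T (monom 1 n)) m"

text \<open>The function \<open>F\<close> of \<open>\<alpha>\<close> is the sum of the power series \<open>g\<close> in \<open>t = q\<^sup>4\<^sup>\<alpha>\<close>.\<close>

definition t_series :: "real \<Rightarrow> (real \<Rightarrow> complex) \<Rightarrow> complex fps \<Rightarrow> bool" where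
  "t_series q F g \<longleftrightarrow>
     (\<forall>\<alpha>>0. (\<lambda>k. fps_nth g k * of_real (q powr (4 * \<alpha> * real k))) sums F \<alpha>)"

text \<open>The expansion is an identity of formal power series in \<open>t\<close> for every matrix entry; the
  infinite sum is taken in the \<open>t\<close>-adic topology of \<^typ>\<open>complex fps\<close>. The value \<open>C 0\<close> is not
  constrained.\<close>

definition berezin_expansion :: "real \<Rightarrow> (nat \<Rightarrow> pol \<Rightarrow> pol \<Rightarrow> pol) \<Rightarrow> bool" where
  "berezin_expansion q C \<longleftrightarrow>
     (\<forall>k\<ge>1. bilinear_on UNIV pscale (C k)) \<and>
     (\<forall>f1 f2 m n. \<exists>g h c.
        t_series q (\<lambda>\<alpha>. entry (hat q \<alpha> f1 \<circ> hat q \<alpha> f2) m n) g \<and>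
        t_series q (\<lambda>\<alpha>. entry (hat q \<alpha> (pmul q f1 f2)) m n) h \<and>
        (\<forall>k\<ge>1. t_series q (\<lambda>\<alpha>. entry (hat q \<alpha> (C k f1 f2)) m n) (c k)) \<and>
        (\<lambda>k. fps_X ^ Suc k * c (Suc k)) sums (g - h))"

end

theory Submission
  imports Defs
begin

text \<open>The theorem is a statement about matrices. On the space with basis \<open>e\<^sub>n\<close> (the monomials) let \<open>z\<close> be the
shift \<open>e\<^sub>n \<mapsto> e\<^sub>n\<^sub>+\<^sub>1\<close>, let \<open>z*\<close> send \<open>e\<^sub>n\<close> to \<open>(1 - q\<^sup>2\<^sup>n) e\<^sub>n\<^sub>-\<^sub>1\<close>, and let \<open>y = 1 - z z*\<close>, which is
diagonal with entries \<open>q\<^sup>2\<^sup>n\<close>. This Fock representation is faithful, and every element of the free algebra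
is congruent to a normal form; hence congruence modulo the ideal is equality of operators
(\<open>pol_ideal_iff\<close>), and the products and the functions \<open>\<psi>\<^sub>m\<close> can be read off from matrix entries. Up to
nonzero factors the numbers \<open>\<psi>\<^sub>m(q\<^sup>2\<^sup>n)\<close> are the entries of the matrix of \<open>f\<close> (\<open>emb_ent\<close>). So generalized
functions are arbitrary infinite matrices with the topology of entrywise convergence, finite functions
are matrices with finitely many nonzero entries, and the extended product is the matrix product. The
partial derivatives are commutators, \<open>(1 - q\<^sup>2) y (\<partial>f/\<partial>z) = [z*, f]\<close> and
\<open>(1 - q\<^sup>2) (\<partial>f/\<partial>z*) y = [f, z]\<close> (\<open>rep_dl\<close>, \<open>rep_dr\<close>), so they extend to all matrices because \<open>y\<close> is an
invertible diagonal matrix. Therefore every bidifferential operator on polynomials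
extends to the operator of the same form on finite functions (\<open>bidiff_extension\<close>).

It remains to see that \<open>C\<^sub>k\<close> exists and has this form. With \<open>t = q\<^sup>4\<^sup>\<alpha>\<close> the conjugate of multiplication by
\<open>z\<close> is \<open>z* (1 - t y)\<^sup>-\<^sup>1 = \<Sum> t\<^sup>k z* y\<^sup>k\<close>. Thus the quantization of \<open>f\<close> is a power series \<open>\<Sum> t\<^sup>l H\<^sub>l f\<close> with
linear maps \<open>H\<^sub>l\<close> of the algebra and \<open>H\<^sub>0 f = f\<close>, and the equation
\<open>(\<Sum> t\<^sup>l H\<^sub>l f) (\<Sum> t\<^sup>l H\<^sub>l g) = \<Sum> t\<^sup>k\<^sup>+\<^sup>l H\<^sub>l (C\<^sub>k (f, g))\<close> has exactly one solution, found recursively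
(\<open>quant_seq_inj\<close>, \<open>quant_seq_berezin\<close>).

Put \<open>p = q\<^sup>-\<^sup>2\<close>. From \<open>f - z f z* = p\<^sup>j f y\<close> for \<open>f = z\<^sup>i z*\<^sup>j\<close> one obtains the recursion
\<open>(p\<^sup>l\<^sup>+\<^sup>1 - 1) H\<^sub>l\<^sub>+\<^sub>1 f = p\<^sup>l H\<^sub>l f - z (H\<^sub>l f) z* - (H\<^sub>l f) y\<close> (\<open>quant_ser_Suc\<close>): each \<open>H\<^sub>l\<close> is a linear
combination of multiplications from the left and from the right. Since
\<open>C\<^sub>k (z\<^sup>a f, g z*\<^sup>b) = z\<^sup>a C\<^sub>k (f, g) z*\<^sup>b\<close>, and since the operators in the claim have the same property, only
\<open>C\<^sub>k (z*\<^sup>J, z\<^sup>M)\<close> matters. The span of the functions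
\<open>(J, M) \<mapsto> (\<partial>/\<partial>z*)\<^sup>i z*\<^sup>J \<cdot> a \<cdot> (\<partial>/\<partial>z)\<^sup>m z\<^sup>M\<close> with \<open>a\<close> in the algebra is stable under multiplication by \<open>z\<close>
on the left and by \<open>y\<close> and \<open>z*\<close> on the right (\<open>symbols_left_z\<close>, \<open>symbols_right_y\<close>, \<open>symbols_right_zs\<close>),
hence under all \<open>H\<^sub>l\<close>, and so the recursion for \<open>C\<^sub>k\<close> does not leave it (\<open>symbols_berezin\<close>). Writing \<open>a\<close> in
the anti-normal order \<open>z*\<^sup>j z\<^sup>n\<close> gives the claimed form. Uniqueness of \<open>C\<^sub>k\<close> follows from the uniqueness of
power series coefficients and the faithfulness of the representation.\<close>

section \<open>Sums over finitely supported functions\<close>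

lemma keys_sum_superset:
  assumes "finite S" "Poly_Mapping.keys f \<subseteq> S" "\<And>w. F w 0 = 0"
  shows "(\<Sum>w\<in>Poly_Mapping.keys f. F w (Poly_Mapping.lookup f w)) = (\<Sum>w\<in>S. F w (Poly_Mapping.lookup f w))"
  by (rule sum.mono_neutral_left) (use assms in \<open>auto simp: in_keys_iff\<close>)

lemma keys_sum_add:
  assumes "\<And>w. F w 0 = 0" "\<And>w a b. F w (a + b) = F w a + F w b"
  shows "(\<Sum>w\<in>Poly_Mapping.keys (f + g). F w (Poly_Mapping.lookup (f + g) w)) =
    (\<Sum>w\<in>Poly_Mapping.keys f. F w (Poly_Mapping.lookup f w)) +
    (\<Sum>w\<in>Poly_Mapping.keys g. F w (Poly_Mapping.lookup g w))"
proof -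
  let ?S = "Poly_Mapping.keys f \<union> Poly_Mapping.keys g"
  have "Poly_Mapping.keys (f + g) \<subseteq> ?S" by (rule Poly_Mapping.keys_add)
  then show ?thesis
    using keys_sum_superset[of ?S "f + g" F] keys_sum_superset[of ?S f F] keys_sum_superset[of ?S g F]
    by (simp add: assms lookup_add sum.distrib)
qed

lemma keys_sum_single:
  assumes "F w 0 = 0"
  shows "(\<Sum>v\<in>Poly_Mapping.keys (Poly_Mapping.single w c). F v (Poly_Mapping.lookup (Poly_Mapping.single w c) v)) = F w c"
  using assms by (cases "c = 0") auto

lemma poly_mapping_single_induct [case_names single add]:
  assumes s: "\<And>w c. P (Poly_Mapping.single w c)" and a: "\<And>f g. P f \<Longrightarrow> P g \<Longrightarrow> P (f + g)"
  shows "P (f :: 'a \<Rightarrow>\<^sub>0 'b::comm_monoid_add)"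
proof -
  have "P (\<Sum>w\<in>S. Poly_Mapping.single w (Poly_Mapping.lookup f w))" if "finite S" for S
    using that
  proof (induction S)
    case empty
    show ?case using s[of undefined 0] by simp
  next
    case (insert x S)
    then show ?case using s a by simp
  qed
  moreover have "f = (\<Sum>w\<in>Poly_Mapping.keys f. Poly_Mapping.single w (Poly_Mapping.lookup f w))"
    by (simp add: poly_mapping_eqI lookup_sum lookup_single when_def in_keys_iff sum.delta)
  ultimately show ?thesis by (metis finite_keys)
qed

section \<open>Linear operators on polynomials\<close>

text \<open>These operators form a ring in which formulas in \<open>z\<close>, \<open>z*\<close> and \<open>y\<close> can be manipulated, and which
  has power series with coefficients in it. Linearity over the complex numbers makes an operator determined
  by its matrix.\<close>

typedef oper = "{f :: complex poly \<Rightarrow> complex poly.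
    (\<forall>x y. f (x + y) = f x + f y) \<and> (\<forall>c x. f (smult c x) = smult c (f x))}"
  morphisms app Oper
  by (rule exI[of _ "\<lambda>_. 0"]) simp

lemma app_add: "app X (x + y) = app X x + app X y"
  and app_smult: "app X (smult c x) = smult c (app X x)"
  using app[of X] by auto

lemma app_zero_right [simp]: "app X 0 = 0"
  using app_add[of X 0 0] by simp

lemma app_sum: "app X (\<Sum>i\<in>S. f i) = (\<Sum>i\<in>S. app X (f i))"
  by (induction S rule: infinite_finite_induct) (auto simp: app_add)

lemma oper_eqI: "(\<And>x. app X x = app Y x) \<Longrightarrow> X = Y"
  by (simp add: app_inject[symmetric] fun_eq_iff)

instantiation oper :: ring_1
begin
definition "0 = Oper (\<lambda>_. 0)"
definition "1 = Oper (\<lambda>x. x)"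
definition "X + Y = Oper (\<lambda>x. app X x + app Y x)"
definition "X - Y = Oper (\<lambda>x. app X x - app Y x)"
definition "- X = Oper (\<lambda>x. - app X x)"
definition "X * Y = Oper (\<lambda>x. app X (app Y x))"

lemma app_ring:
  "app 0 x = 0" "app 1 x = x" "app (X + Y) x = app X x + app Y x"
  "app (X - Y) x = app X x - app Y x" "app (- X) x = - app X x" "app (X * Y) x = app X (app Y x)"
  unfolding zero_oper_def one_oper_def plus_oper_def minus_oper_def uminus_oper_def times_oper_def
  by (subst Oper_inverse; auto simp: app_add app_smult smult_add_right smult_diff_right)+

instance
proof
  have "app (0::oper) 1 \<noteq> app 1 1" by (simp add: app_ring)
  then show "(0::oper) \<noteq> 1" by metis
qed (auto intro!: oper_eqI simp: app_ring app_add)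
end

lemma app_oper_sum: "app (\<Sum>i\<in>S. X i) x = (\<Sum>i\<in>S. app (X i) x)"
  by (induction S rule: infinite_finite_induct) (auto simp: app_ring)

definition scal :: "complex \<Rightarrow> oper" where "scal c = Oper (smult c)"

lemma app_scal [simp]: "app (scal c) x = smult c x"
  unfolding scal_def by (subst Oper_inverse) (auto simp: smult_add_right mult.commute)

lemma scal_hom: "scal (a + b) = scal a + scal b" "scal (a * b) = scal a * scal b"
  "scal 0 = 0" "scal 1 = 1" "scal (a - b) = scal a - scal b" "scal (- a) = - scal a"
  by (auto intro!: oper_eqI simp: app_ring smult_add_left smult_diff_left)

lemma scal_central: "X * scal c = scal c * X"
  by (auto intro!: oper_eqI simp: app_ring app_smult)

lemma scal_left_commute: "X * (scal c * Y) = scal c * (X * Y)"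
  by (metis mult.assoc scal_central)

lemma smult_sum_right: "smult a (\<Sum>i\<in>S. f i) = (\<Sum>i\<in>S. smult a (f i))"
  by (induction S rule: infinite_finite_induct) (auto simp: smult_add_right)

text \<open>The operator whose \<open>n\<close>-th column is the coefficient sequence of \<open>c n\<close>. Columns are polynomials, so
  they are finite; rows may be infinite.\<close>

definition of_cols :: "(nat \<Rightarrow> complex poly) \<Rightarrow> oper" where
  "of_cols c = Oper (\<lambda>p. \<Sum>n\<le>degree p. smult (coeff p n) (c n))"

lemma of_cols_bound:
  assumes "degree p \<le> N"
  shows "(\<Sum>n\<le>degree p. smult (coeff p n) (c n)) = (\<Sum>n\<le>N. smult (coeff p n) (c n))"
  by (rule sum.mono_neutral_left) (use assms in \<open>auto simp: coeff_eq_0\<close>)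

lemma app_of_cols: "app (of_cols c) p = (\<Sum>n\<le>degree p. smult (coeff p n) (c n))"
  unfolding of_cols_def
proof (subst Oper_inverse, safe)
  fix x y :: "complex poly"
  let ?N = "max (degree x) (degree y)"
  show "(\<Sum>n\<le>degree (x + y). smult (coeff (x + y) n) (c n)) =
    (\<Sum>n\<le>degree x. smult (coeff x n) (c n)) + (\<Sum>n\<le>degree y. smult (coeff y n) (c n))"
    using of_cols_bound[of "x + y" ?N c] of_cols_bound[of x ?N c] of_cols_bound[of y ?N c]
    by (simp add: degree_add_le smult_add_left sum.distrib)
next
  fix a and x :: "complex poly"
  show "(\<Sum>n\<le>degree (smult a x). smult (coeff (smult a x) n) (c n)) =
    smult a (\<Sum>n\<le>degree x. smult (coeff x n) (c n))"
    using of_cols_bound[of "smult a x" "degree x" c]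
    by (simp add: smult_sum_right)
qed

lemma app_of_cols_monom [simp]: "app (of_cols c) (monom a n) = smult a (c n)"
proof (cases "a = 0")
  case False
  then have "app (of_cols c) (monom a n) = (\<Sum>k\<le>n. if k = n then smult a (c k) else 0)"
    unfolding app_of_cols degree_monom_eq[OF False]
    by (intro sum.cong) auto
  then show ?thesis by simp
qed simp

lemma oper_eq_monomI:
  assumes "\<And>n. app X (monom 1 n) = app Y (monom 1 n)"
  shows "X = Y"
proof (rule oper_eqI)
  fix x :: "complex poly"
  have "app X x = app X (\<Sum>n\<le>degree x. monom (coeff x n) n)"
    by (simp add: poly_as_sum_of_monoms)
  also have "\<dots> = (\<Sum>n\<le>degree x. app X (smult (coeff x n) (monom 1 n)))"
    by (simp add: app_sum smult_monom)
  also have "\<dots> = (\<Sum>n\<le>degree x. app Y (smult (coeff x n) (monom 1 n)))"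
    by (simp only: app_smult assms)
  also have "\<dots> = app Y x"
    using poly_as_sum_of_monoms[of x] by (simp add: app_sum[symmetric] smult_monom)
  finally show "app X x = app Y x" .
qed

definition ent :: "oper \<Rightarrow> nat \<Rightarrow> nat \<Rightarrow> complex" where
  "ent X m n = coeff (app X (monom 1 n)) m"

lemma ent_eqI: "(\<And>m n. ent X m n = ent Y m n) \<Longrightarrow> X = Y"
  by (rule oper_eq_monomI, rule poly_eqI) (simp add: ent_def)

lemma ent_linear [simp]:
  "ent 0 m n = 0" "ent (X + Y) m n = ent X m n + ent Y m n" "ent (X - Y) m n = ent X m n - ent Y m n"
  "ent (- X) m n = - ent X m n" "ent (scal c * X) m n = c * ent X m n"
  by (simp_all add: ent_def app_ring)

lemma ent_sum: "ent (\<Sum>i\<in>S. X i) m n = (\<Sum>i\<in>S. ent (X i) m n)"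
  by (induction S rule: infinite_finite_induct) auto

lemma ent_of_cols: "ent (of_cols c) m n = coeff (c n) m"
  by (simp add: ent_def)

text \<open>The sum is finite because the columns of \<open>Y\<close> are; the explicit bound allows one index range for
  several columns or operators at once.\<close>

lemma ent_mult:
  assumes "\<And>l. l > L \<Longrightarrow> ent Y l n = 0"
  shows "ent (X * Y) m n = (\<Sum>l\<le>L. ent X m l * ent Y l n)"
proof -
  have "degree (app Y (monom 1 n)) \<le> L"
    using assms by (intro degree_le) (auto simp: ent_def)
  from poly_as_sum_of_monoms'[OF this]
  have "app Y (monom 1 n) = (\<Sum>l\<le>L. smult (ent Y l n) (monom 1 l))"
    by (simp add: smult_monom ent_def)
  then have "app (X * Y) (monom 1 n) = (\<Sum>l\<le>L. smult (ent Y l n) (app X (monom 1 l)))"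
    by (simp add: app_ring app_sum app_smult)
  then show ?thesis
    by (simp add: ent_def[of "X * Y"] ent_def[of X] coeff_sum mult.commute)
qed

lemma ent_bounded: "\<exists>L. \<forall>l>L. ent Y l n = 0"
  unfolding ent_def using coeff_eq_0 by blast

section \<open>Evaluation of the free algebra\<close>

definition ev :: "(complex \<Rightarrow> 'r::ring_1) \<Rightarrow> ('g \<Rightarrow> 'r) \<Rightarrow> 'g free_alg \<Rightarrow> 'r" where
  "ev s g f = (\<Sum>w\<in>Poly_Mapping.keys f. s (Poly_Mapping.lookup f w) * prod_list (map g (letters w)))"

text \<open>The complex numbers act on the target ring through a central homomorphism \<open>s\<close>. Operators and
  formal power series of operators are the two rings of interest.\<close>

locale scalars =
  fixes s :: "complex \<Rightarrow> 'r::ring_1"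
  assumes s_add: "s (a + b) = s a + s b" and s_mult: "s (a * b) = s a * s b"
    and s_1 [simp]: "s 1 = 1" and s_central: "x * s c = s c * x"
begin

lemma s_0 [simp]: "s 0 = 0"
  using s_add[of 0 0] by simp

lemma ev_add: "ev s g (a + b) = ev s g a + ev s g b"
  unfolding ev_def by (rule keys_sum_add) (auto simp: s_add distrib_right)

lemma ev_single: "ev s g (Poly_Mapping.single w c) = s c * prod_list (map g (letters w))"
  unfolding ev_def by (rule keys_sum_single) auto

lemma ev_mult: "ev s g (a * b) = ev s g a * ev s g b"
proof (induction a rule: poly_mapping_single_induct)
  case (single w c)
  show ?case
  proof (induction b rule: poly_mapping_single_induct)
    case (single v d)
    have "prod_list (map g (letters w)) * (s d * t) = s d * (prod_list (map g (letters w)) * t)" for t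
      by (metis s_central mult.assoc)
    then show ?case by (simp add: mult_single ev_single s_mult plus_fword_def mult.assoc)
  qed (simp add: distrib_left ev_add)
qed (simp add: distrib_right ev_add)

lemma ev_zero [simp]: "ev s g 0 = 0"
  by (simp add: ev_def)

lemma ev_uminus: "ev s g (- a) = - ev s g a"
  using ev_add[of g a "- a"] by (simp add: eq_neg_iff_add_eq_0 add.commute)

lemma ev_diff: "ev s g (a - b) = ev s g a - ev s g b"
  using ev_add[of g a "- b"] by (simp add: ev_uminus)

lemma ev_const [simp]: "ev s g (const c) = s c"
  by (simp add: const_def ev_single zero_fword_def)

lemma ev_one [simp]: "ev s g 1 = 1"
  using ev_const[of g 1] by (simp add: const_def)

lemma ev_gen [simp]: "ev s g (gen x) = g x"
  by (simp add: gen_def ev_single)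

lemma ev_power: "ev s g (a ^ n) = ev s g a ^ n"
  by (induction n) (auto simp: ev_mult)

lemma ev_sum: "ev s g (\<Sum>i\<in>S. f i) = (\<Sum>i\<in>S. ev s g (f i))"
  by (induction S rule: infinite_finite_induct) (auto simp: ev_add)

lemma ev_normal_form:
  "ev s g (normal_form x y f) = (\<Sum>(i, j)\<in>Poly_Mapping.keys f. s (Poly_Mapping.lookup f (i, j)) * g x ^ i * g y ^ j)"
  unfolding normal_form_def ev_sum by (intro sum.cong) (auto simp: ev_mult ev_power)

end

section \<open>Congruence modulo a two-sided ideal\<close>

lemma ideal_uminus: "x \<in> two_sided_ideal R \<Longrightarrow> - x \<in> two_sided_ideal R"
proof (induction rule: two_sided_ideal.induct)
  case (gens r a b)
  then show ?case using two_sided_ideal.gens[of r R "- a" b] by simp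
next
  case (add x y)
  from two_sided_ideal.add[OF add.IH] show ?case by (metis minus_add_distrib)
qed (auto intro: two_sided_ideal.zero)

lemma ideal_mult: "x \<in> two_sided_ideal R \<Longrightarrow> a * x * b \<in> two_sided_ideal R"
proof (induction rule: two_sided_ideal.induct)
  case (gens r c d)
  then show ?case using two_sided_ideal.gens[of r R "a * c" "d * b"] by (simp add: mult.assoc)
qed (auto intro: two_sided_ideal.intros simp: distrib_left distrib_right)

text \<open>A transitive relation, so that calculations modulo the ideal can be written as chains.\<close>

definition eqmod :: "'a::ring_1 set \<Rightarrow> 'a \<Rightarrow> 'a \<Rightarrow> bool" where
  "eqmod R a b \<longleftrightarrow> a - b \<in> two_sided_ideal R"

lemma eqmod_refl [simp]: "eqmod R a a"
  by (simp add: eqmod_def two_sided_ideal.zero)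

lemma eqmod_sym: "eqmod R a b \<Longrightarrow> eqmod R b a"
  unfolding eqmod_def using ideal_uminus by fastforce

lemma eqmod_add: "eqmod R a b \<Longrightarrow> eqmod R c d \<Longrightarrow> eqmod R (a + c) (b + d)"
  unfolding eqmod_def using two_sided_ideal.add[of "a - b" R "c - d"] by (simp add: algebra_simps)

lemma eqmod_trans [trans]: "eqmod R a b \<Longrightarrow> eqmod R b c \<Longrightarrow> eqmod R a c"
  unfolding eqmod_def using two_sided_ideal.add[of "a - b" R "b - c"] by simp

lemma eqmod_mult_left: "eqmod R a b \<Longrightarrow> eqmod R (c * a) (c * b)"
  unfolding eqmod_def using ideal_mult[of "a - b" R c 1] by (simp add: algebra_simps)

lemma eqmod_mult_right: "eqmod R a b \<Longrightarrow> eqmod R (a * c) (b * c)"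
  unfolding eqmod_def using ideal_mult[of "a - b" R 1 c] by (simp add: algebra_simps)

lemma eqmod_gens: "r \<in> R \<Longrightarrow> r = a - b \<Longrightarrow> eqmod R a b"
  unfolding eqmod_def using two_sided_ideal.gens[of r R 1 1] by simp

section \<open>The Fock representation of the quantum plane\<close>

text \<open>The basis vector of index \<open>0\<close> keeps the uniform shape \<open>monom 1 0\<close>, which the rules for the
  operators match.\<close>

declare monom_eq_1 [simp del]

lemma const_add: "const (a + b) = const a + const b"
  and const_mult: "const (a * b) = const a * const b"
  and const_1 [simp]: "const 1 = 1"
  and const_0 [simp]: "const 0 = 0"
  by (simp_all add: const_def single_add mult_single)

lemma word_Nil: "Poly_Mapping.single (Word []) 1 = 1"
  unfolding single_one[symmetric] zero_fword_def ..

lemma const_central: "a * const c = const c * a"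
  by (induction a rule: poly_mapping_single_induct) (simp_all add: const_def mult_single distrib_left distrib_right mult.commute)

lemma const_left_commute: "a * (const c * b) = const c * (a * b)"
  by (metis const_central mult.assoc)

lemma normal_form_single:
  "normal_form x y (Poly_Mapping.single (i, j) c) = const c * gen x ^ i * gen y ^ j"
  unfolding normal_form_def
  using keys_sum_single[of "\<lambda>(i, j) c. const c * gen x ^ i * gen y ^ j" "(i, j)" c]
  by (simp add: case_prod_beta)

lemma normal_form_add: "normal_form x y (f + g) = normal_form x y f + normal_form x y g"
proof -
  let ?F = "\<lambda>w c. const c * gen x ^ fst w * gen y ^ snd w"
  have "?F w 0 = 0" "?F w (a + b) = ?F w a + ?F w b" for w a b
    by (simp_all add: const_add distrib_right)
  from keys_sum_add[of ?F f g, OF this] show ?thesis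
    by (simp add: normal_form_def case_prod_beta)
qed

lemma normal_form_const_mult: "\<exists>h. const c * normal_form x y f = normal_form x y h"
proof (induction f rule: poly_mapping_single_induct)
  case (single w d)
  obtain i j where "w = (i, j)" by force
  then have "const c * normal_form x y (Poly_Mapping.single w d) = normal_form x y (Poly_Mapping.single w (c * d))"
    by (simp add: normal_form_single const_mult mult.assoc)
  then show ?case ..
next
  case (add f g)
  then obtain h h' where "const c * normal_form x y f = normal_form x y h" "const c * normal_form x y g = normal_form x y h'"
    by blast
  then show ?case by (intro exI[of _ "h + h'"]) (simp add: distrib_left normal_form_add)
qed

interpretation scal: scalars scal
  by standard (simp_all add: scal_hom, rule scal_central)

locale qdisc =
  fixes q :: real
  assumes q_pos: "0 < q" and q_less_1: "q < 1"
begin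

definition Q :: complex where "Q = of_real (q ^ 2)"

lemma Q_power: "Q ^ n = of_real (q ^ (2 * n))"
  by (simp add: Q_def power_mult)

lemma Q_power_inj: "Q ^ m = Q ^ n \<longleftrightarrow> m = n"
proof -
  have q2: "0 < q\<^sup>2" "q\<^sup>2 < 1"
    using q_pos q_less_1 by (simp_all add: abs_square_less_1)
  have "(q\<^sup>2) ^ m = (q\<^sup>2) ^ n \<longleftrightarrow> m = n"
  proof (cases m n rule: linorder_cases)
    case less
    then show ?thesis using power_strict_decreasing[OF less q2] by linarith
  next
    case greater
    then show ?thesis using power_strict_decreasing[OF greater q2] by linarith
  qed simp
  then show ?thesis unfolding Q_power power_mult of_real_eq_iff .
qed

lemma Q_nonzero [simp]: "Q \<noteq> 0"
  using q_pos by (simp add: Q_def)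

lemma one_minus_Q_power [simp]: "1 - Q ^ n = 0 \<longleftrightarrow> n = 0"
  using Q_power_inj[of 0 n] by auto

lemma Q_power_eq_1 [simp]: "Q ^ n = 1 \<longleftrightarrow> n = 0"
  using Q_power_inj[of n 0] by simp

lemma Q_neq_1 [simp]: "Q \<noteq> 1" "1 \<noteq> Q"
  using one_minus_Q_power[of 1] by auto

definition z :: oper where "z = of_cols (\<lambda>n. monom 1 (Suc n))"
definition zs :: oper where "zs = of_cols (\<lambda>n. monom (1 - Q ^ n) (n - 1))"
definition y :: oper where "y = of_cols (\<lambda>n. monom (Q ^ n) n)"

lemma app_z [simp]: "app z (monom a n) = monom a (Suc n)"
  and app_zs [simp]: "app zs (monom a n) = monom (a * (1 - Q ^ n)) (n - 1)"
  and app_y [simp]: "app y (monom a n) = monom (a * Q ^ n) n"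
  by (simp_all add: z_def zs_def y_def smult_monom)

lemma zs_z: "zs * z = scal Q * z * zs + scal (1 - Q)"
proof (rule oper_eq_monomI)
  fix n show "app (zs * z) (monom 1 n) = app (scal Q * z * zs + scal (1 - Q)) (monom 1 n)"
    by (cases n) (auto simp: app_ring smult_monom add_monom algebra_simps)
qed

lemma y_eq: "y = 1 - z * zs"
proof (rule oper_eq_monomI)
  fix n show "app y (monom 1 n) = app (1 - z * zs) (monom 1 n)"
    by (cases n) (auto simp: app_ring diff_monom)
qed

lemma y_z: "y * z = scal Q * (z * y)"
  by (rule oper_eq_monomI) (simp add: app_ring smult_monom)

lemma zs_y: "zs * y = scal Q * (y * zs)"
proof (rule oper_eq_monomI)
  fix n show "app (zs * y) (monom 1 n) = app (scal Q * (y * zs)) (monom 1 n)"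
    by (cases n) (auto simp: app_ring smult_monom)
qed

definition genop :: "pgen \<Rightarrow> oper" where
  "genop x = (case x of Z \<Rightarrow> z | Zs \<Rightarrow> zs)"

lemma genop_simps [simp]: "genop Z = z" "genop Zs = zs"
  by (simp_all add: genop_def)

abbreviation eval_op :: "pgen free_alg \<Rightarrow> oper" where "eval_op \<equiv> ev scal genop"

abbreviation pol_rel :: "pgen free_alg set" where
  "pol_rel \<equiv> {gen Zs * gen Z - const (of_real (q^2)) * gen Z * gen Zs - const (of_real (1 - q^2))}"

lemma eval_op_ideal: "a \<in> pol_ideal q \<Longrightarrow> eval_op a = 0"
  unfolding pol_ideal_def
proof (induction rule: two_sided_ideal.induct)
  case (gens r a b)
  then have "r = gen Zs * gen Z - const Q * gen Z * gen Zs - const (1 - Q)"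
    by (simp add: Q_def)
  then have "eval_op r = 0"
    by (simp add: scal.ev_mult scal.ev_diff zs_z)
  then show ?case by (simp add: scal.ev_mult)
qed (auto simp: scal.ev_add)

lemma eqmod_zs_z: "eqmod pol_rel (gen Zs * gen Z) (const Q * gen Z * gen Zs + const (1 - Q))"
  by (rule eqmod_gens[OF insertI1]) (simp add: Q_def)

text \<open>Moving one \<open>z*\<close> through \<open>z\<^sup>i\<close> is what makes the set of normal forms stable under left
  multiplication by \<open>z*\<close>.\<close>

lemma eqmod_zs_z_power:
  "eqmod pol_rel (gen Zs * gen Z ^ i) (const (Q ^ i) * gen Z ^ i * gen Zs + const (1 - Q ^ i) * gen Z ^ (i - 1))"
proof (induction i)
  case (Suc i)
  have "eqmod pol_rel (gen Zs * gen Z ^ Suc i)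
      ((const (Q ^ i) * gen Z ^ i * gen Zs + const (1 - Q ^ i) * gen Z ^ (i - 1)) * gen Z)"
    unfolding power_Suc2 mult.assoc[symmetric] by (rule eqmod_mult_right[OF Suc])
  also have "(const (Q ^ i) * gen Z ^ i * gen Zs + const (1 - Q ^ i) * gen Z ^ (i - 1)) * gen Z =
     const (Q ^ i) * gen Z ^ i * (gen Zs * gen Z) + const (1 - Q ^ i) * gen Z ^ i"
    by (cases i) (simp_all add: distrib_right mult.assoc power_commutes)
  also have "eqmod pol_rel \<dots> (const (Q ^ i) * gen Z ^ i * (const Q * gen Z * gen Zs + const (1 - Q)) + const (1 - Q ^ i) * gen Z ^ i)"
    by (intro eqmod_add eqmod_mult_left eqmod_zs_z eqmod_refl)
  also have "const (Q ^ i) * gen Z ^ i * (const Q * gen Z * gen Zs + const (1 - Q)) + const (1 - Q ^ i) * gen Z ^ i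
     = const (Q ^ i * Q) * gen Z ^ Suc i * gen Zs + const (Q ^ i * (1 - Q) + (1 - Q ^ i)) * gen Z ^ i"
  proof -
    have "const (Q ^ i) * gen Z ^ i * (const Q * gen Z * gen Zs) = const (Q ^ i * Q) * gen Z ^ Suc i * gen Zs"
      using const_left_commute[of "gen Z ^ i" Q "gen Z * gen Zs"]
      by (simp add: const_mult mult.assoc power_Suc2 del: power_Suc)
    moreover have "const (Q ^ i) * gen Z ^ i * const (1 - Q) = const (Q ^ i * (1 - Q)) * gen Z ^ i"
      using const_central[of "gen Z ^ i" "1 - Q"] by (simp add: const_mult mult.assoc)
    ultimately show ?thesis
      by (simp only: distrib_left const_add distrib_right add.assoc)
  qed
  finally show ?case by (simp add: algebra_simps)
qed simp

text \<open>Words are reduced from the right: multiplying a normal form by one more letter on the left gives a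
  normal form again.\<close>

lemma normal_form_exists: "\<exists>h. eqmod pol_rel a (normal_form Z Zs h)"
proof (induction a rule: poly_mapping_single_induct)
  case (single w c)
  have "\<exists>h. eqmod pol_rel (Poly_Mapping.single (Word l) 1) (normal_form Z Zs h)" for l
  proof (induction l)
    case Nil
    have "Poly_Mapping.single (Word []) 1 = normal_form Z Zs (mono 0 0)"
      by (simp add: mono_def normal_form_single word_Nil)
    then show ?case by (metis eqmod_refl)
  next
    case (Cons x l)
    then obtain h where h: "eqmod pol_rel (Poly_Mapping.single (Word l) 1) (normal_form Z Zs h)" ..
    have step: "\<exists>h'. eqmod pol_rel (gen x * normal_form Z Zs h) (normal_form Z Zs h')"
    proof (induction h rule: poly_mapping_single_induct)
      case (add f g)
      then obtain f' g' where "eqmod pol_rel (gen x * normal_form Z Zs f) (normal_form Z Zs f')"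
        "eqmod pol_rel (gen x * normal_form Z Zs g) (normal_form Z Zs g')" by blast
      from eqmod_add[OF this] show ?case
        by (intro exI[of _ "f' + g'"]) (simp add: distrib_left normal_form_add)
    next
      case (single w c)
      obtain i j where w: "w = (i, j)" by force
      show ?case
      proof (cases x)
        case Z
        then have "gen x * normal_form Z Zs (Poly_Mapping.single w c) = normal_form Z Zs (Poly_Mapping.single (Suc i, j) c)"
          unfolding w normal_form_single by (simp add: mult.assoc const_left_commute)
        then show ?thesis by (metis eqmod_refl)
      next
        case Zs
        have "gen x * normal_form Z Zs (Poly_Mapping.single w c) = const c * (gen Zs * gen Z ^ i * gen Zs ^ j)"
          unfolding w normal_form_single Zs by (simp add: mult.assoc const_left_commute)
        also have "eqmod pol_rel \<dots> (const c * ((const (Q ^ i) * gen Z ^ i * gen Zs + const (1 - Q ^ i) * gen Z ^ (i - 1)) * gen Zs ^ j))"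
          by (intro eqmod_mult_left eqmod_mult_right eqmod_zs_z_power)
        also have "\<dots> = normal_form Z Zs (Poly_Mapping.single (i, Suc j) (c * Q ^ i) + Poly_Mapping.single (i - 1, j) (c * (1 - Q ^ i)))"
          unfolding normal_form_add normal_form_single const_mult
          by (simp add: distrib_left distrib_right mult.assoc)
        finally show ?thesis by blast
      qed
    qed
    have "Poly_Mapping.single (Word (x # l)) (1::complex) = gen x * Poly_Mapping.single (Word l) 1"
      by (simp add: gen_def mult_single plus_fword_def)
    moreover obtain h' where "eqmod pol_rel (gen x * normal_form Z Zs h) (normal_form Z Zs h')"
      using step ..
    ultimately show ?case
      using eqmod_trans[OF eqmod_mult_left[OF h, of "gen x"]] by (intro exI[of _ h']) simp
  qed
  then obtain h where h: "eqmod pol_rel (Poly_Mapping.single w 1) (normal_form Z Zs h)"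
    by (metis fword.collapse)
  have "Poly_Mapping.single w c = const c * Poly_Mapping.single w 1"
    by (simp add: const_def mult_single)
  moreover obtain h' where "const c * normal_form Z Zs h = normal_form Z Zs h'"
    using normal_form_const_mult[of c Z Zs h] by blast
  ultimately show ?case
    using eqmod_mult_left[OF h, of "const c"] by (intro exI[of _ h']) simp
next
  case (add f g)
  then obtain f' g' where "eqmod pol_rel f (normal_form Z Zs f')" "eqmod pol_rel g (normal_form Z Zs g')"
    by blast
  from eqmod_add[OF this] show ?case
    by (intro exI[of _ "f' + g'"]) (simp add: normal_form_add)
qed

section \<open>Faithfulness\<close>

definition rep :: "pol \<Rightarrow> oper" where
  "rep f = (\<Sum>(i, j)\<in>Poly_Mapping.keys f. scal (Poly_Mapping.lookup f (i, j)) * z ^ i * zs ^ j)"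

lemma eval_op_normal_form: "eval_op (normal_form Z Zs f) = rep f"
  by (simp add: scal.ev_normal_form rep_def)

lemma rep_add: "rep (f + g) = rep f + rep g"
proof -
  let ?F = "\<lambda>w c. scal c * z ^ fst w * zs ^ snd w"
  have "?F w 0 = 0" "?F w (a + b) = ?F w a + ?F w b" for w a b
    by (simp_all add: scal_hom distrib_right)
  from keys_sum_add[of ?F f g, OF this] show ?thesis
    by (simp add: rep_def case_prod_beta)
qed

lemma rep_single: "rep (Poly_Mapping.single (i, j) c) = scal c * (z ^ i * zs ^ j)"
  unfolding rep_def using keys_sum_single[of "\<lambda>(i, j) c. scal c * z ^ i * zs ^ j" "(i, j)" c]
  by (simp add: case_prod_beta scal_hom mult.assoc)

lemma rep_mono: "rep (mono i j) = z ^ i * zs ^ j"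
  by (simp add: mono_def rep_single scal_hom)

lemma rep_zero [simp]: "rep 0 = 0"
  by (simp add: rep_def)

lemma rep_uminus: "rep (- f) = - rep f"
  using rep_add[of f "- f"] by (simp add: eq_neg_iff_add_eq_0 add.commute)

lemma rep_diff: "rep (f - g) = rep f - rep g"
  using rep_add[of f "- g"] by (simp add: rep_uminus)

lemma rep_sum: "rep (\<Sum>i\<in>S. f i) = (\<Sum>i\<in>S. rep (f i))"
  by (induction S rule: infinite_finite_induct) (auto simp: rep_add)

lemma lookup_pscale [simp]: "Poly_Mapping.lookup (pscale c f) k = c * Poly_Mapping.lookup f k"
  unfolding pscale_def by (simp add: Poly_Mapping.map.rep_eq when_def)

lemma pscale_single [simp]: "pscale c (Poly_Mapping.single w d) = Poly_Mapping.single w (c * d)"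
  by (rule poly_mapping_eqI) (simp add: lookup_single when_def)

lemma pscale_add: "pscale c (f + g) = pscale c f + pscale c g"
  by (rule poly_mapping_eqI) (simp add: lookup_add distrib_left)

lemma rep_pscale: "rep (pscale c f) = scal c * rep f"
proof (induction f rule: poly_mapping_single_induct)
  case (single w d)
  show ?case by (cases w) (simp add: rep_single scal_hom mult.assoc)
qed (simp add: pscale_add rep_add distrib_left)

text \<open>The coefficient in \<open>z*\<^sup>j e\<^sub>n = (1 - q\<^sup>2\<^sup>n) \<cdots> (1 - q\<^sup>2\<^sup>(\<^sup>n\<^sup>-\<^sup>j\<^sup>+\<^sup>1\<^sup>)) e\<^sub>n\<^sub>-\<^sub>j\<close>. For \<open>n < j\<close> the factor with \<open>k = n\<close>
  vanishes, so truncated subtraction does no harm.\<close>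

definition zs_coeff :: "nat \<Rightarrow> nat \<Rightarrow> complex" where
  "zs_coeff j n = (\<Prod>k<j. 1 - Q ^ (n - k))"

lemma zs_coeff_eq_0: "zs_coeff j n = 0 \<longleftrightarrow> n < j"
proof
  assume "n < j"
  then show "zs_coeff j n = 0" unfolding zs_coeff_def by (intro prod_zero) (auto intro!: bexI[of _ n])
qed (auto simp: zs_coeff_def)

lemma app_zs_power: "app (zs ^ j) (monom a n) = monom (a * zs_coeff j n) (n - j)"
  by (induction j) (auto simp: zs_coeff_def app_ring mult.assoc)

lemma app_z_power: "app (z ^ i) (monom a n) = monom a (n + i)"
  by (induction i) (auto simp: app_ring)

lemma ent_monomial: "ent (z ^ i * zs ^ j) r c = (if j \<le> c \<and> r = c - j + i then zs_coeff j c else 0)"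
  using zs_coeff_eq_0[of j c] by (auto simp: ent_def app_ring app_zs_power app_z_power)

text \<open>The matrix of \<open>z\<^sup>i z*\<^sup>j\<close> vanishes in the columns before \<open>j\<close> and has its only entry of column \<open>j\<close> in row
  \<open>i\<close>. So the coefficients of \<open>f\<close> with second index \<open>j\<close> can be read off from column \<open>j\<close> once those with
  smaller second index are known to vanish.\<close>

lemma rep_eq_0:
  assumes "rep f = 0"
  shows "f = 0"
proof -
  have "\<forall>i. Poly_Mapping.lookup f (i, j) = 0" for j
  proof (induction j rule: less_induct)
    case (less j)
    show ?case
    proof
      fix i
      have "ent (rep f) i j = (\<Sum>w\<in>Poly_Mapping.keys f. if w = (i, j) then Poly_Mapping.lookup f (i, j) * zs_coeff j j else 0)"
        unfolding rep_def ent_sum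
      proof (intro sum.cong refl)
        fix w assume "w \<in> Poly_Mapping.keys f"
        obtain k l where w: "w = (k, l)" by force
        show "ent (case w of (i, j) \<Rightarrow> scal (Poly_Mapping.lookup f (i, j)) * z ^ i * zs ^ j) i j =
          (if w = (i, j) then Poly_Mapping.lookup f (i, j) * zs_coeff j j else 0)"
          using less[of l] by (auto simp: w mult.assoc ent_monomial)
      qed
      also have "\<dots> = Poly_Mapping.lookup f (i, j) * zs_coeff j j"
        by (simp add: sum.delta in_keys_iff)
      finally show "Poly_Mapping.lookup f (i, j) = 0"
        using assms by (simp add: zs_coeff_eq_0)
    qed
  qed
  then show ?thesis by (intro poly_mapping_eqI) auto
qed

lemma rep_inj: "rep f = rep g \<longleftrightarrow> f = g"
  using rep_eq_0[of "f - g"] by (auto simp: rep_diff)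

text \<open>Reduction to normal form and faithfulness on normal forms together turn congruence into equality of
  operators.\<close>

lemma pol_ideal_iff: "a \<in> pol_ideal q \<longleftrightarrow> eval_op a = 0"
proof
  assume a: "eval_op a = 0"
  obtain h where h: "a - normal_form Z Zs h \<in> pol_ideal q"
    using normal_form_exists[of a] unfolding eqmod_def pol_ideal_def by blast
  from eval_op_ideal[OF this] a have "h = 0"
    using rep_eq_0 by (simp add: scal.ev_diff eval_op_normal_form)
  then show "a \<in> pol_ideal q" using h by (simp add: normal_form_def)
qed (rule eval_op_ideal)

lemma eval_op_in_range: "eval_op a \<in> range rep"
proof -
  obtain h where "a - normal_form Z Zs h \<in> pol_ideal q"
    using normal_form_exists[of a] unfolding eqmod_def pol_ideal_def by blast
  from eval_op_ideal[OF this] show ?thesis by (auto simp: scal.ev_diff eval_op_normal_form)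
qed

lemma rep_pmul: "rep (pmul q f g) = rep f * rep g"
proof -
  have "rep f * rep g \<in> range rep"
    using eval_op_in_range[of "normal_form Z Zs f * normal_form Z Zs g"]
    by (simp add: scal.ev_mult eval_op_normal_form)
  then obtain h where h: "rep h = rep f * rep g" by (metis imageE)
  have "rep f * rep g - rep h = 0 \<longleftrightarrow> rep h = rep f * rep g" for h by auto
  then have "pmul q f g = (THE h. rep h = rep f * rep g)"
    unfolding pmul_def pol_ideal_iff scal.ev_diff scal.ev_mult eval_op_normal_form
    by presburger
  also have "\<dots> = h" by (intro the_equality) (simp_all add: h rep_inj[symmetric])
  finally show ?thesis by (simp add: h)
qed

definition alg :: "oper set" where "alg = range rep"

lemma alg_rep [simp, intro]: "rep f \<in> alg"
  by (simp add: alg_def)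

lemma alg_add [intro]: "X \<in> alg \<Longrightarrow> Y \<in> alg \<Longrightarrow> X + Y \<in> alg"
  unfolding alg_def by (auto simp flip: rep_add)

lemma alg_mult [intro]: "X \<in> alg \<Longrightarrow> Y \<in> alg \<Longrightarrow> X * Y \<in> alg"
  unfolding alg_def by (auto simp flip: rep_pmul)

lemma alg_diff [intro]: "X \<in> alg \<Longrightarrow> Y \<in> alg \<Longrightarrow> X - Y \<in> alg"
  unfolding alg_def by (auto simp flip: rep_diff)

lemma alg_zero [intro, simp]: "0 \<in> alg" using alg_rep[of 0] by simp
lemma alg_z [intro, simp]: "z \<in> alg" using alg_rep[of "mono 1 0"] by (simp add: rep_mono)
lemma alg_zs [intro, simp]: "zs \<in> alg" using alg_rep[of "mono 0 1"] by (simp add: rep_mono)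
lemma alg_scal [intro, simp]: "scal c \<in> alg" using alg_rep[of "pscale c (mono 0 0)"] by (simp add: rep_mono rep_pscale)
lemma alg_one [intro, simp]: "1 \<in> alg" using alg_rep[of "mono 0 0"] by (simp add: rep_mono)
lemma alg_y [intro, simp]: "y \<in> alg" unfolding y_eq by auto
lemma alg_power [intro]: "X \<in> alg \<Longrightarrow> X ^ n \<in> alg" by (induction n) auto
lemma alg_sum [intro]: "(\<And>i. i \<in> S \<Longrightarrow> f i \<in> alg) \<Longrightarrow> sum f S \<in> alg"
  by (induction S rule: infinite_finite_induct) auto

definition unrep :: "oper \<Rightarrow> pol" where "unrep X = inv rep X"

lemma rep_unrep: "X \<in> alg \<Longrightarrow> rep (unrep X) = X"
  unfolding alg_def unrep_def by (rule f_inv_into_f)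

section \<open>The decomposition by powers of \<open>z\<close> and \<open>z*\<close>\<close>

text \<open>The factor by which the entry \<open>(r, c)\<close> of the matrix of \<open>\<psi>\<^sub>-\<^sub>m(y) z*\<^sup>m\<close>, \<open>m = c - r\<close>, differs from
  \<open>\<psi>\<^sub>-\<^sub>m(q\<^sup>2\<^sup>r)\<close>. On and below the diagonal it is \<open>1\<close>.\<close>

definition wt :: "nat \<Rightarrow> nat \<Rightarrow> complex" where
  "wt r c = (\<Prod>k\<in>{r<..c}. 1 - Q ^ k)"

lemma wt_nonzero [simp]: "wt r c \<noteq> 0"
  by (auto simp: wt_def)

lemma wt_ge: "c \<le> r \<Longrightarrow> wt r c = 1"
  by (simp add: wt_def)

lemma zs_coeff_wt: "M \<le> c \<Longrightarrow> zs_coeff M c = wt (c - M) c"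
proof (induction M)
  case (Suc M)
  have "wt (c - Suc M) c = (1 - Q ^ (c - M)) * wt (c - M) c"
  proof -
    have "{c - Suc M<..c} = insert (c - M) {c - M<..c}" using Suc.prems by auto
    then show ?thesis by (simp add: wt_def)
  qed
  then show ?case using Suc by (simp add: zs_coeff_def)
qed (simp add: zs_coeff_def wt_def)

lemma zs_coeff_add: "zs_coeff (a + b) c = zs_coeff a c * zs_coeff b (c - a)"
  unfolding zs_coeff_def by (induction b) (auto simp: algebra_simps)

text \<open>As a function of \<open>n\<close> the coefficient is a polynomial in \<open>q\<^sup>2\<^sup>n\<close>: this is \<open>z\<^sup>m z*\<^sup>m\<close> written as a
  polynomial in \<open>y\<close>.\<close>

lemma zs_coeff_poly: "zs_coeff m n = poly (\<Prod>k<m. [:1, - (1 / Q ^ k):]) (Q ^ n)"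
proof (cases "m \<le> n")
  case True
  then show ?thesis unfolding zs_coeff_def poly_prod
    by (intro prod.cong) (auto simp: power_diff)
next
  case False
  then have "(\<Prod>k<m. poly [:1, - (1 / Q ^ k):] (Q ^ n)) = 0"
    by (intro prod_zero bexI[of _ n]) auto
  then show ?thesis using False zs_coeff_eq_0[of m n] by (simp add: poly_prod)
qed

text \<open>For a monomial \<open>z\<^sup>i z*\<^sup>j\<close> only \<open>\<psi>\<^sub>i\<^sub>-\<^sub>j\<close> is nonzero; it is the polynomial that expresses
  \<open>z\<^sup>m z*\<^sup>m\<close>, \<open>m = min i j\<close>, by \<open>y\<close>.\<close>

lemma psi_exists:
  "\<exists>\<psi>. finite {m. \<psi> m \<noteq> 0} \<and> (\<forall>r c. ent (rep f) r c = poly (\<psi> (int r - int c)) (Q ^ min r c) * wt r c)"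
proof (induction f rule: poly_mapping_single_induct)
  case (single w a)
  obtain i j where w: "w = (i, j)" by force
  let ?m = "min i j"
  let ?p = "smult a (\<Prod>k<?m. [:1, - (1 / Q ^ k):])"
  let ?\<psi> = "\<lambda>m. if m = int i - int j then ?p else 0"
  have "ent (rep (Poly_Mapping.single w a)) r c = poly (?\<psi> (int r - int c)) (Q ^ min r c) * wt r c" for r c
  proof (cases "int r - int c = int i - int j")
    case False
    then show ?thesis by (auto simp: w rep_single ent_monomial)
  next
    case True
    have "zs_coeff ?m (min r c) * wt r c = (if j \<le> c \<and> r = c - j + i then zs_coeff j c else 0)"
    proof (cases "j \<le> i")
      case ij: True
      then show ?thesis using True by (auto simp: wt_ge min_def zs_coeff_eq_0)
    next
      case ij: False
      then have m: "?m = i" "min r c = r" using True by auto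
      show ?thesis
      proof (cases "i \<le> r")
        case ir: True
        then have "zs_coeff j c = zs_coeff (j - i) c * zs_coeff i (c - (j - i))"
          using zs_coeff_add[of "j - i" i c] ij by simp
        also have "c - (j - i) = r" using True ij by linarith
        also have "zs_coeff (j - i) c = wt (c - (j - i)) c" using True ij by (intro zs_coeff_wt) linarith
        also have "c - (j - i) = r" using True ij by linarith
        finally show ?thesis using True ij ir m by auto
      next
        case ir: False
        then show ?thesis using True ij m zs_coeff_eq_0[of i r] by auto
      qed
    qed
    then show ?thesis using True by (auto simp: w rep_single ent_monomial zs_coeff_poly[symmetric])
  qed
  moreover have "finite {m. ?\<psi> m \<noteq> 0}"
    by (rule finite_subset[of _ "{int i - int j}"]) auto
  ultimately show ?case by (intro exI[of _ ?\<psi>] conjI allI)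
next
  case (add f g)
  then obtain \<psi> \<psi>' where 1: "finite {m. \<psi> m \<noteq> 0}" "\<And>r c. ent (rep f) r c = poly (\<psi> (int r - int c)) (Q ^ min r c) * wt r c"
    and 2: "finite {m. \<psi>' m \<noteq> 0}" "\<And>r c. ent (rep g) r c = poly (\<psi>' (int r - int c)) (Q ^ min r c) * wt r c"
    by blast
  have "finite {m. \<psi> m + \<psi>' m \<noteq> 0}"
    by (rule finite_subset[OF _ finite_UnI[OF 1(1) 2(1)]]) auto
  then show ?case
    by (intro exI[of _ "\<lambda>m. \<psi> m + \<psi>' m"]) (simp add: rep_add 1(2) 2(2) distrib_right)
qed

definition comp_op :: "int \<Rightarrow> complex poly \<Rightarrow> oper" where
  "comp_op m p = eval_op (if 0 \<le> m then gen Z ^ nat m * at_y p else at_y p * gen Zs ^ nat (- m))"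

lemma app_y_power: "app (y ^ i) (monom a n) = monom (a * (Q ^ n) ^ i) n"
  by (induction i) (auto simp: app_ring mult.assoc mult.commute)

lemma app_at_y: "app (eval_op (at_y p)) (monom a n) = monom (a * poly p (Q ^ n)) n"
proof -
  have "eval_op (at_y p) = (\<Sum>i\<le>degree p. scal (coeff p i) * y ^ i)"
    by (simp add: at_y_def scal.ev_sum scal.ev_mult scal.ev_power scal.ev_diff y_eq)
  then show ?thesis
    by (simp add: app_oper_sum app_ring app_y_power smult_monom monom_sum poly_altdef sum_distrib_left algebra_simps)
qed

lemma ent_comp_op: "ent (comp_op m p) r c = (if m = int r - int c then poly p (Q ^ min r c) * wt r c else 0)"
proof (cases "0 \<le> m")
  case True
  then show ?thesis
    by (auto simp: comp_op_def scal.ev_mult scal.ev_power ent_def app_ring app_at_y app_z_power wt_ge)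
next
  case False
  then show ?thesis
    using zs_coeff_wt[of "nat (- m)" c] zs_coeff_eq_0[of "nat (- m)" c]
    by (auto simp: comp_op_def scal.ev_mult scal.ev_power ent_def app_ring app_at_y app_zs_power min_def)
qed

text \<open>The summands of the decomposition live on different diagonals, so the decomposition holds if and only
  if each entry of the matrix of \<open>f\<close> is the entry of the only summand on its diagonal.\<close>

lemma psi_cond_iff:
  assumes "finite {m. \<psi> m \<noteq> 0}"
  shows "normal_form Z Zs f
     - (\<Sum>m | \<psi> m \<noteq> 0. if 0 \<le> m then gen Z ^ nat m * at_y (\<psi> m) else at_y (\<psi> m) * gen Zs ^ nat (- m))
     \<in> pol_ideal q \<longleftrightarrow> (\<forall>r c. ent (rep f) r c = poly (\<psi> (int r - int c)) (Q ^ min r c) * wt r c)"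
proof -
  let ?S = "\<Sum>m | \<psi> m \<noteq> 0. comp_op m (\<psi> m)"
  have S: "ent ?S r c = poly (\<psi> (int r - int c)) (Q ^ min r c) * wt r c" for r c
  proof -
    have "ent ?S r c = (\<Sum>m | \<psi> m \<noteq> 0. if m = int r - int c then poly (\<psi> m) (Q ^ min r c) * wt r c else 0)"
      unfolding ent_sum ent_comp_op ..
    also have "\<dots> = poly (\<psi> (int r - int c)) (Q ^ min r c) * wt r c"
      unfolding sum.delta[OF assms] by simp
    finally show ?thesis .
  qed
  have "eval_op (normal_form Z Zs f
     - (\<Sum>m | \<psi> m \<noteq> 0. if 0 \<le> m then gen Z ^ nat m * at_y (\<psi> m) else at_y (\<psi> m) * gen Zs ^ nat (- m)))
     = rep f - ?S"
    unfolding scal.ev_diff scal.ev_sum eval_op_normal_form comp_op_def ..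
  moreover have "rep f - ?S = 0 \<longleftrightarrow> (\<forall>r c. ent (rep f) r c = ent ?S r c)"
    using ent_eqI[of "rep f" ?S] by auto
  ultimately show ?thesis unfolding pol_ideal_iff S by simp
qed

text \<open>This identifies formal series with matrices. Uniqueness of \<open>\<psi>\<^sub>m\<close> holds because the points \<open>q\<^sup>2\<^sup>n\<close> are
  infinitely many.\<close>

lemma emb_ent: "emb q f (int r - int c) (min r c) * wt r c = ent (rep f) r c"
proof -
  let ?C = "\<lambda>\<psi>. finite {m. \<psi> m \<noteq> 0} \<and> (\<forall>r c. ent (rep f) r c = poly (\<psi> (int r - int c)) (Q ^ min r c) * wt r c)"
  obtain \<psi> where \<psi>: "?C \<psi>" using psi_exists by blast
  have "\<phi> = \<psi>" if "?C \<phi>" for \<phi>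
  proof
    fix m
    have "poly (\<phi> m) (Q ^ n) = poly (\<psi> m) (Q ^ n)" for n
    proof -
      have m: "int (n + nat m) - int (n + nat (- m)) = m" "min (n + nat m) (n + nat (- m)) = n" by auto
      have "poly (\<phi> m) (Q ^ n) * wt (n + nat m) (n + nat (- m)) = poly (\<psi> m) (Q ^ n) * wt (n + nat m) (n + nat (- m))"
        using that \<psi> m by metis
      then show ?thesis by simp
    qed
    then have "range (\<lambda>n. Q ^ n) \<subseteq> {x. poly (\<phi> m - \<psi> m) x = 0}" by auto
    moreover have "infinite (range (\<lambda>n. Q ^ n))"
      by (rule range_inj_infinite) (auto simp: inj_def Q_power_inj)
    ultimately have "\<phi> m - \<psi> m = 0" using poly_roots_finite finite_subset by blast
    then show "\<phi> m = \<psi> m" by simp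
  qed
  moreover have "psi q f = (THE \<psi>. ?C \<psi>)"
    unfolding psi_def by (intro arg_cong[where f = The] ext conj_cong refl psi_cond_iff)
  ultimately have "psi q f = \<psi>" using \<psi> by (simp add: the_equality)
  then show ?thesis using \<psi> by (simp add: emb_def Q_power)
qed

end

section \<open>Partial derivatives\<close>

lemma ext_d_single: "ext_d (Poly_Mapping.single w c) = const c * ext_d_word (letters w)"
  unfolding ext_d_def by (rule keys_sum_single) simp

lemma ext_d_add: "ext_d (a + b) = ext_d a + ext_d b"
  unfolding ext_d_def by (rule keys_sum_add) (simp_all add: const_add distrib_right)

interpretation fscal: scalars "\<lambda>c. fps_const (scal c)"
proof
  fix c x
  show "x * fps_const (scal c) = fps_const (scal c) * x"
    by (rule fps_ext) (simp add: scal_central[of _ c])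
qed (simp_all add: scal_hom)

context qdisc
begin

abbreviation "fz \<equiv> gen (Fn Z)"
abbreviation "fzs \<equiv> gen (Fn Zs)"
abbreviation "fdz \<equiv> gen (Df Z)"
abbreviation "fdzs \<equiv> gen (Df Zs)"

definition P :: complex where "P = 1 / Q"

lemma P_Q [simp]: "P * Q = 1" "Q * P = 1"
  by (simp_all add: P_def)

definition form_rel :: "fgen free_alg set" where
  "form_rel = {(1 - fzs * fz) - const Q * (1 - fz * fzs),
        fdz * fzs - const P * fzs * fdz, fdzs * fz - const Q * fz * fdzs,
        fdz * fz - const Q * fz * fdz, fdzs * fzs - const P * fzs * fdzs,
        fdz * fdzs + const P * fdzs * fdz,
        fdz * fdz, fdzs * fdzs}"

lemma form_ideal_eq: "form_ideal q = two_sided_ideal form_rel"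
  unfolding form_ideal_def form_rel_def Let_def P_def Q_def by simp

text \<open>The \<open>q\<close>-number \<open>(1 - p\<^sup>i) / (1 - p)\<close> with \<open>p = q\<^sup>-\<^sup>2\<close>: moving \<open>dz\<close> to the left, and \<open>dz*\<close> to the right,
  past one generator of the same kind costs a factor \<open>p\<close>.\<close>

definition qnum :: "nat \<Rightarrow> complex" where
  "qnum i = (\<Sum>k<i. P ^ k)"

lemma qnum_0 [simp]: "qnum 0 = 0"
  and qnum_Suc: "qnum (Suc i) = qnum i + P ^ i"
  by (simp_all add: qnum_def)

lemma qnum_Suc': "qnum (Suc i) = 1 + P * qnum i"
proof (induction i)
  case (Suc i)
  have "qnum (Suc (Suc i)) = qnum (Suc i) + P ^ Suc i" by (rule qnum_Suc)
  also have "\<dots> = 1 + P * (qnum i + P ^ i)" by (simp add: Suc algebra_simps)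
  finally show ?case by (simp only: qnum_Suc)
qed (simp add: qnum_Suc)

lemma qnum_Q: "(1 - Q) * qnum (Suc i) * Q ^ i = 1 - Q ^ Suc i"
proof (induction i)
  case (Suc i)
  have 1: "P ^ Suc i * Q ^ Suc i = 1" by (simp add: P_def flip: power_mult_distrib)
  have "(1 - Q) * qnum (Suc (Suc i)) * Q ^ Suc i =
      Q * ((1 - Q) * qnum (Suc i) * Q ^ i) + (1 - Q) * (P ^ Suc i * Q ^ Suc i)"
    unfolding qnum_Suc[of "Suc i"] by (simp add: algebra_simps)
  also have "\<dots> = 1 - Q ^ Suc (Suc i)"
    unfolding Suc 1 by (simp add: algebra_simps)
  finally show ?case .
qed (simp add: qnum_Suc)

lemma z_dz: "eqmod form_rel (fz * fdz) (const P * fdz * fz)"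
proof -
  have "eqmod form_rel (fdz * fz) (const Q * fz * fdz)"
    by (rule eqmod_gens[where r = "fdz * fz - const Q * fz * fdz"]) (auto simp: form_rel_def)
  from eqmod_sym[OF eqmod_mult_left[OF this, of "const P"]]
  show ?thesis by (simp add: mult.assoc[symmetric] const_mult[symmetric])
qed

lemma dzs_zs: "eqmod form_rel (fdzs * fzs) (const P * fzs * fdzs)"
  by (rule eqmod_gens[where r = "fdzs * fzs - const P * fzs * fdzs"]) (auto simp: form_rel_def)

lemma dzs_zs_power: "eqmod form_rel (fdzs * fzs ^ j) (const (P ^ j) * fzs ^ j * fdzs)"
proof (induction j)
  case (Suc j)
  have "eqmod form_rel (fdzs * fzs ^ Suc j) (const (P ^ j) * fzs ^ j * fdzs * fzs)"
    unfolding power_Suc2 mult.assoc[symmetric] by (rule eqmod_mult_right[OF Suc])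
  also have "const (P ^ j) * fzs ^ j * fdzs * fzs = const (P ^ j) * fzs ^ j * (fdzs * fzs)"
    by (simp add: mult.assoc)
  also have "eqmod form_rel \<dots> (const (P ^ j) * fzs ^ j * (const P * fzs * fdzs))"
    by (rule eqmod_mult_left[OF dzs_zs])
  also have "\<dots> = const (P ^ Suc j) * fzs ^ Suc j * fdzs"
    using const_left_commute[of "fzs ^ j" P "fzs * fdzs"]
    by (simp add: mult.assoc power_Suc2 const_mult del: power_Suc)
  finally show ?case .
qed simp

abbreviation "word_mono l \<equiv> Poly_Mapping.single (Word l) (1::complex)"

lemma word_mono_Cons: "word_mono (x # l) = gen x * word_mono l"
  by (simp add: gen_def mult_single plus_fword_def)

lemma word_mono_replicate: "word_mono (replicate i x @ l) = gen x ^ i * word_mono l"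
  by (induction i) (simp_all add: word_mono_Cons mult.assoc)

lemma word_mono_Nil: "word_mono [] = 1"
  by (rule word_Nil)

lemma ext_d_z_power:
  "eqmod form_rel (ext_d_word (replicate i (Fn Z) @ l))
     (const (qnum i) * fdz * fz ^ (i - 1) * word_mono l + fz ^ i * ext_d_word l)"
proof (induction i)
  case (Suc i)
  have "ext_d_word (replicate (Suc i) (Fn Z) @ l) =
      fdz * fz ^ i * word_mono l + fz * ext_d_word (replicate i (Fn Z) @ l)"
    by (simp add: word_mono_replicate mult.assoc)
  also have "eqmod form_rel \<dots> (fdz * fz ^ i * word_mono l +
      fz * (const (qnum i) * fdz * fz ^ (i - 1) * word_mono l + fz ^ i * ext_d_word l))"
    by (intro eqmod_add eqmod_mult_left Suc eqmod_refl)
  also have "\<dots> = fdz * fz ^ i * word_mono l + const (qnum i) * (fz * fdz) * (fz ^ (i - 1) * word_mono l)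
      + fz ^ Suc i * ext_d_word l"
    using const_left_commute[of fz "qnum i" "fdz * (fz ^ (i - 1) * word_mono l)"]
    by (simp add: distrib_left mult.assoc)
  also have "eqmod form_rel \<dots> (fdz * fz ^ i * word_mono l + const (qnum i) * (const P * fdz * fz) * (fz ^ (i - 1) * word_mono l)
      + fz ^ Suc i * ext_d_word l)"
    by (intro eqmod_add eqmod_mult_left eqmod_mult_right z_dz eqmod_refl)
  also have "const (qnum i) * (const P * fdz * fz) * (fz ^ (i - 1) * word_mono l) =
      const (P * qnum i) * fdz * fz ^ i * word_mono l"
    by (cases i) (simp_all add: const_mult mult.assoc mult.commute[of P])
  also have "fdz * fz ^ i * word_mono l + const (P * qnum i) * fdz * fz ^ i * word_mono l =
      const (qnum (Suc i)) * fdz * fz ^ i * word_mono l"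
    by (simp add: qnum_Suc' const_add distrib_right)
  finally show ?case by simp
qed simp

lemma ext_d_zs_power:
  "eqmod form_rel (ext_d_word (replicate j (Fn Zs))) (const (qnum j) * fzs ^ (j - 1) * fdzs)"
proof (induction j)
  case (Suc j)
  have "ext_d_word (replicate (Suc j) (Fn Zs)) = fdzs * fzs ^ j + fzs * ext_d_word (replicate j (Fn Zs))"
    using word_mono_replicate[of j "Fn Zs" "[]"] by (simp add: word_mono_Nil)
  also have "eqmod form_rel \<dots> (const (P ^ j) * fzs ^ j * fdzs + fzs * (const (qnum j) * fzs ^ (j - 1) * fdzs))"
    by (intro eqmod_add eqmod_mult_left Suc dzs_zs_power)
  also have "fzs * (const (qnum j) * fzs ^ (j - 1) * fdzs) = const (qnum j) * fzs ^ j * fdzs"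
    using const_left_commute[of fzs "qnum j" "fzs ^ (j - 1) * fdzs"]
    by (cases j) (simp_all add: mult.assoc)
  finally show ?case by (simp add: qnum_Suc const_add distrib_right add.commute)
qed simp

definition dl :: "pol \<Rightarrow> pol" where
  "dl f = (\<Sum>w\<in>Poly_Mapping.keys f. Poly_Mapping.single (fst w - 1, snd w) (Poly_Mapping.lookup f w * qnum (fst w)))"

definition dr :: "pol \<Rightarrow> pol" where
  "dr f = (\<Sum>w\<in>Poly_Mapping.keys f. Poly_Mapping.single (fst w, snd w - 1) (Poly_Mapping.lookup f w * qnum (snd w)))"

lemma dl_single: "dl (Poly_Mapping.single (i, j) c) = Poly_Mapping.single (i - 1, j) (c * qnum i)"
  unfolding dl_def by (subst keys_sum_single) simp_all

lemma dr_single: "dr (Poly_Mapping.single (i, j) c) = Poly_Mapping.single (i, j - 1) (c * qnum j)"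
  unfolding dr_def by (subst keys_sum_single) simp_all

lemma dl_add: "dl (f + g) = dl f + dl g"
  unfolding dl_def by (rule keys_sum_add) (simp_all add: distrib_right single_add)

lemma dr_add: "dr (f + g) = dr f + dr g"
  unfolding dr_def by (rule keys_sum_add) (simp_all add: distrib_right single_add)

abbreviation "nff \<equiv> normal_form (Fn Z) (Fn Zs)"

lemma partials_iff: "partials q f g h \<longleftrightarrow> eqmod form_rel (ext_d (nff f)) (fdz * nff g + nff h * fdzs)"
  by (simp add: partials_def form_ideal_eq eqmod_def)

lemma partials_exist: "partials q f (dl f) (dr f)"
proof (induction f rule: poly_mapping_single_induct)
  case (single w c)
  obtain i j where w: "w = (i, j)" by force
  have "nff (Poly_Mapping.single w c) = Poly_Mapping.single (Word (replicate i (Fn Z) @ replicate j (Fn Zs))) c"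
  proof -
    have "Poly_Mapping.single (Word (replicate i (Fn Z) @ replicate j (Fn Zs))) c =
      const c * word_mono (replicate i (Fn Z) @ (replicate j (Fn Zs) @ []))"
      by (simp add: const_def mult_single)
    also have "\<dots> = nff (Poly_Mapping.single w c)"
      unfolding word_mono_replicate word_mono_Nil by (simp add: w normal_form_single mult.assoc)
    finally show ?thesis ..
  qed
  then have "ext_d (nff (Poly_Mapping.single w c)) = const c * ext_d_word (replicate i (Fn Z) @ replicate j (Fn Zs))"
    by (simp add: ext_d_single)
  also have "eqmod form_rel \<dots> (const c * (const (qnum i) * fdz * fz ^ (i - 1) * word_mono (replicate j (Fn Zs))
      + fz ^ i * ext_d_word (replicate j (Fn Zs))))"
    by (intro eqmod_mult_left ext_d_z_power)
  also have "eqmod form_rel \<dots> (const c * (const (qnum i) * fdz * fz ^ (i - 1) * word_mono (replicate j (Fn Zs))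
      + fz ^ i * (const (qnum j) * fzs ^ (j - 1) * fdzs)))"
    by (intro eqmod_mult_left eqmod_add eqmod_refl ext_d_zs_power)
  also have "word_mono (replicate j (Fn Zs)) = fzs ^ j"
    using word_mono_replicate[of j "Fn Zs" "[]"] by (simp add: word_mono_Nil)
  also have "const c * (const (qnum i) * fdz * fz ^ (i - 1) * fzs ^ j + fz ^ i * (const (qnum j) * fzs ^ (j - 1) * fdzs))
    = fdz * nff (dl (Poly_Mapping.single w c)) + nff (dr (Poly_Mapping.single w c)) * fdzs"
    using const_left_commute[of "fz ^ i" "qnum j" "fzs ^ (j - 1) * fdzs"]
      const_left_commute[of fdz "c * qnum i" "fz ^ (i - 1) * fzs ^ j"]
    by (simp add: w dl_single dr_single normal_form_single distrib_left const_mult mult.assoc)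
  finally show ?case unfolding partials_iff .
next
  case (add f g)
  from eqmod_add[OF add[unfolded partials_iff]]
  show ?case unfolding partials_iff dl_add dr_add normal_form_add ext_d_add
    by (simp add: algebra_simps)
qed

lemma fps_nth_mult_01:
  "fps_nth (f * g) 0 = fps_nth f 0 * fps_nth g 0"
  "fps_nth (f * g) (Suc 0) = fps_nth f 0 * fps_nth g (Suc 0) + fps_nth f (Suc 0) * fps_nth g 0"
  for f g :: "'a::ring_1 fps"
  by (simp_all add: fps_mult_nth)

text \<open>In the Fock representation \<open>y\<close> satisfies the same commutation relations with \<open>z\<close> and \<open>z*\<close> as \<open>dz\<close> and
  as \<open>dz*\<close>. Sending the differentials to multiples of \<open>y X\<close> therefore respects all relations modulo \<open>X\<^sup>2\<close>.
  Taking one of the factors \<open>e\<close>, \<open>e'\<close> to be zero separates the two components of a form of degree one.\<close>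

definition form_gen :: "complex \<Rightarrow> complex \<Rightarrow> fgen \<Rightarrow> oper fps" where
  "form_gen e e' x = (case x of Fn x \<Rightarrow> fps_const (genop x)
     | Df x \<Rightarrow> Abs_fps (\<lambda>n. if n = Suc 0 then scal (case x of Z \<Rightarrow> e | Zs \<Rightarrow> e') * y else 0))"

lemma form_gen_nth [simp]:
  "fps_nth (form_gen e e' (Fn x)) 0 = genop x" "fps_nth (form_gen e e' (Fn x)) (Suc 0) = 0"
  "fps_nth (form_gen e e' (Df x)) 0 = 0"
  "fps_nth (form_gen e e' (Df x)) (Suc 0) = scal (case x of Z \<Rightarrow> e | Zs \<Rightarrow> e') * y"
  by (simp_all add: form_gen_def)

lemma scal_scal: "scal a * (scal b * X) = scal (a * b) * X"
  by (simp add: scal_hom(2) mult.assoc)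

lemma y_z_P: "z * y = scal P * (y * z)"
  unfolding y_z scal_scal by (simp add: scal_hom(4))

lemma y_zs_P: "y * zs = scal P * (zs * y)"
  unfolding zs_y scal_scal by (simp add: scal_hom(4))

lemma form_ideal_eval:
  assumes "a \<in> two_sided_ideal form_rel"
  shows "fps_nth (ev (\<lambda>c. fps_const (scal c)) (form_gen e e') a) 0 = 0 \<and>
    fps_nth (ev (\<lambda>c. fps_const (scal c)) (form_gen e e') a) (Suc 0) = 0"
  using assms
proof (induction rule: two_sided_ideal.induct)
  case (gens r a b)
  let ?ev = "ev (\<lambda>c. fps_const (scal c)) (form_gen e e')"
  have yz: "y * z = scal Q * (z * y)" by (rule y_z)
  have yzs: "y * zs = scal P * (zs * y)" by (rule y_zs_P)
  have c: "z * (scal c * X) = scal c * (z * X)" "zs * (scal c * X) = scal c * (zs * X)" for c X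
    by (rule scal_left_commute)+
  note s = scal_scal
  note ev = fscal.ev_mult fscal.ev_diff fscal.ev_add fscal.ev_gen fscal.ev_one fscal.ev_const fps_nth_mult_01
  have "fps_nth (?ev r) 0 = 0 \<and> fps_nth (?ev r) (Suc 0) = 0"
    using gens(1) unfolding form_rel_def insert_iff
  proof (elim disjE)
    assume "r = 1 - fzs * fz - const Q * (1 - fz * fzs)"
    then show ?thesis by (simp add: ev zs_z right_diff_distrib scal_hom(4,5) mult.assoc)
  next
    assume "r = fdz * fzs - const P * fzs * fdz"
    then show ?thesis by (simp add: ev mult.assoc yzs c s mult.commute[of P])
  next
    assume "r = fdzs * fz - const Q * fz * fdzs"
    then show ?thesis by (simp add: ev mult.assoc yz c s mult.commute[of Q])
  next
    assume "r = fdz * fz - const Q * fz * fdz"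
    then show ?thesis by (simp add: ev mult.assoc yz c s mult.commute[of Q])
  next
    assume "r = fdzs * fzs - const P * fzs * fdzs"
    then show ?thesis by (simp add: ev mult.assoc yzs c s mult.commute[of P])
  qed (simp_all add: ev)
  then show ?case by (simp add: fscal.ev_mult fps_nth_mult_01)
qed (auto simp: fscal.ev_add)

lemma ent_y_mult: "ent (y * X) r c = Q ^ r * ent X r c"
proof -
  obtain L where L: "\<forall>l>L. ent X l c = 0" using ent_bounded by blast
  then have "ent (y * X) r c = (\<Sum>l\<le>max L r. ent y r l * ent X l c)"
    by (intro ent_mult) auto
  also have "\<dots> = (\<Sum>l\<le>max L r. if l = r then Q ^ r * ent X r c else 0)"
    by (intro sum.cong) (auto simp: y_def ent_of_cols)
  finally show ?thesis by simp
qed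

lemma ent_mult_y: "ent (X * y) r c = ent X r c * Q ^ c"
  by (simp add: ent_def app_ring app_y) (metis app_smult coeff_smult mult.commute mult.right_neutral smult_monom)

text \<open>The coefficient of \<open>X\<close> of the image of \<open>dz \<cdot> g + h \<cdot> dz*\<close> is \<open>e y g + e' h y\<close>, and \<open>y\<close> is injective.\<close>

lemma partials_unique:
  assumes "partials q f g h" "partials q f g' h'"
  shows "g = g'" "h = h'"
proof -
  have "eqmod form_rel (fdz * nff g + nff h * fdzs) (fdz * nff g' + nff h' * fdzs)"
    using assms eqmod_sym eqmod_trans unfolding partials_iff by blast
  then have *: "fps_nth (ev (\<lambda>c. fps_const (scal c)) (form_gen e e') (fdz * nff g + nff h * fdzs)) (Suc 0) =
    fps_nth (ev (\<lambda>c. fps_const (scal c)) (form_gen e e') (fdz * nff g' + nff h' * fdzs)) (Suc 0)" for e e'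
    unfolding eqmod_def by (drule_tac form_ideal_eval[of _ e e']) (simp add: fscal.ev_diff)
  have nf: "ev (\<lambda>c. fps_const (scal c)) (form_gen e e') (nff u) = fps_const (rep u)" for e e' u
  proof -
    have "fps_const X ^ n = fps_const (X ^ n)" for X :: oper and n
      by (induction n) auto
    moreover have "fps_const (sum f S) = (\<Sum>i\<in>S. fps_const (f i))" for f :: "nat \<times> nat \<Rightarrow> oper" and S
      by (induction S rule: infinite_finite_induct) (auto simp flip: fps_const_add)
    ultimately show ?thesis unfolding fscal.ev_normal_form rep_def
      by (simp add: form_gen_def case_prod_beta)
  qed
  have **: "scal e * y * rep g + rep h * (scal e' * y) = scal e * y * rep g' + rep h' * (scal e' * y)" for e e'
    using *[of e e'] unfolding fscal.ev_add fscal.ev_mult nf by (simp add: fps_nth_mult_01)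
  \<comment> \<open>The two specializations keep one component of the form each.\<close>
  have "y * rep g = y * rep g'" using **[of 1 0] by (simp add: scal_hom)
  then have "ent (y * rep g) r c = ent (y * rep g') r c" for r c by simp
  then have "rep g = rep g'" by (intro ent_eqI) (simp add: ent_y_mult)
  then show "g = g'" by (simp add: rep_inj)
  have "rep h * y = rep h' * y" using **[of 0 1] by (simp add: scal_hom)
  then have "ent (rep h * y) r c = ent (rep h' * y) r c" for r c by simp
  then have "rep h = rep h'" by (intro ent_eqI) (simp add: ent_mult_y)
  then show "h = h'" by (simp add: rep_inj)
qed

lemma dl_z_eq: "dl_z q = dl"
  unfolding dl_z_def using partials_exist partials_unique by (intro ext the_equality) blast+

lemma dr_zs_eq: "dr_zs q = dr"
  unfolding dr_zs_def using partials_exist partials_unique by (intro ext the_equality) blast+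

section \<open>Derivatives as commutators\<close>

text \<open>On \<open>z\<^sup>i z*\<^sup>j\<close> the commutator with \<open>z*\<close> is \<open>(1 - q\<^sup>2\<^sup>i) z\<^sup>i\<^sup>-\<^sup>1 (1 - z z*) z*\<^sup>j\<close>; moving the middle factor
  \<open>y\<close> to the left turns the coefficient into \<open>(1 - q\<^sup>2)\<close> times the \<open>q\<close>-number of \<open>i\<close>.\<close>

lemma rep_dl: "scal (1 - Q) * (y * rep (dl f)) = zs * rep f - rep f * zs"
proof (induction f rule: poly_mapping_single_induct)
  case (add f g)
  show ?case unfolding dl_add rep_add distrib_left distrib_right add by simp
next
  case (single w a)
  obtain i j where w: "w = (i, j)" by force
  have "app (scal (1 - Q) * (scal (qnum i) * (y * (z ^ (i - 1) * zs ^ j)))) (monom 1 n) = app (zs * (z ^ i * zs ^ j) - z ^ i * zs ^ j * zs) (monom 1 n)" for n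
  proof (cases i)
    case 0
    have "zs * zs ^ j = zs ^ j * zs" by (simp add: power_commutes)
    then show ?thesis using 0 by (simp add: scal_hom app_ring)
  next
    case (Suc k)
    show ?thesis
    proof (cases "j \<le> n")
      case True
      then obtain m where n: "n = m + j" by (metis le_add_diff_inverse2)
      have *: "zs_coeff (Suc j) n = zs_coeff j n * (1 - Q ^ m)" by (simp add: zs_coeff_def n)
      have A: "app (scal (1 - Q) * (scal (qnum i) * (y * (z ^ (i - 1) * zs ^ j)))) (monom 1 n) =
          monom ((1 - Q) * (qnum i * (zs_coeff j n * Q ^ (m + k)))) (m + k)"
        by (simp add: Suc n app_ring app_zs_power app_z_power smult_monom del: power_Suc)
      have B: "app (zs * (z ^ i * zs ^ j)) (monom 1 n) = monom (zs_coeff j n * (1 - Q ^ (m + i))) (m + k)"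
        by (simp add: Suc n app_ring(6) app_zs_power app_z_power del: power_Suc)
      have "app (z ^ i * zs ^ j * zs) (monom 1 n) = app (z ^ i) (app (zs ^ Suc j) (monom 1 n))"
        by (simp only: power_Suc2 app_ring)
      also have "\<dots> = monom (zs_coeff j n * (1 - Q ^ m)) (m + k)"
        by (cases m) (simp_all only: app_zs_power app_z_power *, simp_all add: n Suc)
      finally have C: "app (z ^ i * zs ^ j * zs) (monom 1 n) = monom (zs_coeff j n * (1 - Q ^ m)) (m + k)" .
      have D: "(1 - Q) * (qnum i * (zs_coeff j n * Q ^ (m + k))) = zs_coeff j n * (1 - Q ^ (m + i)) - zs_coeff j n * (1 - Q ^ m)"
        using arg_cong[OF qnum_Q[of k], of "\<lambda>x. x * (zs_coeff j n * Q ^ m)"] by (simp add: Suc power_add algebra_simps)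
      show ?thesis unfolding app_ring(4) A B C D diff_monom ..
    next
      case False
      then have "zs_coeff j n = 0" "zs_coeff (Suc j) n = 0" using zs_coeff_eq_0 by auto
      moreover have "app (z ^ i * zs ^ j * zs) (monom 1 n) = app (z ^ i) (app (zs ^ Suc j) (monom 1 n))"
        by (simp only: power_Suc2 app_ring)
      ultimately show ?thesis by (simp add: app_ring app_zs_power del: power_Suc)
    qed
  qed
  then have "scal (1 - Q) * (scal (qnum i) * (y * (z ^ (i - 1) * zs ^ j))) = zs * (z ^ i * zs ^ j) - z ^ i * zs ^ j * zs"
    by (rule oper_eq_monomI)
  from arg_cong[OF this, of "\<lambda>X. scal a * X"] show ?case
    unfolding w dl_single rep_single
    by (simp add: right_diff_distrib scal_left_commute[of y] scal_left_commute[of z] scal_left_commute[of zs]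
        scal_scal mult.assoc mult.left_commute)
qed

lemma rep_dr: "scal (1 - Q) * (rep (dr f) * y) = rep f * z - z * rep f"
proof (induction f rule: poly_mapping_single_induct)
  case (add f g)
  show ?case unfolding dr_add rep_add distrib_left distrib_right add by simp
next
  case (single w a)
  obtain i j where w: "w = (i, j)" by force
  have "app (scal (1 - Q) * (scal (qnum j) * (z ^ i * zs ^ (j - 1) * y))) (monom 1 n) = app (z ^ i * zs ^ j * z - z * (z ^ i * zs ^ j)) (monom 1 n)" for n
  proof (cases j)
    case 0
    have "z * z ^ i = z ^ i * z" by (simp add: power_commutes)
    then show ?thesis using 0 by (simp add: scal_hom app_ring)
  next
    case (Suc k)
    show ?thesis
    proof (cases "k \<le> n")
      case True
      then obtain m where n: "n = m + k" by (metis le_add_diff_inverse2)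
      have 1: "zs_coeff (Suc k) n = zs_coeff k n * (1 - Q ^ m)" by (simp add: zs_coeff_def n)
      have 2: "zs_coeff (Suc k) (Suc n) = (1 - Q ^ Suc n) * zs_coeff k n"
        using zs_coeff_add[of 1 k "Suc n"] by (simp add: zs_coeff_def)
      have A: "app (scal (1 - Q) * (scal (qnum j) * (z ^ i * zs ^ (j - 1) * y))) (monom 1 n) =
          monom ((1 - Q) * (qnum j * (zs_coeff k n * Q ^ n))) (m + i)"
        by (simp add: Suc app_ring app_zs_power app_z_power smult_monom del: power_Suc) (simp add: n mult.commute)
      have B: "app (z ^ i * zs ^ j * z) (monom 1 n) = monom ((1 - Q ^ Suc n) * zs_coeff k n) (m + i)"
        by (simp add: Suc app_ring(6) app_zs_power app_z_power 2 del: power_Suc) (simp add: n)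
      have C: "app (z * (z ^ i * zs ^ j)) (monom 1 n) = monom (zs_coeff k n * (1 - Q ^ m)) (m + i)"
        by (cases m) (simp_all add: Suc app_ring(6) app_zs_power app_z_power 1 del: power_Suc, simp_all add: n)
      have D: "(1 - Q) * (qnum j * (zs_coeff k n * Q ^ n)) = (1 - Q ^ Suc n) * zs_coeff k n - zs_coeff k n * (1 - Q ^ m)"
        using arg_cong[OF qnum_Q[of k], of "\<lambda>x. x * (zs_coeff k n * Q ^ m)"] by (simp add: Suc n power_add algebra_simps)
      show ?thesis unfolding app_ring(4) A B C D diff_monom ..
    next
      case False
      then have "zs_coeff k n = 0" "zs_coeff (Suc k) n = 0" "zs_coeff (Suc k) (Suc n) = 0" using zs_coeff_eq_0 by auto
      then show ?thesis by (simp add: Suc app_ring app_zs_power del: power_Suc)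
    qed
  qed
  then have "scal (1 - Q) * (scal (qnum j) * (z ^ i * zs ^ (j - 1) * y)) = z ^ i * zs ^ j * z - z * (z ^ i * zs ^ j)"
    by (rule oper_eq_monomI)
  from arg_cong[OF this, of "\<lambda>X. scal a * X"] show ?case
    unfolding w dr_single rep_single
    by (simp add: right_diff_distrib scal_left_commute[of y] scal_left_commute[of z] scal_left_commute[of zs]
        scal_scal mult.assoc mult.left_commute)
qed

end

section \<open>Generalized functions as matrices\<close>

lemma tendsto_fun_iff:
  fixes f :: "'a \<Rightarrow> 'i \<Rightarrow> 'b::topological_space"
  shows "(f \<longlongrightarrow> l) F \<longleftrightarrow> (\<forall>i. ((\<lambda>x. f x i) \<longlongrightarrow> l i) F)"
  using limitin_componentwise[of "\<lambda>i. euclidean" UNIV f l F]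
  by (simp add: euclidean_product_topology PiE_UNIV_domain)

lemma nonzero_subset_atMost:
  fixes L :: nat
  assumes "\<And>k. L < k \<Longrightarrow> g k = (0::complex)"
  shows "{k. g k \<noteq> 0} \<subseteq> {..L}"
proof
  fix k assume "k \<in> {k. g k \<noteq> 0}"
  then show "k \<in> {..L}" using assms[of k] by (cases "L < k") auto
qed

definition row_finite :: "(nat \<Rightarrow> nat \<Rightarrow> complex) \<Rightarrow> bool" where
  "row_finite A \<longleftrightarrow> (\<forall>r. finite {k. A r k \<noteq> 0})"

definition col_finite :: "(nat \<Rightarrow> nat \<Rightarrow> complex) \<Rightarrow> bool" where
  "col_finite A \<longleftrightarrow> (\<forall>c. finite {k. A k c \<noteq> 0})"

text \<open>The sum runs over the indices with a nonzero summand, which are finitely many as soon as a row of \<open>A\<close>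
  or a column of \<open>B\<close> is finite. One formula thus serves both one-sided extensions of the product.\<close>

definition mat_mult :: "(nat \<Rightarrow> nat \<Rightarrow> complex) \<Rightarrow> (nat \<Rightarrow> nat \<Rightarrow> complex) \<Rightarrow> nat \<Rightarrow> nat \<Rightarrow> complex" where
  "mat_mult A B r c = (\<Sum>k | A r k \<noteq> 0 \<and> B k c \<noteq> 0. A r k * B k c)"

lemma mat_mult_row:
  assumes "finite S" "{k. A r k \<noteq> 0} \<subseteq> S"
  shows "mat_mult A B r c = (\<Sum>k\<in>S. A r k * B k c)"
  unfolding mat_mult_def by (rule sum.mono_neutral_left) (use assms in auto)

lemma mat_mult_col:
  assumes "finite S" "{k. B k c \<noteq> 0} \<subseteq> S"
  shows "mat_mult A B r c = (\<Sum>k\<in>S. A r k * B k c)"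
  unfolding mat_mult_def by (rule sum.mono_neutral_left) (use assms in auto)

lemma mat_mult_row':
  "finite {k. A r k \<noteq> 0} \<Longrightarrow> mat_mult A B r c = (\<Sum>k | A r k \<noteq> 0. A r k * B k c)"
  by (rule mat_mult_row) auto

lemma mat_mult_col':
  "finite {k. B k c \<noteq> 0} \<Longrightarrow> mat_mult A B r c = (\<Sum>k | B k c \<noteq> 0. A r k * B k c)"
  by (rule mat_mult_col) auto

lemma mat_mult_linear_right:
  assumes "row_finite A"
  shows "mat_mult A (\<lambda>r c. B r c + a * C r c) r c = mat_mult A B r c + a * mat_mult A C r c"
proof -
  have "finite {k. A r k \<noteq> 0}" using assms by (simp add: row_finite_def)
  from mat_mult_row'[where A = A, OF this] show ?thesis
    by (simp add: sum.distrib sum_distrib_left algebra_simps)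
qed

lemma mat_mult_linear_left:
  assumes "col_finite C"
  shows "mat_mult (\<lambda>r c. A r c + a * B r c) C r c = mat_mult A C r c + a * mat_mult B C r c"
proof -
  have "finite {k. C k c \<noteq> 0}" using assms by (simp add: col_finite_def)
  from mat_mult_col'[where B = C, OF this] show ?thesis
    by (simp add: sum.distrib sum_distrib_left algebra_simps)
qed

lemma mat_mult_nonzero:
  assumes "mat_mult A B r c \<noteq> 0"
  shows "\<exists>k. A r k \<noteq> 0 \<and> B k c \<noteq> 0"
proof (rule ccontr)
  assume "\<not> ?thesis"
  then have "{k. A r k \<noteq> 0 \<and> B k c \<noteq> 0} = {}" by blast
  with assms show False by (simp add: mat_mult_def)
qed

lemma finite_mat_mult_left:
  assumes "finite {(r, c). A r c \<noteq> 0}" "row_finite B"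
  shows "finite {(r, c). mat_mult A B r c \<noteq> 0}"
proof (rule finite_subset)
  show "finite (\<Union>(r, k)\<in>{(r, c). A r c \<noteq> 0}. Pair r ` {c. B k c \<noteq> 0})"
    using assms by (auto simp: row_finite_def)
  show "{(r, c). mat_mult A B r c \<noteq> 0} \<subseteq> (\<Union>(r, k)\<in>{(r, c). A r c \<noteq> 0}. Pair r ` {c. B k c \<noteq> 0})"
  proof safe
    fix r c assume "mat_mult A B r c \<noteq> 0"
    then obtain k where "A r k \<noteq> 0" "B k c \<noteq> 0"
      using mat_mult_nonzero by blast
    then show "(r, c) \<in> (\<Union>(r, k)\<in>{(r, c). A r c \<noteq> 0}. Pair r ` {c. B k c \<noteq> 0})" by auto
  qed
qed

lemma finite_mat_mult_right:
  assumes "finite {(r, c). B r c \<noteq> 0}" "col_finite A"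
  shows "finite {(r, c). mat_mult A B r c \<noteq> 0}"
proof (rule finite_subset)
  show "finite (\<Union>(k, c)\<in>{(r, c). B r c \<noteq> 0}. (\<lambda>r. (r, c)) ` {r. A r k \<noteq> 0})"
    using assms by (auto simp: col_finite_def)
  show "{(r, c). mat_mult A B r c \<noteq> 0} \<subseteq> (\<Union>(k, c)\<in>{(r, c). B r c \<noteq> 0}. (\<lambda>r. (r, c)) ` {r. A r k \<noteq> 0})"
  proof safe
    fix r c assume "mat_mult A B r c \<noteq> 0"
    then obtain k where "A r k \<noteq> 0" "B k c \<noteq> 0"
      using mat_mult_nonzero by blast
    then show "(r, c) \<in> (\<Union>(k, c)\<in>{(r, c). B r c \<noteq> 0}. (\<lambda>r. (r, c)) ` {r. A r k \<noteq> 0})" by auto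
  qed
qed

lemma finite_support_row_col:
  assumes "finite {(r, c). A r c \<noteq> 0}"
  shows "row_finite A" "col_finite A"
proof -
  have "{k. A r k \<noteq> 0} \<subseteq> snd ` {(r, c). A r c \<noteq> 0}" for r
  proof
    fix k assume "k \<in> {k. A r k \<noteq> 0}"
    then show "k \<in> snd ` {(r, c). A r c \<noteq> 0}" by (intro image_eqI[of _ _ "(r, k)"]) simp_all
  qed
  from finite_subset[OF this finite_imageI[OF assms]] show "row_finite A"
    by (simp add: row_finite_def)
  have "{k. A k c \<noteq> 0} \<subseteq> fst ` {(r, c). A r c \<noteq> 0}" for c
  proof
    fix k assume "k \<in> {k. A k c \<noteq> 0}"
    then show "k \<in> fst ` {(r, c). A r c \<noteq> 0}" by (intro image_eqI[of _ _ "(k, c)"]) simp_all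
  qed
  from finite_subset[OF this finite_imageI[OF assms]] show "col_finite A"
    by (simp add: col_finite_def)
qed

context qdisc
begin

text \<open>The entry \<open>(r, c)\<close> lies on the diagonal \<open>m = r - c\<close>, at the position \<open>n = min r c\<close>.\<close>

definition mat :: "gfun \<Rightarrow> nat \<Rightarrow> nat \<Rightarrow> complex" where
  "mat X r c = X (int r - int c) (min r c) * wt r c"

definition of_mat :: "(nat \<Rightarrow> nat \<Rightarrow> complex) \<Rightarrow> gfun" where
  "of_mat A m n = A (n + nat m) (n + nat (- m)) / wt (n + nat m) (n + nat (- m))"

lemma mat_of_mat [simp]: "mat (of_mat A) = A"
proof (intro ext)
  fix r c
  have "min r c + nat (int r - int c) = r" "min r c + nat (- (int r - int c)) = c" by auto
  then show "mat (of_mat A) r c = A r c" unfolding mat_def of_mat_def by simp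
qed

lemma of_mat_mat [simp]: "of_mat (mat X) = X"
proof (intro ext)
  fix m n
  have "int (n + nat m) - int (n + nat (- m)) = m" "min (n + nat m) (n + nat (- m)) = n" by auto
  then show "of_mat (mat X) m n = X m n" unfolding mat_def of_mat_def by simp
qed

lemma mat_emb: "mat (emb q f) = ent (rep f)"
  by (intro ext) (simp add: mat_def emb_ent)

lemma emb_eq: "emb q f = of_mat (ent (rep f))"
  unfolding mat_emb[symmetric] by simp

lemma mat_linear: "mat (X + gscale a Y) = (\<lambda>r c. mat X r c + a * mat Y r c)"
  by (intro ext) (simp add: mat_def gscale_def algebra_simps)

lemma of_mat_linear: "of_mat (\<lambda>r c. A r c + a * B r c) = of_mat A + gscale a (of_mat B)"
  by (intro ext) (simp add: of_mat_def gscale_def add_divide_distrib)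

lemma emb_linear: "emb q (f + pscale a g) = emb q f + gscale a (emb q g)"
proof -
  have "ent (rep (f + pscale a g)) = (\<lambda>r c. ent (rep f) r c + a * ent (rep g) r c)"
    by (intro ext) (simp add: rep_add rep_pscale)
  then show ?thesis unfolding emb_eq of_mat_linear[symmetric] by simp
qed

lemma gscale_1 [simp]: "gscale 1 X = X"
  by (simp add: gscale_def)

lemma pscale_1 [simp]: "pscale 1 f = f"
  by (rule poly_mapping_eqI) simp

lemma emb_add: "emb q (f + g) = emb q f + emb q g"
  using emb_linear[of f 1 g] by simp

lemma emb_zero: "emb q 0 = 0"
  using emb_add[of 0 0] by simp

lemma emb_pscale: "emb q (pscale a g) = gscale a (emb q g)"
  using emb_linear[of 0 a g] by (simp add: emb_zero)

lemma emb_sum: "emb q (\<Sum>i\<in>S. f i) = (\<Sum>i\<in>S. emb q (f i))"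
  by (induction S rule: infinite_finite_induct) (auto simp: emb_add emb_zero)

lemma fin_funs_iff: "X \<in> fin_funs \<longleftrightarrow> finite {(r, c). mat X r c \<noteq> 0}"
proof -
  let ?\<phi> = "\<lambda>(r, c). (int r - int c, min r c)"
  have inj: "inj ?\<phi>" by (auto simp: inj_def)
  have eq: "{(r, c). mat X r c \<noteq> 0} = ?\<phi> -` {(m, n). X m n \<noteq> 0}"
    by (auto simp: mat_def)
  have sub: "{(m, n). X m n \<noteq> 0} \<subseteq> ?\<phi> ` {(r, c). mat X r c \<noteq> 0}"
  proof
    fix w assume "w \<in> {(m, n). X m n \<noteq> 0}"
    then obtain m n where w: "w = (m, n)" "X m n \<noteq> 0" by blast
    have "int (n + nat m) - int (n + nat (- m)) = m" "min (n + nat m) (n + nat (- m)) = n" by auto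
    with w show "w \<in> ?\<phi> ` {(r, c). mat X r c \<noteq> 0}"
      by (intro image_eqI[of _ _ "(n + nat m, n + nat (- m))"]) (simp_all add: mat_def)
  qed
  show ?thesis
  proof
    assume "X \<in> fin_funs"
    then have "finite {(m, n). X m n \<noteq> 0}" by (simp add: fin_funs_def)
    from finite_vimageI[OF this inj] show "finite {(r, c). mat X r c \<noteq> 0}" by (simp only: eq)
  next
    assume "finite {(r, c). mat X r c \<noteq> 0}"
    from finite_subset[OF sub finite_imageI[OF this]] show "X \<in> fin_funs" by (simp add: fin_funs_def)
  qed
qed

text \<open>The generalized functions by which any other may be multiplied; their matrices have finite rows and
  columns.\<close>

abbreviation tame :: "gfun set" where "tame \<equiv> range (emb q) \<union> fin_funs"

lemma ent_rep_band: "\<exists>b. \<forall>r c. b + r < c \<longrightarrow> ent (rep f) r c = 0"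
proof (induction f rule: poly_mapping_single_induct)
  case (single w a)
  show ?case by (cases w, rule exI[of _ "snd w"]) (auto simp: rep_single ent_monomial)
next
  case (add f g)
  then obtain b b' where "\<forall>r c. b + r < c \<longrightarrow> ent (rep f) r c = 0" "\<forall>r c. b' + r < c \<longrightarrow> ent (rep g) r c = 0" by blast
  then show ?case by (intro exI[of _ "max b b'"]) (simp add: rep_add)
qed

lemma tame_finite:
  assumes "X \<in> tame"
  shows "row_finite (mat X)" "col_finite (mat X)"
proof -
  have "row_finite (mat (emb q f)) \<and> col_finite (mat (emb q f))" for f
  proof
    obtain b where b: "\<And>r c. b + r < c \<Longrightarrow> ent (rep f) r c = 0" using ent_rep_band by blast
    have "finite {k. ent (rep f) r k \<noteq> 0}" for r
      by (rule finite_subset[OF nonzero_subset_atMost[of "b + r"]]) (auto intro: b)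
    then show "row_finite (mat (emb q f))"
      unfolding row_finite_def mat_emb by blast
    have "finite {k. ent (rep f) k c \<noteq> 0}" for c
    proof -
      obtain L where "\<forall>l>L. ent (rep f) l c = 0" using ent_bounded by blast
      then show ?thesis by (intro finite_subset[OF nonzero_subset_atMost[of L]]) auto
    qed
    then show "col_finite (mat (emb q f))"
      unfolding col_finite_def mat_emb by blast
  qed
  moreover have "row_finite (mat X) \<and> col_finite (mat X)" if "X \<in> fin_funs"
    using finite_support_row_col[of "mat X"] that by (simp add: fin_funs_iff)
  ultimately show "row_finite (mat X)" "col_finite (mat X)" using assms by blast+
qed

definition gprod :: "gfun \<Rightarrow> gfun \<Rightarrow> gfun" where
  "gprod X Y = of_mat (mat_mult (mat X) (mat Y))"

lemma ent_mult_mat: "ent (X * Y) = mat_mult (ent X) (ent Y)"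
proof (intro ext)
  fix r c
  obtain L where L: "\<forall>l>L. ent Y l c = 0" using ent_bounded by blast
  then have "{k. ent Y k c \<noteq> 0} \<subseteq> {..L}" by (intro nonzero_subset_atMost) simp
  then show "ent (X * Y) r c = mat_mult (ent X) (ent Y) r c"
    using L ent_mult[of L Y c X r] mat_mult_col[of "{..L}" "ent Y" c "ent X" r] by simp
qed

lemma gprod_emb: "gprod (emb q f) (emb q g) = emb q (pmul q f g)"
  by (simp add: gprod_def mat_emb emb_eq rep_pmul ent_mult_mat)

section \<open>Continuity and density\<close>

lemma continuous_gfun_coord: "continuous_on UNIV (\<lambda>X::gfun. X m n)"
  by (rule continuous_on_product_then_coordinatewise[OF continuous_on_product_coordinates])

lemma continuous_mat: "continuous_on UNIV (\<lambda>X. mat X r c)"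
  unfolding mat_def by (intro continuous_on_mult continuous_gfun_coord continuous_on_const)

lemma continuous_of_mat:
  assumes "\<And>r c. continuous_on UNIV (\<lambda>X. F X r c)"
  shows "continuous_on UNIV (\<lambda>X. of_mat (F X))"
  unfolding of_mat_def divide_inverse
  by (intro continuous_on_coordinatewise_then_product continuous_on_mult assms continuous_on_const)

lemma continuous_gprod_right:
  assumes "row_finite (mat X)"
  shows "continuous_on UNIV (\<lambda>Y. gprod X Y)"
proof -
  have "finite {k. mat X r k \<noteq> 0}" for r using assms by (simp add: row_finite_def)
  note m = mat_mult_row'[where A = "mat X", OF this]
  show ?thesis unfolding gprod_def
  proof (rule continuous_of_mat)
    fix r c show "continuous_on UNIV (\<lambda>Y. mat_mult (mat X) (mat Y) r c)"
      unfolding m by (intro continuous_on_sum continuous_on_mult continuous_on_const continuous_mat)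
  qed
qed

lemma continuous_gprod_left:
  assumes "col_finite (mat Y)"
  shows "continuous_on UNIV (\<lambda>X. gprod X Y)"
proof -
  have "finite {k. mat Y k c \<noteq> 0}" for c using assms by (simp add: col_finite_def)
  note m = mat_mult_col'[where B = "mat Y", OF this]
  show ?thesis unfolding gprod_def
  proof (rule continuous_of_mat)
    fix r c show "continuous_on UNIV (\<lambda>X. mat_mult (mat X) (mat Y) r c)"
      unfolding m by (intro continuous_on_sum continuous_on_mult continuous_on_const continuous_mat)
  qed
qed

text \<open>The monomials \<open>z\<^sup>i z*\<^sup>N\<close> vanish in the columns before \<open>N\<close> and form there, up to a nonzero factor, the
  unit vectors. So prescribed entries can be attained column by column.\<close>

lemma interpolate: "\<exists>f. \<forall>c<N. \<forall>r\<le>R. ent (rep f) r c = A r c"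
proof (induction N)
  case (Suc N)
  then obtain f where f: "\<And>r c. c < N \<Longrightarrow> r \<le> R \<Longrightarrow> ent (rep f) r c = A r c" by blast
  \<comment> \<open>Adding multiples of \<open>z\<^sup>i z*\<^sup>N\<close> corrects column \<open>N\<close> and leaves the columns before it unchanged.\<close>
  let ?b = "\<lambda>i. (A i N - ent (rep f) i N) / zs_coeff N N"
  let ?g = "f + (\<Sum>i\<le>R. pscale (?b i) (mono i N))"
  have e: "ent (rep ?g) r c = ent (rep f) r c + (\<Sum>i\<le>R. ?b i * ent (z ^ i * zs ^ N) r c)" for r c
    by (simp add: rep_add rep_sum rep_pscale rep_mono ent_sum)
  have "ent (rep ?g) r c = A r c" if "c < Suc N" "r \<le> R" for r c
  proof (cases "c = N")
    case True
    have "(\<Sum>i\<le>R. ?b i * ent (z ^ i * zs ^ N) r N) = (\<Sum>i\<le>R. if i = r then ?b r * zs_coeff N N else 0)"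
      by (intro sum.cong) (auto simp: ent_monomial)
    also have "\<dots> = A r N - ent (rep f) r N"
      using that zs_coeff_eq_0[of N N] by simp
    finally show ?thesis unfolding e True by simp
  next
    case False
    then have "c < N" using that by simp
    then have "(\<Sum>i\<le>R. ?b i * ent (z ^ i * zs ^ N) r c) = 0"
      by (intro sum.neutral) (simp add: ent_monomial)
    then show ?thesis unfolding e using f[OF \<open>c < N\<close> that(2)] by simp
  qed
  then show ?case by (intro exI[of _ ?g]) blast
qed simp

text \<open>Polynomials that agree with \<open>X\<close> on growing blocks converge to \<open>X\<close>, each entry being eventually
  constant.\<close>

lemma emb_dense: "\<exists>f. (\<lambda>N. emb q (f N)) \<longlonglongrightarrow> X"
proof -
  have "\<exists>f. \<forall>c<N. \<forall>r\<le>N. ent (rep f) r c = mat X r c" for N by (rule interpolate)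
  then obtain f where f: "\<And>N r c. c < N \<Longrightarrow> r \<le> N \<Longrightarrow> ent (rep (f N)) r c = mat X r c" by metis
  have "(\<lambda>N. emb q (f N) m n) \<longlonglongrightarrow> X m n" for m n
  proof (rule tendsto_eventually, rule eventually_sequentiallyI)
    fix N assume "Suc (n + nat m + nat (- m)) \<le> N"
    then have "of_mat (ent (rep (f N))) m n = of_mat (mat X) m n"
      unfolding of_mat_def by (subst f) auto
    then show "emb q (f N) m n = X m n" by (simp add: emb_eq)
  qed
  then show ?thesis by (auto simp: tendsto_fun_iff)
qed

lemma continuous_ext_unique:
  fixes G H :: "gfun \<Rightarrow> gfun"
  assumes "continuous_on UNIV G" "continuous_on UNIV H" "\<And>f. G (emb q f) = H (emb q f)"
  shows "G = H"
proof (intro ext)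
  fix X m n
  obtain f where f: "(\<lambda>N. emb q (f N)) \<longlonglongrightarrow> X" using emb_dense by blast
  have "(\<lambda>N. G (emb q (f N))) \<longlonglongrightarrow> G X" "(\<lambda>N. H (emb q (f N))) \<longlonglongrightarrow> H X"
    using continuous_on_tendsto_compose[OF assms(1) f] continuous_on_tendsto_compose[OF assms(2) f] by simp_all
  then have "(\<lambda>N. G (emb q (f N)) m n) \<longlonglongrightarrow> G X m n" "(\<lambda>N. H (emb q (f N)) m n) \<longlonglongrightarrow> H X m n"
    by (simp_all add: tendsto_fun_iff)
  then show "G X m n = H X m n" unfolding assms(3) by (rule LIMSEQ_unique)
qed

lemma gprod_sep_cont_ext: "sep_cont_ext q (pmul q) gprod"
  unfolding sep_cont_ext_def
  by (intro conjI allI ballI gprod_emb continuous_gprod_left continuous_gprod_right tame_finite)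

lemma gmul_sep_cont_ext: "sep_cont_ext q (pmul q) (gmul q)"
  unfolding gmul_def by (rule someI[of "sep_cont_ext q (pmul q)"]) (rule gprod_sep_cont_ext)

text \<open>Density is used twice, first with a polynomial as one argument, then with a finite function.\<close>

lemma sep_cont_ext_unique:
  assumes B: "sep_cont_ext q C B" "sep_cont_ext q C B'" and X: "X \<in> tame \<or> Y \<in> tame"
  shows "B X Y = B' X Y"
proof -
  have 1: "B (emb q f) Y = B' (emb q f) Y" "B Y (emb q f) = B' Y (emb q f)" for f Y
  proof -
    have "(\<lambda>Y. B (emb q f) Y) = (\<lambda>Y. B' (emb q f) Y)" "(\<lambda>Y. B Y (emb q f)) = (\<lambda>Y. B' Y (emb q f))"
      using B unfolding sep_cont_ext_def by (intro continuous_ext_unique; simp)+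
    then show "B (emb q f) Y = B' (emb q f) Y" "B Y (emb q f) = B' Y (emb q f)" by meson+
  qed
  from X show ?thesis
  proof
    assume "X \<in> tame"
    then have "(\<lambda>Y. B X Y) = (\<lambda>Y. B' X Y)"
      using B unfolding sep_cont_ext_def by (intro continuous_ext_unique) (auto simp: 1)
    then show ?thesis by meson
  next
    assume "Y \<in> tame"
    then have "(\<lambda>X. B X Y) = (\<lambda>X. B' X Y)"
      using B unfolding sep_cont_ext_def by (intro continuous_ext_unique) (auto simp: 1)
    then show ?thesis by meson
  qed
qed

lemma gmul_eq: "X \<in> tame \<or> Y \<in> tame \<Longrightarrow> gmul q X Y = gprod X Y"
  by (rule sep_cont_ext_unique[OF gmul_sep_cont_ext gprod_sep_cont_ext])

lemma cont_ext_eq: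
  assumes "continuous_on UNIV G" "\<And>f. G (emb q f) = emb q (F f)"
  shows "cont_ext q F = G"
  unfolding cont_ext_def
proof (rule the_equality)
  show "continuous_on UNIV G \<and> (\<forall>f. G (emb q f) = emb q (F f))" using assms by simp
  show "H = G" if "continuous_on UNIV H \<and> (\<forall>f. H (emb q f) = emb q (F f))" for H
    using that assms by (intro continuous_ext_unique) auto
qed

section \<open>Derivatives of generalized functions\<close>

text \<open>The entries of \<open>(1 - q\<^sup>2)\<^sup>-\<^sup>1 y\<^sup>-\<^sup>1 [z*, A]\<close> and of \<open>(1 - q\<^sup>2)\<^sup>-\<^sup>1 [A, z] y\<^sup>-\<^sup>1\<close>. Each involves only two entries of
  \<open>A\<close>, so both operations are continuous and preserve finite support. In column \<open>0\<close> the factor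
  \<open>1 - Q ^ c\<close> removes the term in which the subtraction is truncated.\<close>

definition mat_dl :: "(nat \<Rightarrow> nat \<Rightarrow> complex) \<Rightarrow> nat \<Rightarrow> nat \<Rightarrow> complex" where
  "mat_dl A r c = ((1 - Q ^ Suc r) * A (Suc r) c - A r (c - 1) * (1 - Q ^ c)) / ((1 - Q) * Q ^ r)"

definition mat_dr :: "(nat \<Rightarrow> nat \<Rightarrow> complex) \<Rightarrow> nat \<Rightarrow> nat \<Rightarrow> complex" where
  "mat_dr A r c = (A r (Suc c) - (if r = 0 then 0 else A (r - 1) c)) / ((1 - Q) * Q ^ c)"

lemma ent_zs_mult: "ent (zs * X) r c = (1 - Q ^ Suc r) * ent X (Suc r) c"
proof -
  obtain L where L: "\<forall>l>L. ent X l c = 0" using ent_bounded by blast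
  then have "ent (zs * X) r c = (\<Sum>l\<le>max L (Suc r). ent zs r l * ent X l c)"
    by (intro ent_mult) auto
  also have "\<dots> = (\<Sum>l\<le>max L (Suc r). if l = Suc r then (1 - Q ^ Suc r) * ent X (Suc r) c else 0)"
    by (intro sum.cong) (auto simp: zs_def ent_of_cols)
  finally show ?thesis by simp
qed

lemma ent_z_mult: "ent (z * X) r c = (if r = 0 then 0 else ent X (r - 1) c)"
proof -
  obtain L where L: "\<forall>l>L. ent X l c = 0" using ent_bounded by blast
  then have "ent (z * X) r c = (\<Sum>l\<le>max L r. ent z r l * ent X l c)"
    by (intro ent_mult) auto
  also have "\<dots> = (\<Sum>l\<le>max L r. if l = r - 1 then (if r = 0 then 0 else ent X (r - 1) c) else 0)"
    by (intro sum.cong) (auto simp: z_def ent_of_cols)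
  finally show ?thesis by (simp add: le_max_iff_disj)
qed

lemma app_monom: "app X (monom a n) = smult a (app X (monom 1 n))"
  by (metis app_smult mult.right_neutral smult_monom)

lemma ent_mult_z: "ent (X * z) r c = ent X r (Suc c)"
  by (simp add: ent_def app_ring)

lemma ent_mult_zs: "ent (X * zs) r c = ent X r (c - 1) * (1 - Q ^ c)"
  by (simp add: ent_def app_ring app_monom[of X "1 - Q ^ c"])

lemma ent_dl: "ent (rep (dl f)) = mat_dl (ent (rep f))"
proof (intro ext)
  fix r c
  have "(1 - Q) * (Q ^ r * ent (rep (dl f)) r c) = (1 - Q ^ Suc r) * ent (rep f) (Suc r) c - ent (rep f) r (c - 1) * (1 - Q ^ c)"
    using arg_cong[OF rep_dl[of f], of "\<lambda>X. ent X r c"]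
    by (simp only: ent_linear ent_y_mult ent_zs_mult ent_mult_zs)
  then show "ent (rep (dl f)) r c = mat_dl (ent (rep f)) r c"
    by (simp add: mat_dl_def eq_divide_eq algebra_simps)
qed

lemma ent_dr: "ent (rep (dr f)) = mat_dr (ent (rep f))"
proof (intro ext)
  fix r c
  have "(1 - Q) * (ent (rep (dr f)) r c * Q ^ c) = ent (rep f) r (Suc c) - (if r = 0 then 0 else ent (rep f) (r - 1) c)"
    using arg_cong[OF rep_dr[of f], of "\<lambda>X. ent X r c"]
    by (simp only: ent_linear ent_mult_y ent_z_mult ent_mult_z)
  then show "ent (rep (dr f)) r c = mat_dr (ent (rep f)) r c"
    by (simp add: mat_dr_def eq_divide_eq algebra_simps)
qed

lemma continuous_mat_dl: "continuous_on UNIV (\<lambda>X. of_mat (mat_dl (mat X)))"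
  unfolding mat_dl_def divide_inverse
  by (intro continuous_of_mat continuous_on_mult continuous_on_diff continuous_on_const continuous_mat)

lemma continuous_mat_dr: "continuous_on UNIV (\<lambda>X. of_mat (mat_dr (mat X)))"
proof (rule continuous_of_mat)
  fix r c show "continuous_on UNIV (\<lambda>X. mat_dr (mat X) r c)"
    unfolding mat_dr_def divide_inverse
    by (cases r) (simp_all, intro continuous_on_mult continuous_on_diff continuous_on_const continuous_mat,
        intro continuous_on_mult continuous_on_diff continuous_on_const continuous_mat)
qed

lemma gdl_z_eq: "gdl_z q = (\<lambda>X. of_mat (mat_dl (mat X)))"
  unfolding gdl_z_def by (rule cont_ext_eq[OF continuous_mat_dl]) (simp add: mat_emb dl_z_eq emb_eq ent_dl)

lemma gdr_zs_eq: "gdr_zs q = (\<lambda>X. of_mat (mat_dr (mat X)))"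
  unfolding gdr_zs_def by (rule cont_ext_eq[OF continuous_mat_dr]) (simp add: mat_emb dr_zs_eq emb_eq ent_dr)

lemma gdl_z_emb: "(gdl_z q ^^ n) (emb q f) = emb q ((dl_z q ^^ n) f)"
  by (induction n) (simp_all add: gdl_z_eq mat_emb dl_z_eq emb_eq ent_dl)

lemma gdr_zs_emb: "(gdr_zs q ^^ n) (emb q f) = emb q ((dr_zs q ^^ n) f)"
  by (induction n) (simp_all add: gdr_zs_eq mat_emb dr_zs_eq emb_eq ent_dr)

lemma continuous_gdl_z: "continuous_on UNIV (gdl_z q ^^ n)"
proof (induction n)
  case (Suc n)
  have "continuous_on UNIV (gdl_z q)" unfolding gdl_z_eq by (rule continuous_mat_dl)
  from continuous_on_compose2[OF this Suc] show ?case by (simp add: o_def)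
qed (simp add: id_def)

lemma continuous_gdr_zs: "continuous_on UNIV (gdr_zs q ^^ n)"
proof (induction n)
  case (Suc n)
  have "continuous_on UNIV (gdr_zs q)" unfolding gdr_zs_eq by (rule continuous_mat_dr)
  from continuous_on_compose2[OF this Suc] show ?case by (simp add: o_def)
qed (simp add: id_def)

lemma gdl_z_linear: "(gdl_z q ^^ n) (X + gscale a Y) = (gdl_z q ^^ n) X + gscale a ((gdl_z q ^^ n) Y)"
proof (induction n)
  case (Suc n)
  have "mat_dl (\<lambda>r c. A r c + a * B r c) = (\<lambda>r c. mat_dl A r c + a * mat_dl B r c)" for A B
    by (intro ext) (simp add: mat_dl_def add_divide_distrib[symmetric] algebra_simps)
  then have "gdl_z q (X + gscale a Y) = gdl_z q X + gscale a (gdl_z q Y)" for X Y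
    unfolding gdl_z_eq mat_linear of_mat_linear[symmetric] by simp
  then show ?case by (simp only: funpow.simps o_apply Suc)
qed simp

lemma gdr_zs_linear: "(gdr_zs q ^^ n) (X + gscale a Y) = (gdr_zs q ^^ n) X + gscale a ((gdr_zs q ^^ n) Y)"
proof (induction n)
  case (Suc n)
  have "mat_dr (\<lambda>r c. A r c + a * B r c) = (\<lambda>r c. mat_dr A r c + a * mat_dr B r c)" for A B
    by (intro ext) (simp add: mat_dr_def add_divide_distrib[symmetric] algebra_simps)
  then have "gdr_zs q (X + gscale a Y) = gdr_zs q X + gscale a (gdr_zs q Y)" for X Y
    unfolding gdr_zs_eq mat_linear of_mat_linear[symmetric] by simp
  then show ?case by (simp only: funpow.simps o_apply Suc)
qed simp

lemma gdl_z_fin: "X \<in> fin_funs \<Longrightarrow> (gdl_z q ^^ n) X \<in> fin_funs"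
proof (induction n)
  case (Suc n)
  define A where "A = mat ((gdl_z q ^^ n) X)"
  have fin: "finite {(r, c). A r c \<noteq> 0}" using Suc by (simp add: fin_funs_iff A_def)
  have "{(r, c). mat_dl A r c \<noteq> 0} \<subseteq>
      (\<lambda>(r, c). (r - 1, c)) ` {(r, c). A r c \<noteq> 0} \<union> (\<lambda>(r, c). (r, Suc c)) ` {(r, c). A r c \<noteq> 0}"
  proof safe
    fix r c
    assume *: "mat_dl A r c \<noteq> 0" "(r, c) \<notin> (\<lambda>(r, c). (r, Suc c)) ` {(r, c). A r c \<noteq> 0}"
    then have "A (Suc r) c \<noteq> 0" by (cases c) (auto simp: mat_dl_def image_def)
    then show "(r, c) \<in> (\<lambda>(r, c). (r - 1, c)) ` {(r, c). A r c \<noteq> 0}"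
      by (intro image_eqI[of _ _ "(Suc r, c)"]) auto
  qed
  then have "finite {(r, c). mat_dl A r c \<noteq> 0}" using fin by (auto intro: finite_subset)
  moreover have "mat (gdl_z q Y) = mat_dl (mat Y)" for Y by (simp add: gdl_z_eq)
  ultimately show ?case by (simp add: fin_funs_iff A_def)
qed simp

lemma gdr_zs_fin: "X \<in> fin_funs \<Longrightarrow> (gdr_zs q ^^ n) X \<in> fin_funs"
proof (induction n)
  case (Suc n)
  define A where "A = mat ((gdr_zs q ^^ n) X)"
  have fin: "finite {(r, c). A r c \<noteq> 0}" using Suc by (simp add: fin_funs_iff A_def)
  have "{(r, c). mat_dr A r c \<noteq> 0} \<subseteq>
      (\<lambda>(r, c). (r, c - 1)) ` {(r, c). A r c \<noteq> 0} \<union> (\<lambda>(r, c). (Suc r, c)) ` {(r, c). A r c \<noteq> 0}"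
  proof safe
    fix r c
    assume *: "mat_dr A r c \<noteq> 0" "(r, c) \<notin> (\<lambda>(r, c). (Suc r, c)) ` {(r, c). A r c \<noteq> 0}"
    then have "A r (Suc c) \<noteq> 0" by (cases r) (auto simp: mat_dr_def image_def)
    then show "(r, c) \<in> (\<lambda>(r, c). (r, c - 1)) ` {(r, c). A r c \<noteq> 0}"
      by (intro image_eqI[of _ _ "(r, Suc c)"]) auto
  qed
  then have "finite {(r, c). mat_dr A r c \<noteq> 0}" using fin by (auto intro: finite_subset)
  moreover have "mat (gdr_zs q Y) = mat_dr (mat Y)" for Y by (simp add: gdr_zs_eq)
  ultimately show ?case by (simp add: fin_funs_iff A_def)
qed simp

section \<open>Bidifferential operators on finite functions\<close>

lemma fin_funs_zero: "0 \<in> fin_funs"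
  by (simp add: fin_funs_def)

lemma fin_funs_add: "X \<in> fin_funs \<Longrightarrow> Y \<in> fin_funs \<Longrightarrow> X + Y \<in> fin_funs"
  unfolding fin_funs_def mem_Collect_eq
  by (rule finite_subset[of _ "{(m, n). X m n \<noteq> 0} \<union> {(m, n). Y m n \<noteq> 0}"]) auto

lemma fin_funs_gscale: "X \<in> fin_funs \<Longrightarrow> gscale a X \<in> fin_funs"
  unfolding fin_funs_def mem_Collect_eq
  by (rule finite_subset[of _ "{(m, n). X m n \<noteq> 0}"]) (auto simp: gscale_def)

lemma fin_funs_sum: "(\<And>i. i \<in> S \<Longrightarrow> f i \<in> fin_funs) \<Longrightarrow> sum f S \<in> fin_funs"
  by (induction S rule: infinite_finite_induct) (auto simp: fin_funs_zero fin_funs_add)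

lemma gprod_fin:
  "X \<in> fin_funs \<Longrightarrow> Y \<in> tame \<Longrightarrow> gprod X Y \<in> fin_funs"
  "X \<in> tame \<Longrightarrow> Y \<in> fin_funs \<Longrightarrow> gprod X Y \<in> fin_funs"
  using finite_mat_mult_left finite_mat_mult_right tame_finite by (simp_all add: fin_funs_iff gprod_def)

lemma gprod_linear:
  "col_finite (mat W) \<Longrightarrow> gprod (X + gscale a Y) W = gprod X W + gscale a (gprod Y W)"
  "row_finite (mat W) \<Longrightarrow> gprod W (X + gscale a Y) = gprod W X + gscale a (gprod W Y)"
  unfolding gprod_def mat_linear of_mat_linear[symmetric]
  by (intro arg_cong[where f = of_mat] ext mat_mult_linear_left mat_mult_linear_right; assumption)+

definition bidiff_term :: "nat \<Rightarrow> nat \<Rightarrow> nat \<Rightarrow> nat \<Rightarrow> gfun \<Rightarrow> gfun \<Rightarrow> gfun" where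
  "bidiff_term i j n m X Y = gmul q (gmul q ((gdr_zs q ^^ i) X) (emb q (zs_z q j n))) ((gdl_z q ^^ m) Y)"

lemma gmul_emb: "gmul q (emb q f) (emb q g) = emb q (pmul q f g)"
  by (simp add: gmul_eq gprod_emb)

lemma tame_gdr: "X \<in> tame \<Longrightarrow> (gdr_zs q ^^ n) X \<in> tame"
  using gdr_zs_fin gdr_zs_emb by auto

lemma tame_gdl: "X \<in> tame \<Longrightarrow> (gdl_z q ^^ n) X \<in> tame"
  using gdl_z_fin gdl_z_emb by auto

lemma tame_gprod_emb: "X \<in> tame \<Longrightarrow> gprod X (emb q f) \<in> tame"
  using gprod_fin(1) gprod_emb by auto

lemma bidiff_term_eq:
  assumes "X \<in> tame \<or> Y \<in> tame"
  shows "bidiff_term i j n m X Y = gprod (gprod ((gdr_zs q ^^ i) X) (emb q (zs_z q j n))) ((gdl_z q ^^ m) Y)"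
proof -
  let ?Z = "gprod ((gdr_zs q ^^ i) X) (emb q (zs_z q j n))"
  have "gmul q ((gdr_zs q ^^ i) X) (emb q (zs_z q j n)) = ?Z"
    by (rule gmul_eq) simp
  moreover have "?Z \<in> tame \<or> (gdl_z q ^^ m) Y \<in> tame"
    using assms tame_gprod_emb[OF tame_gdr] tame_gdl by blast
  ultimately show ?thesis unfolding bidiff_term_def by (simp only: gmul_eq)
qed

lemma bidiff_term_emb:
  "bidiff_term i j n m (emb q f) (emb q g) =
    emb q (pmul q (pmul q ((dr_zs q ^^ i) f) (zs_z q j n)) ((dl_z q ^^ m) g))"
  by (simp add: bidiff_term_def gdr_zs_emb gdl_z_emb gmul_emb)

lemma continuous_bidiff_term_right:
  assumes "X \<in> tame"
  shows "continuous_on UNIV (\<lambda>Y. bidiff_term i j n m X Y)"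
proof -
  let ?Z = "gprod ((gdr_zs q ^^ i) X) (emb q (zs_z q j n))"
  have "continuous_on UNIV (\<lambda>Y. gprod ?Z Y)"
    using assms by (intro continuous_gprod_right tame_finite tame_gprod_emb tame_gdr)
  from continuous_on_compose2[OF this continuous_gdl_z[of m]] show ?thesis
    using assms by (simp add: bidiff_term_eq)
qed

lemma continuous_bidiff_term_left:
  assumes "Y \<in> tame"
  shows "continuous_on UNIV (\<lambda>X. bidiff_term i j n m X Y)"
proof -
  have 1: "continuous_on UNIV (\<lambda>X. gprod X ((gdl_z q ^^ m) Y))"
    using assms by (intro continuous_gprod_left tame_finite tame_gdl)
  have 2: "continuous_on UNIV (\<lambda>X. gprod X (emb q (zs_z q j n)))"
    by (intro continuous_gprod_left tame_finite) simp
  from continuous_on_compose2[OF 1 continuous_on_compose2[OF 2 continuous_gdr_zs[of i]]]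
  show ?thesis using assms by (simp add: bidiff_term_eq)
qed

lemma bidiff_term_fin:
  assumes "X \<in> fin_funs" "Y \<in> fin_funs"
  shows "bidiff_term i j n m X Y \<in> fin_funs"
  using assms by (simp add: bidiff_term_eq gprod_fin gdr_zs_fin gdl_z_fin)

lemma bidiff_term_linear:
  assumes "X \<in> fin_funs" "Y \<in> fin_funs" "W \<in> fin_funs"
  shows "bidiff_term i j n m (X + gscale a Y) W = bidiff_term i j n m X W + gscale a (bidiff_term i j n m Y W)"
    "bidiff_term i j n m W (X + gscale a Y) = bidiff_term i j n m W X + gscale a (bidiff_term i j n m W Y)"
proof -
  have t: "X + gscale a Y \<in> tame" "X \<in> tame" "Y \<in> tame" "W \<in> tame"
    using assms by (auto intro: fin_funs_add fin_funs_gscale)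
  have e: "emb q f \<in> tame" for f by simp
  note f = tame_finite[OF tame_gdr[OF t(4)]] tame_finite[OF tame_gdl[OF t(4)]] tame_finite[OF e]
    tame_finite[OF tame_gprod_emb[OF tame_gdr[OF t(4)]]]
  show "bidiff_term i j n m (X + gscale a Y) W = bidiff_term i j n m X W + gscale a (bidiff_term i j n m Y W)"
    "bidiff_term i j n m W (X + gscale a Y) = bidiff_term i j n m W X + gscale a (bidiff_term i j n m W Y)"
    using t by (simp_all add: bidiff_term_eq gdr_zs_linear gdl_z_linear gprod_linear f)
qed

lemma bidiff_fin_eq: "bidiff_fin q N a X Y =
    (\<Sum>i\<le>N. \<Sum>j\<le>N. \<Sum>n\<le>N. \<Sum>m\<le>N. gscale (a i j n m) (bidiff_term i j n m X Y))"
  by (simp add: bidiff_fin_def bidiff_term_def)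

lemma continuous_gfunI:
  assumes "\<And>m n. continuous_on UNIV (\<lambda>X. F X m n)"
  shows "continuous_on UNIV (F :: gfun \<Rightarrow> gfun)"
  by (rule continuous_on_coordinatewise_then_product, rule continuous_on_coordinatewise_then_product, rule assms)

lemma continuous_gfunD:
  assumes "continuous_on UNIV (F :: gfun \<Rightarrow> gfun)"
  shows "continuous_on UNIV (\<lambda>X. F X m n)"
  by (rule continuous_on_product_then_coordinatewise[OF continuous_on_product_then_coordinatewise[OF assms]])

lemma continuous_gscale:
  assumes "continuous_on UNIV (F :: gfun \<Rightarrow> gfun)"
  shows "continuous_on UNIV (\<lambda>X. gscale a (F X))"
  unfolding gscale_def
  by (rule continuous_gfunI) (intro continuous_on_mult continuous_on_const continuous_gfunD assms)

lemma continuous_gfun_sum: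
  assumes "\<And>i. i \<in> S \<Longrightarrow> continuous_on UNIV (F i :: gfun \<Rightarrow> gfun)"
  shows "continuous_on UNIV (\<lambda>X. \<Sum>i\<in>S. F i X)"
proof (rule continuous_gfunI)
  fix m n
  have "(\<Sum>i\<in>S. F i X) m n = (\<Sum>i\<in>S. F i X m n)" for X
    by (induction S rule: infinite_finite_induct) auto
  then show "continuous_on UNIV (\<lambda>X. (\<Sum>i\<in>S. F i X) m n)"
    by (simp only:) (intro continuous_on_sum continuous_gfunD assms)
qed

lemma gscale_sum: "gscale a (\<Sum>i\<in>S. f i) = (\<Sum>i\<in>S. gscale a (f i))"
proof (induction S rule: infinite_finite_induct)
  case (insert x F)
  then show ?case by (simp add: fun_eq_iff gscale_def distrib_left)
qed (auto simp: gscale_def fun_eq_iff)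

lemma gscale_linear: "gscale b (X + gscale a Y) = gscale b X + gscale a (gscale b Y)"
  by (simp add: gscale_def fun_eq_iff algebra_simps)

text \<open>The bidifferential expression itself is the extension: it is built from the extended derivatives and
  products, each of which is continuous in the argument that varies.\<close>

theorem bidiff_extension:
  "sep_cont_ext q (bidiff_pol q N a) (bidiff_fin q N a)"
  "bilinear_on fin_funs gscale (bidiff_fin q N a)"
  "X \<in> fin_funs \<Longrightarrow> Y \<in> fin_funs \<Longrightarrow> bidiff_fin q N a X Y \<in> fin_funs"
proof -
  show "sep_cont_ext q (bidiff_pol q N a) (bidiff_fin q N a)"
    unfolding sep_cont_ext_def
  proof (intro conjI allI ballI)
    show "bidiff_fin q N a (emb q f) (emb q g) = emb q (bidiff_pol q N a f g)" for f g
      by (simp add: bidiff_fin_eq bidiff_term_emb bidiff_pol_def emb_sum emb_pscale)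
  qed (unfold bidiff_fin_eq, intro continuous_gfun_sum continuous_gscale continuous_bidiff_term_right, assumption,
      intro continuous_gfun_sum continuous_gscale continuous_bidiff_term_left, assumption)
  show "bilinear_on fin_funs gscale (bidiff_fin q N a)"
    unfolding bilinear_on_def
    by (simp add: bidiff_fin_eq bidiff_term_linear gscale_linear sum.distrib gscale_sum)
  show "X \<in> fin_funs \<Longrightarrow> Y \<in> fin_funs \<Longrightarrow> bidiff_fin q N a X Y \<in> fin_funs"
    by (simp add: bidiff_fin_eq fin_funs_sum fin_funs_gscale bidiff_term_fin)
qed

end

section \<open>The quantization map as a formal power series\<close>

lemma fps_const_power_ring: "fps_const X ^ n = fps_const (X ^ n :: 'a::ring_1)"
  by (induction n) auto

context qdisc
begin

lemma P_power_eq_1: "P ^ n = 1 \<longleftrightarrow> n = 0"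
proof -
  have "P ^ n = 1 / Q ^ n" by (simp add: P_def power_one_over)
  then show ?thesis by auto
qed

lemma qnum_P: "(1 - P) * qnum n = 1 - P ^ n"
proof (induction n)
  case (Suc n)
  show ?case unfolding qnum_Suc distrib_left Suc by (simp add: algebra_simps)
qed simp

lemma y_zs_power: "y * zs ^ n = scal (P ^ n) * (zs ^ n * y)"
proof (induction n)
  case (Suc n)
  have "y * zs ^ Suc n = (y * zs) * zs ^ n" by (simp add: mult.assoc)
  also have "\<dots> = scal P * (zs * (y * zs ^ n))" unfolding y_zs_P by (simp add: mult.assoc)
  also have "\<dots> = scal (P ^ Suc n) * (zs ^ Suc n * y)"
    unfolding Suc by (simp add: scal_left_commute[of zs] scal_scal mult.assoc)
  finally show ?case .
qed (simp add: scal_hom(4))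

lemma y_power_zs: "y ^ n * zs = scal (P ^ n) * (zs * y ^ n)"
proof (induction n)
  case (Suc n)
  have "y ^ Suc n * zs = y * (y ^ n * zs)" by (simp add: mult.assoc)
  also have "\<dots> = scal (P ^ n) * (y * zs * y ^ n)"
    unfolding Suc by (simp add: scal_left_commute[of y] mult.assoc)
  also have "\<dots> = scal (P ^ Suc n) * (zs * y ^ Suc n)"
    unfolding y_zs_P by (simp add: scal_scal mult.assoc mult.commute[of P])
  finally show ?case .
qed (simp add: scal_hom(4))

lemma z_power_y: "z ^ n * y = scal (P ^ n) * (y * z ^ n)"
proof (induction n)
  case (Suc n)
  have "z ^ Suc n * y = z * (z ^ n * y)" by (simp add: mult.assoc)
  also have "\<dots> = scal (P ^ n) * (z * y * z ^ n)"
    unfolding Suc by (simp add: scal_left_commute[of z] mult.assoc)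
  also have "\<dots> = scal (P ^ Suc n) * (y * z ^ Suc n)"
    unfolding y_z_P by (simp add: scal_scal mult.assoc mult.commute[of P])
  finally show ?case .
qed (simp add: scal_hom(4))

lemma z_zs: "z * zs = scal P * (zs * z) + scal (1 - P)"
proof -
  have "scal P * (zs * z) = scal (P * Q) * (z * zs) + scal (P * (1 - Q))"
    unfolding zs_z distrib_left by (simp add: scal_scal mult.assoc scal_hom(2))
  also have "P * (1 - Q) = P - 1" by (simp add: right_diff_distrib)
  finally show ?thesis by (simp add: scal_hom(4,5))
qed

lemma z_zs_power: "z * zs ^ n = scal (P ^ n) * (zs ^ n * z) + scal (1 - P ^ n) * zs ^ (n - 1)"
proof (induction n)
  case (Suc n)
  have s: "scal a * X + scal b * X = scal (a + b) * X" for a b X by (simp add: scal_hom distrib_right)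
  have "z * zs ^ Suc n = (z * zs ^ n) * zs" by (simp add: mult.assoc power_commutes)
  also have "\<dots> = scal (P ^ n) * (zs ^ n * (z * zs)) + scal (1 - P ^ n) * zs ^ n"
    unfolding Suc by (cases n) (simp_all add: distrib_right mult.assoc power_commutes scal_hom)
  also have "scal (P ^ n) * (zs ^ n * (z * zs)) =
      scal (P ^ n) * (scal P * (zs ^ n * (zs * z))) + scal (P ^ n) * (scal (1 - P) * zs ^ n)"
    unfolding z_zs distrib_left scal_left_commute[of "zs ^ n"] scal_central[of "zs ^ n"] ..
  also have "zs ^ n * (zs * z) = zs ^ Suc n * z" by (simp only: power_Suc2 mult.assoc)
  finally have "z * zs ^ Suc n = scal (P ^ n * P) * (zs ^ Suc n * z) + scal (P ^ n * (1 - P) + (1 - P ^ n)) * zs ^ n"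
    by (simp only: scal_scal s add.assoc)
  then show ?case by (simp add: algebra_simps)
qed (simp add: scal_hom)

lemma z_power_zs: "z ^ n * zs = scal (P ^ n) * (zs * z ^ n) + scal (1 - P ^ n) * z ^ (n - 1)"
proof (induction n)
  case (Suc n)
  have s: "scal a * X + scal b * X = scal (a + b) * X" for a b X by (simp add: scal_hom distrib_right)
  have "z ^ Suc n * zs = z * (z ^ n * zs)" by (simp add: mult.assoc)
  also have "\<dots> = scal (P ^ n) * ((z * zs) * z ^ n) + scal (1 - P ^ n) * z ^ n"
    unfolding Suc by (cases n) (simp_all add: distrib_left mult.assoc scal_left_commute[of z] scal_hom(3))
  also have "scal (P ^ n) * ((z * zs) * z ^ n) =
      scal (P ^ n) * (scal P * (zs * z ^ Suc n)) + scal (P ^ n) * (scal (1 - P) * z ^ n)"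
    unfolding z_zs by (simp add: distrib_left distrib_right mult.assoc)
  finally have "z ^ Suc n * zs = scal (P ^ n * P) * (zs * z ^ Suc n) + scal (P ^ n * (1 - P) + (1 - P ^ n)) * z ^ n"
    by (simp only: scal_scal s add.assoc)
  then show ?case by (simp add: algebra_simps)
qed (simp add: scal_hom)

text \<open>The conjugate of multiplication by \<open>z\<close>, that is \<open>z* (1 - t y)\<^sup>-\<^sup>1\<close>, as a power series in \<open>t\<close>.\<close>

definition zs_ser :: "oper fps" where
  "zs_ser = Abs_fps (\<lambda>k. zs * y ^ k)"

text \<open>The \<open>q\<close>-binomial coefficient of \<open>j + l - 1\<close> over \<open>l\<close> to the base \<open>p\<close>: the coefficient of \<open>x\<^sup>l\<close> in the
  inverse of \<open>(1 - x) (1 - p x) \<cdots> (1 - p\<^sup>j\<^sup>-\<^sup>1 x)\<close>.\<close>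

definition beta :: "nat \<Rightarrow> nat \<Rightarrow> complex" where
  "beta l j = (\<Prod>s<l. P ^ (j + s) - 1) / (\<Prod>s<l. P ^ Suc s - 1)"

lemma beta_0 [simp]: "beta 0 j = 1"
  by (simp add: beta_def)

lemma beta_0_right: "beta (Suc l) 0 = 0"
  unfolding beta_def prod.lessThan_Suc_shift by simp

lemma beta_Suc: "(P ^ Suc l - 1) * beta (Suc l) j = beta l j * (P ^ (j + l) - 1)"
proof -
  have "beta (Suc l) j = beta l j * ((P ^ (j + l) - 1) / (P ^ Suc l - 1))"
    by (simp add: beta_def del: power_Suc)
  moreover have "P ^ Suc l - 1 \<noteq> 0" using P_power_eq_1[of "Suc l"] by simp
  ultimately show ?thesis by (simp del: power_Suc)
qed

lemma beta_Suc_shift: "(P ^ Suc l - 1) * beta (Suc l) j = (P ^ j - 1) * beta l (Suc j)"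
proof -
  have "(\<Prod>s<Suc l. P ^ (j + s) - 1) = (P ^ j - 1) * (\<Prod>s<l. P ^ (Suc j + s) - 1)"
    by (subst prod.lessThan_Suc_shift) simp
  moreover have "(\<Prod>s<Suc l. P ^ Suc s - 1) = (\<Prod>s<l. P ^ Suc s - 1) * (P ^ Suc l - 1)"
    by (rule prod.lessThan_Suc)
  ultimately have "beta (Suc l) j = (P ^ j - 1) / (P ^ Suc l - 1) * beta l (Suc j)"
    unfolding beta_def by (simp only: times_divide_times_eq mult.commute)
  moreover have "P ^ Suc l - 1 \<noteq> 0" using P_power_eq_1[of "Suc l"] by simp
  ultimately show ?thesis by (simp del: power_Suc)
qed

lemma beta_Suc_Suc: "beta (Suc l) (Suc j) = beta l (Suc j) + P ^ Suc l * beta (Suc l) j"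
proof -
  have "(P ^ Suc l - 1) * beta (Suc l) (Suc j) = beta l (Suc j) * (P ^ (Suc j + l) - 1)"
    by (rule beta_Suc)
  also have "\<dots> = beta l (Suc j) * (P ^ Suc l - 1) + P ^ Suc l * ((P ^ j - 1) * beta l (Suc j))"
    by (simp add: power_add algebra_simps)
  also have "\<dots> = (P ^ Suc l - 1) * (beta l (Suc j) + P ^ Suc l * beta (Suc l) j)"
    unfolding beta_Suc_shift[symmetric] by (simp add: algebra_simps)
  finally show ?thesis using P_power_eq_1[of "Suc l"] by simp
qed

lemma mult_zs_ser_0: "fps_nth (F * zs_ser) 0 = fps_nth F 0 * zs"
  by (simp add: zs_ser_def)

text \<open>Coefficientwise form of \<open>F z* (1 - t y)\<^sup>-\<^sup>1 \<cdot> (1 - t y) = F z*\<close>, which avoids convolutions.\<close>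

lemma mult_zs_ser_Suc: "fps_nth (F * zs_ser) (Suc n) = fps_nth (F * zs_ser) n * y + fps_nth F (Suc n) * zs"
proof -
  have "fps_nth (F * zs_ser) (Suc n) = (\<Sum>i=0..n. fps_nth F i * (zs * y ^ (Suc n - i))) + fps_nth F (Suc n) * zs"
    by (simp add: fps_mult_nth zs_ser_def)
  also have "(\<Sum>i=0..n. fps_nth F i * (zs * y ^ (Suc n - i))) = (\<Sum>i=0..n. fps_nth F i * (zs * y ^ (n - i)) * y)"
    by (intro sum.cong) (auto simp: Suc_diff_le mult.assoc power_commutes)
  finally show ?thesis by (simp add: fps_mult_nth zs_ser_def sum_distrib_right)
qed

text \<open>Moving the factors \<open>(1 - t y)\<^sup>-\<^sup>1\<close> to the right through the powers of \<open>z*\<close> gives the product of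
  \<open>(1 - t p\<^sup>s y)\<^sup>-\<^sup>1\<close> over \<open>s < j\<close>, whose coefficients are \<open>q\<close>-binomial.\<close>

lemma zs_ser_power: "fps_nth (zs_ser ^ j) l = scal (beta l j) * (zs ^ j * y ^ l)"
proof (induction j arbitrary: l)
  case 0
  then show ?case by (cases l) (simp_all add: beta_0_right scal_hom)
next
  case (Suc j)
  show ?case
  proof (induction l)
    case 0
    then show ?case unfolding power_Suc2 mult_zs_ser_0 Suc by (simp add: scal_hom)
  next
    case (Suc l)
    have "fps_nth (zs_ser ^ Suc j) (Suc l) = scal (beta l (Suc j)) * (zs ^ Suc j * y ^ l) * y
        + scal (beta (Suc l) j) * (zs ^ j * y ^ Suc l) * zs"
      unfolding power_Suc2[of zs_ser] mult_zs_ser_Suc \<open>\<And>l. fps_nth (zs_ser ^ j) l = scal (beta l j) * (zs ^ j * y ^ l)\<close>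
      unfolding power_Suc2[of zs_ser, symmetric] Suc ..
    also have "scal (beta l (Suc j)) * (zs ^ Suc j * y ^ l) * y = scal (beta l (Suc j)) * (zs ^ Suc j * y ^ Suc l)"
      by (simp only: power_Suc2[of y] mult.assoc)
    also have "scal (beta (Suc l) j) * (zs ^ j * y ^ Suc l) * zs = scal (beta (Suc l) j) * (zs ^ j * (y ^ Suc l * zs))"
      by (simp only: mult.assoc)
    also have "\<dots> = scal (P ^ Suc l * beta (Suc l) j) * (zs ^ Suc j * y ^ Suc l)"
      unfolding y_power_zs scal_left_commute[of "zs ^ j"] scal_scal power_Suc2[of zs]
      by (simp only: mult.assoc mult.commute[of "beta _ _"])
    finally show ?case unfolding beta_Suc_Suc scal_hom(1) distrib_right .
  qed
qed

definition ser_gen :: "pgen \<Rightarrow> oper fps" where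
  "ser_gen x = (case x of Z \<Rightarrow> fps_const z | Zs \<Rightarrow> zs_ser)"

text \<open>The quantization map with its dependence on \<open>t\<close> turned into a formal power series; the coefficient of
  \<open>t\<^sup>l\<close> is a linear map \<open>H\<^sub>l\<close> applied to \<open>f\<close>.\<close>

definition quant_ser :: "pol \<Rightarrow> oper fps" where
  "quant_ser f = ev (\<lambda>c. fps_const (scal c)) ser_gen (normal_form Z Zs f)"

lemma quant_ser_add: "quant_ser (f + g) = quant_ser f + quant_ser g"
  by (simp add: quant_ser_def normal_form_add fscal.ev_add)

lemma quant_ser_single: "quant_ser (Poly_Mapping.single (i, j) c) = fps_const (scal c * z ^ i) * zs_ser ^ j"
  by (simp add: quant_ser_def normal_form_single fscal.ev_mult fscal.ev_power ser_gen_def fps_const_power_ring)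

lemma quant_ser_single_nth: "fps_nth (quant_ser (Poly_Mapping.single (i, j) c)) l = scal (c * beta l j) * (z ^ i * zs ^ j * y ^ l)"
  unfolding quant_ser_single fps_mult_left_const_nth zs_ser_power
  by (simp add: scal_left_commute[of "z ^ i"] scal_scal mult.assoc)

lemma quant_ser_pscale: "quant_ser (pscale c f) = fps_const (scal c) * quant_ser f"
proof (induction f rule: poly_mapping_single_induct)
  case (single w d)
  obtain i j where "w = (i, j)" by force
  then show ?case by (intro fps_ext) (simp add: quant_ser_single_nth scal_scal mult.assoc)
qed (simp add: pscale_add quant_ser_add distrib_left)

lemma quant_ser_0: "fps_nth (quant_ser f) 0 = rep f"
proof (induction f rule: poly_mapping_single_induct)
  case (single w d)
  obtain i j where "w = (i, j)" by force
  then show ?case by (simp add: quant_ser_single_nth rep_single)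
qed (simp add: quant_ser_add rep_add)

lemma quant_ser_alg: "fps_nth (quant_ser f) l \<in> alg"
proof (induction f rule: poly_mapping_single_induct)
  case (single w d)
  obtain i j where "w = (i, j)" by force
  then show ?case by (simp only: quant_ser_single_nth) (intro alg_mult alg_power alg_scal alg_z alg_zs alg_y)
qed (auto simp: quant_ser_add)

text \<open>For \<open>T = z\<^sup>i z*\<^sup>j\<close> one has \<open>H\<^sub>l T = c\<^sub>l T y\<^sup>l\<close> with the \<open>q\<close>-binomial coefficient \<open>c\<^sub>l\<close>, and
  \<open>(p\<^sup>l\<^sup>+\<^sup>1 - 1) c\<^sub>l\<^sub>+\<^sub>1 = c\<^sub>l (p\<^sup>j\<^sup>+\<^sup>l - 1)\<close>. The factor \<open>p\<^sup>j\<close>, which depends on the monomial, is produced by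
  two-sided multiplications, since \<open>T - z T z* = p\<^sup>j T y\<close>.\<close>

lemma quant_ser_Suc: "scal (P ^ Suc l - 1) * fps_nth (quant_ser f) (Suc l) =
    scal (P ^ l) * fps_nth (quant_ser f) l - z * fps_nth (quant_ser f) l * zs - fps_nth (quant_ser f) l * y"
proof (induction f rule: poly_mapping_single_induct)
  case (single w c)
  obtain i j where w: "w = (i, j)" by force
  let ?T = "z ^ i * zs ^ j"
  have s: "scal a * X - scal b * X = scal (a - b) * X" for a b X by (simp add: scal_hom left_diff_distrib)
  have T: "z * ?T * zs = ?T - scal (P ^ j) * (?T * y)"
  proof -
    have "z * ?T * zs = z ^ i * (z * zs) * zs ^ j"
      by (simp add: mult.assoc power_commutes) (simp add: mult.assoc[symmetric] power_commutes)
    also have "z * zs = 1 - y" by (simp add: y_eq)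
    also have "z ^ i * (1 - y) * zs ^ j = ?T - z ^ i * (y * zs ^ j)"
      by (simp add: right_diff_distrib left_diff_distrib mult.assoc)
    also have "\<dots> = ?T - scal (P ^ j) * (?T * y)"
      unfolding y_zs_power scal_left_commute[of "z ^ i"] by (simp add: mult.assoc)
    finally show ?thesis .
  qed
  let ?R = "?T * y ^ Suc l"
  have 1: "z * (?T * y ^ l) * zs = scal (P ^ l) * (?T * y ^ l) - scal (P ^ l * P ^ j) * ?R"
  proof -
    have "z * (?T * y ^ l) * zs = z * ?T * (y ^ l * zs)" by (simp only: mult.assoc)
    also have "\<dots> = scal (P ^ l) * (z * ?T * zs * y ^ l)"
      unfolding y_power_zs scal_left_commute[of "z * ?T"] by (simp only: mult.assoc)
    also have "\<dots> = scal (P ^ l) * (?T * y ^ l) - scal (P ^ l) * (scal (P ^ j) * ?R)"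
      unfolding T by (simp only: left_diff_distrib right_diff_distrib mult.assoc power_Suc)
    finally show ?thesis unfolding scal_scal .
  qed
  have 2: "(P ^ Suc l - 1) * (c * beta (Suc l) j) = (c * beta l j) * (P ^ l * P ^ j - 1)"
    using arg_cong[OF beta_Suc[of l j], of "\<lambda>x. c * x"] by (simp add: power_add algebra_simps)
  have "scal (P ^ l) * (scal (c * beta l j) * (?T * y ^ l)) - z * (scal (c * beta l j) * (?T * y ^ l)) * zs
      - scal (c * beta l j) * (?T * y ^ l) * y =
    scal (c * beta l j) * (scal (P ^ l) * (?T * y ^ l) - z * (?T * y ^ l) * zs - ?R)"
    unfolding scal_left_commute[of z] right_diff_distrib power_Suc2[of y]
    by (simp only: scal_scal mult.assoc mult.commute[of "P ^ l"])
  also have "\<dots> = scal (c * beta l j) * (scal (P ^ l * P ^ j - 1) * ?R)"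
    unfolding 1 by (simp add: scal_hom left_diff_distrib)
  also have "\<dots> = scal (P ^ Suc l - 1) * (scal (c * beta (Suc l) j) * ?R)"
    unfolding scal_scal 2 ..
  finally show ?case unfolding w quant_ser_single_nth by simp
next
  case (add f g)
  show ?case unfolding quant_ser_add fps_add_nth distrib_left distrib_right add by simp
qed

section \<open>Power series with coefficients in the algebra\<close>

text \<open>The extension of the quantization map to the power series \<open>\<Sum> t\<^sup>k c\<^sub>k\<close>, linear over power series in
  \<open>t\<close>.\<close>

definition quant_seq :: "(nat \<Rightarrow> pol) \<Rightarrow> oper fps" where
  "quant_seq c = Abs_fps (\<lambda>k. \<Sum>l\<le>k. fps_nth (quant_ser (c l)) (k - l))"

lemma quant_seq_nth: "fps_nth (quant_seq c) k = rep (c k) + (\<Sum>l<k. fps_nth (quant_ser (c l)) (k - l))"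
  by (simp add: quant_seq_def lessThan_Suc_atMost[symmetric] quant_ser_0 add.commute)

text \<open>The constant coefficient of the quantization of \<open>f\<close> is \<open>f\<close> itself, so the map is triangular with
  injective diagonal.\<close>

lemma quant_seq_inj:
  assumes "quant_seq c = quant_seq d"
  shows "c k = d k"
proof (induction k rule: less_induct)
  case (less k)
  then have "(\<Sum>l<k. fps_nth (quant_ser (c l)) (k - l)) = (\<Sum>l<k. fps_nth (quant_ser (d l)) (k - l))"
    by (intro sum.cong) auto
  then have "rep (c k) = rep (d k)"
    using arg_cong[OF assms, of "\<lambda>F. fps_nth F k"] unfolding quant_seq_nth by simp
  then show ?case by (simp add: rep_inj)
qed

lemma quant_seq_linear: "quant_seq (\<lambda>k. c k + pscale a (d k)) = quant_seq c + fps_const (scal a) * quant_seq d"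
  by (rule fps_ext) (simp add: quant_seq_def quant_ser_add quant_ser_pscale sum.distrib sum_distrib_left)

lemma quant_seq_left:
  assumes "\<And>f. quant_ser (T f) = fps_const X * quant_ser f"
  shows "quant_seq (\<lambda>k. T (c k)) = fps_const X * quant_seq c"
  by (rule fps_ext) (simp add: quant_seq_def assms sum_distrib_left)

text \<open>A common factor on the right can be taken out of \<open>\<Sum> t\<^sup>l F\<^sub>l\<close>; both sides sum over the triples of
  indices with sum \<open>k\<close>.\<close>

lemma fps_mult_sum_shift:
  fixes F :: "nat \<Rightarrow> 'a::ring_1 fps"
  shows "Abs_fps (\<lambda>k. \<Sum>l\<le>k. fps_nth (F l * G) (k - l)) = Abs_fps (\<lambda>k. \<Sum>l\<le>k. fps_nth (F l) (k - l)) * G"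
proof (rule fps_ext)
  fix k
  have "(\<Sum>l\<le>k. fps_nth (F l * G) (k - l)) = (\<Sum>l\<le>k. \<Sum>i\<le>k - l. fps_nth (F l) i * fps_nth G (k - l - i))"
    by (simp add: fps_mult_nth atLeast0AtMost)
  also have "\<dots> = (\<Sum>(l, i)\<in>{(l, i). l + i \<le> k}. fps_nth (F l) i * fps_nth G (k - l - i))"
    by (subst sum.Sigma) (auto intro!: sum.cong)
  also have "\<dots> = (\<Sum>(m, l)\<in>(SIGMA m:{..k}. {..m}). fps_nth (F l) (m - l) * fps_nth G (k - m))"
    by (rule sum.reindex_bij_witness[of _ "\<lambda>(m, l). (l, m - l)" "\<lambda>(l, i). (l + i, l)"]) (auto simp: diff_diff_left)
  also have "\<dots> = (\<Sum>m\<le>k. (\<Sum>l\<le>m. fps_nth (F l) (m - l)) * fps_nth G (k - m))"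
    by (subst sum.Sigma[symmetric]) (auto simp: sum_distrib_right)
  finally show "fps_nth (Abs_fps (\<lambda>k. \<Sum>l\<le>k. fps_nth (F l * G) (k - l))) k =
    fps_nth (Abs_fps (\<lambda>k. \<Sum>l\<le>k. fps_nth (F l) (k - l)) * G) k"
    by (simp add: fps_mult_nth atLeast0AtMost)
qed

lemma quant_seq_right:
  assumes "\<And>f. quant_ser (T f) = quant_ser f * G"
  shows "quant_seq (\<lambda>k. T (c k)) = quant_seq c * G"
  unfolding quant_seq_def assms by (rule fps_mult_sum_shift)

section \<open>The coefficients of the expansion\<close>

text \<open>The bilinear map \<open>C\<^sub>k\<close>, obtained by comparing the coefficients of \<open>t\<^sup>k\<close>. The value for \<open>k = 0\<close> is the
  product, which lets the recursion start without a special case.\<close>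

fun berezin :: "nat \<Rightarrow> pol \<Rightarrow> pol \<Rightarrow> pol" where
  "berezin k f g = unrep (fps_nth (quant_ser f * quant_ser g) k - (\<Sum>l<k. fps_nth (quant_ser (berezin l f g)) (k - l)))"

declare berezin.simps [simp del]

lemma rep_berezin: "rep (berezin k f g) = fps_nth (quant_ser f * quant_ser g) k - (\<Sum>l<k. fps_nth (quant_ser (berezin l f g)) (k - l))"
  unfolding berezin.simps[of k]
  by (rule rep_unrep) (auto simp: fps_mult_nth intro!: alg_diff alg_sum alg_mult quant_ser_alg)

lemma quant_seq_berezin: "quant_seq (\<lambda>k. berezin k f g) = quant_ser f * quant_ser g"
  by (rule fps_ext) (simp add: quant_seq_nth rep_berezin)

lemma berezin_0: "berezin 0 f g = pmul q f g"
proof -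
  have "rep (berezin 0 f g) = rep (pmul q f g)" by (simp add: rep_berezin rep_pmul quant_ser_0)
  then show ?thesis by (simp add: rep_inj)
qed

lemma berezin_bilinear: "bilinear_on UNIV pscale (berezin k)"
proof -
  have "berezin k (f + pscale a g) h = berezin k f h + pscale a (berezin k g h)" for f g h a
    by (rule quant_seq_inj[of "\<lambda>k. berezin k (f + pscale a g) h" "\<lambda>k. berezin k f h + pscale a (berezin k g h)"])
      (simp add: quant_seq_linear quant_seq_berezin quant_ser_add quant_ser_pscale distrib_right mult.assoc)
  moreover have "berezin k h (f + pscale a g) = berezin k h f + pscale a (berezin k h g)" for f g h a
  proof (rule quant_seq_inj[of "\<lambda>k. berezin k h (f + pscale a g)" "\<lambda>k. berezin k h f + pscale a (berezin k h g)"])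
    have "quant_ser h * (fps_const (scal a) * quant_ser g) = fps_const (scal a) * (quant_ser h * quant_ser g)"
      using fscal.s_central[of "quant_ser h" a] by (simp add: mult.assoc[symmetric])
    then show "quant_seq (\<lambda>k. berezin k h (f + pscale a g)) = quant_seq (\<lambda>k. berezin k h f + pscale a (berezin k h g))"
      by (simp add: quant_seq_linear quant_seq_berezin quant_ser_add quant_ser_pscale distrib_left)
  qed
  ultimately show ?thesis by (simp add: bilinear_on_def)
qed

lemma pmul_add: "pmul q (f + g) h = pmul q f h + pmul q g h" "pmul q h (f + g) = pmul q h f + pmul q h g"
  by (simp_all add: rep_inj[symmetric] rep_pmul rep_add distrib_left distrib_right)

lemma quant_ser_left_mono: "quant_ser (pmul q (mono a 0) f) = fps_const (z ^ a) * quant_ser f"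
proof (induction f rule: poly_mapping_single_induct)
  case (single w c)
  obtain i j where w: "w = (i, j)" by force
  have "pmul q (mono a 0) (Poly_Mapping.single w c) = Poly_Mapping.single (a + i, j) c"
    by (simp add: rep_inj[symmetric] rep_pmul rep_mono rep_single w scal_left_commute[of "z ^ a"] power_add mult.assoc)
  moreover have "fps_const (scal c * z ^ (a + i)) = fps_const (z ^ a) * fps_const (scal c * z ^ i)"
    by (simp add: scal_left_commute[of "z ^ a"] power_add)
  ultimately show ?case
    by (simp only: quant_ser_single w mult.assoc)
qed (simp add: pmul_add quant_ser_add distrib_left)

lemma quant_ser_right_mono: "quant_ser (pmul q f (mono 0 b)) = quant_ser f * zs_ser ^ b"
proof (induction f rule: poly_mapping_single_induct)
  case (single w c)
  obtain i j where w: "w = (i, j)" by force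
  have "pmul q (Poly_Mapping.single w c) (mono 0 b) = Poly_Mapping.single (i, j + b) c"
    by (simp add: rep_inj[symmetric] rep_pmul rep_mono rep_single w power_add mult.assoc)
  then show ?case
    by (simp add: quant_ser_single w power_add mult.assoc)
qed (simp add: pmul_add quant_ser_add distrib_right)

text \<open>Quantization turns left multiplication by \<open>z\<close> into left multiplication by \<open>z\<close>, and right
  multiplication by \<open>z*\<close> into right multiplication by the quantized \<open>z*\<close>. Both pass through the product
  of two quantized elements and are reflected by injectivity.\<close>

lemma berezin_mono: "rep (berezin k (mono a J) (mono M b)) = z ^ a * rep (berezin k (mono 0 J) (mono M 0)) * zs ^ b"
proof -
  let ?f = "mono 0 J" and ?g = "mono M 0"
  have "mono a J = pmul q (mono a 0) ?f" "mono M b = pmul q ?g (mono 0 b)"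
    by (simp_all add: rep_inj[symmetric] rep_pmul rep_mono)
  then have "quant_ser (mono a J) = fps_const (z ^ a) * quant_ser ?f" "quant_ser (mono M b) = quant_ser ?g * zs_ser ^ b"
    using quant_ser_left_mono[of a ?f] quant_ser_right_mono[of ?g b] by simp_all
  then have "quant_seq (\<lambda>k. berezin k (mono a J) (mono M b)) = fps_const (z ^ a) * (quant_ser ?f * quant_ser ?g * zs_ser ^ b)"
    unfolding quant_seq_berezin by (simp add: mult.assoc)
  also have "\<dots> = quant_seq (\<lambda>k. pmul q (mono a 0) (pmul q (berezin k ?f ?g) (mono 0 b)))"
    by (subst quant_seq_left[where T = "pmul q (mono a 0)", OF quant_ser_left_mono],
        subst quant_seq_right[where T = "\<lambda>f. pmul q f (mono 0 b)", OF quant_ser_right_mono]) (simp add: quant_seq_berezin)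
  finally have "berezin k (mono a J) (mono M b) = pmul q (mono a 0) (pmul q (berezin k ?f ?g) (mono 0 b))"
    by (rule quant_seq_inj)
  then show ?thesis by (simp add: rep_pmul rep_mono mult.assoc)
qed

end

section \<open>Symbols of bidifferential operators\<close>

context qdisc
begin

definition qfall :: "nat \<Rightarrow> nat \<Rightarrow> complex" where
  "qfall i n = (\<Prod>l<i. qnum (n - l))"

text \<open>\<open>du i J\<close> is \<open>(\<partial>/\<partial>z*)\<^sup>i z*\<^sup>J\<close> and \<open>dv m M\<close> is \<open>(\<partial>/\<partial>z)\<^sup>m z\<^sup>M\<close>. They vanish for \<open>J < i\<close> and \<open>M < m\<close>, where
  the product of \<open>q\<close>-numbers contains the \<open>q\<close>-number of \<open>0\<close>.\<close>

definition du :: "nat \<Rightarrow> nat \<Rightarrow> oper" where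
  "du i J = scal (qfall i J) * zs ^ (J - i)"

definition dv :: "nat \<Rightarrow> nat \<Rightarrow> oper" where
  "dv m M = scal (qfall m M) * z ^ (M - m)"

lemma dr_iter: "(dr ^^ i) (Poly_Mapping.single (a, J) c) = Poly_Mapping.single (a, J - i) (c * qfall i J)"
  by (induction i) (simp_all add: dr_single qfall_def mult.assoc)

lemma dl_iter: "(dl ^^ m) (Poly_Mapping.single (M, b) c) = Poly_Mapping.single (M - m, b) (c * qfall m M)"
  by (induction m) (simp_all add: dl_single qfall_def mult.assoc)

lemma rep_dr_iter: "rep ((dr ^^ i) (Poly_Mapping.single (a, J) c)) = scal c * (z ^ a * du i J)"
  unfolding dr_iter rep_single du_def
  by (simp add: scal_left_commute[of "z ^ a"] scal_scal)

lemma rep_dl_iter: "rep ((dl ^^ m) (Poly_Mapping.single (M, b) c)) = scal c * (dv m M * zs ^ b)"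
  unfolding dl_iter rep_single dv_def by (simp add: scal_scal mult.assoc)

lemma qfall_Suc: "(1 - P) * qfall (Suc i) n = qfall i n * (1 - P ^ (n - i))"
  unfolding qfall_def prod.lessThan_Suc qnum_P[symmetric] by simp

lemma qfall_eq_0: "n \<le> i \<Longrightarrow> qfall (Suc i) n = 0"
  by (simp add: qfall_def)

lemma du_Suc_zs: "du (Suc i) J * zs = scal (qfall (Suc i) J) * zs ^ (J - i)"
proof (cases "J \<le> i")
  case False
  then have "J - i = Suc (J - Suc i)" by simp
  then show ?thesis by (simp only: du_def mult.assoc power_Suc2)
qed (simp add: du_def qfall_eq_0 scal_hom)

lemma z_dv_Suc: "z * dv (Suc m) M = scal (qfall (Suc m) M) * z ^ (M - m)"
proof (cases "M \<le> m")
  case False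
  then have "M - m = Suc (M - Suc m)" by simp
  then show ?thesis by (simp only: dv_def scal_left_commute[of z] power_Suc)
qed (simp add: dv_def qfall_eq_0 scal_hom)

lemma scal_diff_mult: "scal a * X - scal b * X = scal (a - b) * X"
  by (simp add: scal_hom left_diff_distrib)

text \<open>Moving \<open>z\<close> through \<open>z*\<^sup>J\<^sup>-\<^sup>i\<close> produces the factor \<open>1 - p\<^sup>J\<^sup>-\<^sup>i\<close>. It depends on \<open>J\<close>, but it is the factor by
  which \<open>(1 - p)\<close> times the next derivative differs from the present one.\<close>

lemma z_du: "z * du i J = (du i J - scal (1 - P) * du (Suc i) J * zs) * z + scal (1 - P) * du (Suc i) J"
proof -
  have "z * du i J = scal (qfall i J) * (scal (P ^ (J - i)) * (zs ^ (J - i) * z) + scal (1 - P ^ (J - i)) * zs ^ (J - i - 1))"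
    unfolding du_def scal_left_commute[of z] z_zs_power ..
  also have "\<dots> = scal (qfall i J * P ^ (J - i)) * zs ^ (J - i) * z + scal (qfall i J * (1 - P ^ (J - i))) * zs ^ (J - Suc i)"
    by (simp add: distrib_left scal_scal mult.assoc)
  also have "scal (qfall i J * (1 - P ^ (J - i))) * zs ^ (J - Suc i) = scal (1 - P) * du (Suc i) J"
    unfolding qfall_Suc[symmetric] du_def scal_scal ..
  also have "scal (qfall i J * P ^ (J - i)) * zs ^ (J - i) = du i J - scal (1 - P) * (du (Suc i) J * zs)"
    unfolding du_Suc_zs scal_scal qfall_Suc unfolding du_def scal_diff_mult by (simp add: right_diff_distrib)
  finally show ?thesis by (simp only: mult.assoc)
qed

lemma qfall_P: "scal (qfall m M * P ^ (M - m)) * z ^ (M - m) = dv m M - scal (1 - P) * (z * dv (Suc m) M)"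
  unfolding z_dv_Suc scal_scal qfall_Suc unfolding dv_def scal_diff_mult by (simp add: right_diff_distrib)

text \<open>The same mechanism on the other side: \<open>p\<^sup>M\<^sup>-\<^sup>m\<close> is \<open>1\<close> minus a multiple of the \<open>q\<close>-number that the next
  derivative contributes.\<close>

lemma dv_y: "dv m M * y = y * (dv m M - scal (1 - P) * (z * dv (Suc m) M))"
proof -
  have "dv m M * y = scal (qfall m M) * (scal (P ^ (M - m)) * (y * z ^ (M - m)))"
    unfolding dv_def mult.assoc z_power_y ..
  then show ?thesis unfolding qfall_P[symmetric] scal_left_commute[of y] by (simp add: scal_scal)
qed

lemma dv_zs: "dv m M * zs = zs * (dv m M - scal (1 - P) * (z * dv (Suc m) M)) + scal (1 - P) * dv (Suc m) M"
proof -
  have "dv m M * zs = scal (qfall m M) * (scal (P ^ (M - m)) * (zs * z ^ (M - m)) + scal (1 - P ^ (M - m)) * z ^ (M - m - 1))"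
    unfolding dv_def mult.assoc z_power_zs ..
  also have "\<dots> = zs * (scal (qfall m M * P ^ (M - m)) * z ^ (M - m)) + scal (qfall m M * (1 - P ^ (M - m))) * z ^ (M - Suc m)"
    by (simp add: distrib_left scal_left_commute[of zs] scal_scal)
  also have "scal (qfall m M * (1 - P ^ (M - m))) * z ^ (M - Suc m) = scal (1 - P) * dv (Suc m) M"
    unfolding qfall_Suc[symmetric] dv_def scal_scal ..
  finally show ?thesis unfolding qfall_P .
qed

text \<open>The values at \<open>(z*\<^sup>J, z\<^sup>M)\<close> of the bidifferential operators, with an arbitrary element of the algebra in
  the middle. The coefficients may not depend on \<open>J\<close> and \<open>M\<close>, hence functions of both indices.\<close>

inductive_set symbols :: "(nat \<Rightarrow> nat \<Rightarrow> oper) set" where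
  symbols_term: "a \<in> alg \<Longrightarrow> (\<lambda>J M. du i J * a * dv m M) \<in> symbols"
| symbols_add: "F \<in> symbols \<Longrightarrow> G \<in> symbols \<Longrightarrow> (\<lambda>J M. F J M + G J M) \<in> symbols"

lemma symbols_scal: "F \<in> symbols \<Longrightarrow> (\<lambda>J M. scal c * F J M) \<in> symbols"
proof (induction rule: symbols.induct)
  case (symbols_term a i m)
  have "(\<lambda>J M. scal c * (du i J * a * dv m M)) = (\<lambda>J M. du i J * (scal c * a) * dv m M)"
    by (intro ext) (simp only: mult.assoc scal_left_commute[of "du i _"])
  then show ?case using symbols_term by (auto intro: symbols.symbols_term)
next
  case (symbols_add F G)
  from symbols.symbols_add[OF symbols_add.IH] show ?case by (simp only: distrib_left)
qed

lemma symbols_diff: "F \<in> symbols \<Longrightarrow> G \<in> symbols \<Longrightarrow> (\<lambda>J M. F J M - G J M) \<in> symbols"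
  using symbols_add[OF _ symbols_scal[of G "- 1"], of F] by (simp add: scal_hom)

lemma symbols_sum: "(\<And>i. i < (n::nat) \<Longrightarrow> F i \<in> symbols) \<Longrightarrow> (\<lambda>J M. \<Sum>i<n. F i J M) \<in> symbols"
proof (induction n)
  case 0
  show ?case using symbols_term[of 0 0 0] by simp
next
  case (Suc n)
  then have "(\<lambda>J M. (\<Sum>i<n. F i J M) + F n J M) \<in> symbols" by (intro symbols_add) auto
  then show ?case by simp
qed

lemma symbols_left_z: "F \<in> symbols \<Longrightarrow> (\<lambda>J M. z * F J M) \<in> symbols"
proof (induction rule: symbols.induct)
  case (symbols_term a i m)
  have eq: "z * (du i J * a * dv m M) = du i J * (z * a) * dv m M - du (Suc i) J * (scal (1 - P) * (zs * z * a)) * dv m M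
      + du (Suc i) J * (scal (1 - P) * a) * dv m M" for J M
  proof -
    have "z * (du i J * a * dv m M) = (z * du i J) * (a * dv m M)" by (simp only: mult.assoc)
    then show ?thesis unfolding z_du
      by (simp only: distrib_right left_diff_distrib mult.assoc scal_left_commute[of "du (Suc i) J"])
  qed
  show ?case unfolding eq
    using symbols_term by (intro symbols_add symbols_diff symbols.symbols_term alg_mult alg_scal alg_z alg_zs)
next
  case (symbols_add F G)
  from symbols.symbols_add[OF symbols_add.IH] show ?case by (simp only: distrib_left)
qed

lemma symbols_right_zs: "F \<in> symbols \<Longrightarrow> (\<lambda>J M. F J M * zs) \<in> symbols"
proof (induction rule: symbols.induct)
  case (symbols_term a i m)
  have eq: "du i J * a * dv m M * zs = du i J * (a * zs) * dv m M - du i J * (scal (1 - P) * (a * zs * z)) * dv (Suc m) M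
      + du i J * (scal (1 - P) * a) * dv (Suc m) M" for J M
  proof -
    have "du i J * a * dv m M * zs = du i J * (a * (dv m M * zs))" by (simp only: mult.assoc)
    then show ?thesis unfolding dv_zs
      by (simp only: distrib_left right_diff_distrib mult.assoc scal_left_commute[of zs] scal_left_commute[of a])
  qed
  show ?case unfolding eq
    using symbols_term by (intro symbols_add symbols_diff symbols.symbols_term alg_mult alg_scal alg_z alg_zs)
next
  case (symbols_add F G)
  from symbols.symbols_add[OF symbols_add.IH] show ?case by (simp only: distrib_right)
qed

lemma symbols_right_y: "F \<in> symbols \<Longrightarrow> (\<lambda>J M. F J M * y) \<in> symbols"
proof (induction rule: symbols.induct)
  case (symbols_term a i m)
  have eq: "du i J * a * dv m M * y = du i J * (a * y) * dv m M - du i J * (scal (1 - P) * (a * y * z)) * dv (Suc m) M" for J M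
  proof -
    have "du i J * a * dv m M * y = du i J * (a * (dv m M * y))" by (simp only: mult.assoc)
    then show ?thesis unfolding dv_y
      by (simp only: right_diff_distrib mult.assoc scal_left_commute[of y] scal_left_commute[of a])
  qed
  show ?case unfolding eq
    using symbols_term by (intro symbols_diff symbols.symbols_term alg_mult alg_scal alg_z alg_y)
next
  case (symbols_add F G)
  from symbols.symbols_add[OF symbols_add.IH] show ?case by (simp only: distrib_right)
qed

lemma quant_ser_Suc_eq: "fps_nth (quant_ser f) (Suc l) = scal (1 / (P ^ Suc l - 1)) *
    (scal (P ^ l) * fps_nth (quant_ser f) l - z * (fps_nth (quant_ser f) l * zs) - fps_nth (quant_ser f) l * y)"
proof -
  have "P ^ Suc l - 1 \<noteq> 0" using P_power_eq_1[of "Suc l"] by simp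
  moreover have "fps_nth (quant_ser f) (Suc l) = scal (1 / (P ^ Suc l - 1) * (P ^ Suc l - 1)) * fps_nth (quant_ser f) (Suc l)"
    using calculation by (simp add: scal_hom(4) del: power_Suc)
  ultimately show ?thesis unfolding scal_scal[symmetric] quant_ser_Suc by (simp only: mult.assoc)
qed

text \<open>Each \<open>H\<^sub>l\<close> is composed of multiplications under which symbols are stable.\<close>

lemma symbols_quant_ser:
  assumes "(\<lambda>J M. rep (c J M)) \<in> symbols"
  shows "(\<lambda>J M. fps_nth (quant_ser (c J M)) l) \<in> symbols"
proof (induction l)
  case 0
  show ?case using assms by (simp only: quant_ser_0)
next
  case (Suc l)
  show ?case unfolding quant_ser_Suc_eq
    by (intro symbols_scal symbols_diff symbols_left_z symbols_right_zs symbols_right_y Suc)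
qed

text \<open>The element \<open>a\<close> collects the factors that the recursion for \<open>H\<^sub>k\<close> puts to the right of \<open>z*\<^sup>J\<close>, hence
  between the two derivatives.\<close>

lemma symbols_quant_ser_mono: "a \<in> alg \<Longrightarrow> (\<lambda>J M. fps_nth (quant_ser (mono 0 J)) k * (a * z ^ M)) \<in> symbols"
proof (induction k arbitrary: a)
  case 0
  have "(\<lambda>J M. du 0 J * a * dv 0 M) \<in> symbols" using 0 by (rule symbols_term)
  then show ?case by (simp add: quant_ser_0 rep_mono du_def dv_def qfall_def scal_hom mult.assoc)
next
  case (Suc k)
  let ?G = "\<lambda>J. fps_nth (quant_ser (mono 0 J)) k"
  have eq: "fps_nth (quant_ser (mono 0 J)) (Suc k) * (a * z ^ M) = scal (1 / (P ^ Suc k - 1)) *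
      (scal (P ^ k) * (?G J * (a * z ^ M)) - z * (?G J * ((zs * a) * z ^ M)) - ?G J * ((y * a) * z ^ M))" for J M
    unfolding quant_ser_Suc_eq by (simp only: left_diff_distrib mult.assoc)
  show ?case unfolding eq
    by (intro symbols_scal symbols_diff symbols_left_z Suc alg_mult alg_zs alg_y)
qed

lemma quant_ser_mono_z: "quant_ser (mono M 0) = fps_const (z ^ M)"
  by (simp add: mono_def quant_ser_single scal_hom)

text \<open>The recursion for \<open>C\<^sub>k\<close>: on \<open>z\<^sup>M\<close> the quantization map is constant in \<open>t\<close>, so the product contributes
  \<open>H\<^sub>k(z*\<^sup>J) z\<^sup>M\<close>, and the remaining terms are images of earlier \<open>C\<^sub>l\<close> under the maps \<open>H\<^sub>k\<^sub>-\<^sub>l\<close>.\<close>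

lemma symbols_berezin: "(\<lambda>J M. rep (berezin k (mono 0 J) (mono M 0))) \<in> symbols"
proof (induction k rule: less_induct)
  case (less k)
  have "(\<lambda>J M. fps_nth (quant_ser (mono 0 J)) k * (1 * z ^ M)) \<in> symbols" by (rule symbols_quant_ser_mono) simp
  moreover have "(\<lambda>J M. \<Sum>l<k. fps_nth (quant_ser (berezin l (mono 0 J) (mono M 0))) (k - l)) \<in> symbols"
    by (intro symbols_sum symbols_quant_ser less)
  ultimately show ?case unfolding rep_berezin quant_ser_mono_z by (simp add: symbols_diff)
qed

section \<open>Anti-normal ordering\<close>

type_synonym index4 = "nat \<times> nat \<times> nat \<times> nat"

definition bterm :: "index4 \<Rightarrow> nat \<Rightarrow> nat \<Rightarrow> oper" where
  "bterm w J M = (case w of (i, j, n, m) \<Rightarrow> du i J * (zs ^ j * z ^ n) * dv m M)"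

text \<open>A finitely supported family of coefficients, so that sums of symbols need no common bound \<open>N\<close>.\<close>

definition bsum :: "(index4 \<Rightarrow>\<^sub>0 complex) \<Rightarrow> nat \<Rightarrow> nat \<Rightarrow> oper" where
  "bsum c J M = (\<Sum>w\<in>Poly_Mapping.keys c. scal (Poly_Mapping.lookup c w) * bterm w J M)"

lemma bsum_add: "bsum (c + d) J M = bsum c J M + bsum d J M"
  unfolding bsum_def by (rule keys_sum_add) (simp_all add: scal_hom distrib_right)

lemma bsum_single: "bsum (Poly_Mapping.single w a) J M = scal a * bterm w J M"
  unfolding bsum_def by (rule keys_sum_single) (simp add: scal_hom)

inductive_set antinormal :: "oper set" where
  an_term: "scal c * (zs ^ j * z ^ n) \<in> antinormal"
| an_add: "X \<in> antinormal \<Longrightarrow> Y \<in> antinormal \<Longrightarrow> X + Y \<in> antinormal"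

lemma antinormal_z: "X \<in> antinormal \<Longrightarrow> z * X \<in> antinormal"
proof (induction rule: antinormal.induct)
  case (an_term c j n)
  have "z * (scal c * (zs ^ j * z ^ n)) = scal c * ((z * zs ^ j) * z ^ n)"
    by (simp only: scal_left_commute[of z] mult.assoc)
  also have "\<dots> = scal (c * P ^ j) * (zs ^ j * z ^ Suc n) + scal (c * (1 - P ^ j)) * (zs ^ (j - 1) * z ^ n)"
    unfolding z_zs_power by (simp only: distrib_left distrib_right scal_scal mult.assoc power_Suc)
  finally show ?case by (simp only: antinormal.intros)
qed (simp add: distrib_left an_add)

lemma antinormal_alg:
  assumes "a \<in> alg"
  shows "a \<in> antinormal"
proof -
  have "rep f \<in> antinormal" for f
  proof (induction f rule: poly_mapping_single_induct)
    case (single w c)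
    obtain i j where w: "w = (i, j)" by force
    have "scal c * zs ^ j \<in> antinormal" using an_term[of c j 0] by simp
    then have "z ^ i * (scal c * zs ^ j) \<in> antinormal"
      by (induction i) (simp_all add: mult.assoc antinormal_z)
    then show ?case by (simp add: w rep_single scal_left_commute[of "z ^ i"])
  qed (simp add: rep_add an_add)
  then show ?thesis using assms by (auto simp: alg_def)
qed

lemma symbols_bsum: "F \<in> symbols \<Longrightarrow> \<exists>c. F = bsum c"
proof (induction rule: symbols.induct)
  case (symbols_term a i m)
  from antinormal_alg[OF this] show ?case
  proof (induction rule: antinormal.induct)
    case (an_term c j n)
    have "(\<lambda>J M. du i J * (scal c * (zs ^ j * z ^ n)) * dv m M) = bsum (Poly_Mapping.single (i, j, n, m) c)"
      by (intro ext) (simp only: bsum_single bterm_def prod.case scal_left_commute[of "du i _"] mult.assoc)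
    then show ?case ..
  next
    case (an_add X Y)
    then obtain c d where "(\<lambda>J M. du i J * X * dv m M) = bsum c" "(\<lambda>J M. du i J * Y * dv m M) = bsum d" by blast
    then have "(\<lambda>J M. du i J * (X + Y) * dv m M) = bsum (c + d)"
      by (intro ext) (simp only: fun_eq_iff bsum_add distrib_left distrib_right)
    then show ?case ..
  qed
next
  case (symbols_add F G)
  then obtain c d where "F = bsum c" "G = bsum d" by blast
  then have "(\<lambda>J M. F J M + G J M) = bsum (c + d)"
    by (intro ext) (simp only: bsum_add)
  then show ?case ..
qed

lemma rep_zs_z: "rep (zs_z q j n) = zs ^ j * z ^ n"
  by (simp add: zs_z_def rep_pmul rep_mono)

lemma rep_bidiff_pol: "rep (bidiff_pol q N a f g) =
    (\<Sum>i\<le>N. \<Sum>j\<le>N. \<Sum>n\<le>N. \<Sum>m\<le>N. scal (a i j n m) *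
      (rep ((dr ^^ i) f) * (zs ^ j * z ^ n) * rep ((dl ^^ m) g)))"
  by (simp add: bidiff_pol_def rep_sum rep_pscale rep_pmul rep_zs_z dr_zs_eq dl_z_eq)

lemma dr_iter_add: "(dr ^^ i) (f + g) = (dr ^^ i) f + (dr ^^ i) g"
  by (induction i) (simp_all add: dr_add)

lemma dl_iter_add: "(dl ^^ i) (f + g) = (dl ^^ i) f + (dl ^^ i) g"
  by (induction i) (simp_all add: dl_add)

lemma bsum_box: "\<exists>N a. \<forall>J M. bsum c J M = (\<Sum>i\<le>N. \<Sum>j\<le>N. \<Sum>n\<le>N. \<Sum>m\<le>N. scal (a i j n m) * bterm (i, j, n, m) J M)"
proof -
  let ?a = "\<lambda>i j n m. Poly_Mapping.lookup c (i, j, n, m)"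
  have "finite ((\<lambda>(i, j, n, m). i + j + n + m) ` Poly_Mapping.keys c)" by simp
  then obtain N where N: "\<forall>x\<in>(\<lambda>(i, j, n, m). i + j + n + m) ` Poly_Mapping.keys c. x \<le> N"
    using finite_nat_set_iff_bounded_le by blast
  have sub: "Poly_Mapping.keys c \<subseteq> {..N} \<times> {..N} \<times> {..N} \<times> {..N}"
  proof
    fix w assume "w \<in> Poly_Mapping.keys c"
    then show "w \<in> {..N} \<times> {..N} \<times> {..N} \<times> {..N}" using N by (cases w) force
  qed
  have "bsum c J M = (\<Sum>i\<le>N. \<Sum>j\<le>N. \<Sum>n\<le>N. \<Sum>m\<le>N. scal (?a i j n m) * bterm (i, j, n, m) J M)" for J M
  proof -
    have "bsum c J M = (\<Sum>w\<in>{..N} \<times> {..N} \<times> {..N} \<times> {..N}. scal (Poly_Mapping.lookup c w) * bterm w J M)"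
      unfolding bsum_def by (rule keys_sum_superset[OF _ sub]) (simp_all add: scal_hom)
    then show ?thesis by (simp add: sum.cartesian_product case_prod_beta)
  qed
  then show ?thesis by (intro exI[of _ N] exI[of _ ?a]) blast
qed

text \<open>Both sides are bilinear and compatible with left multiplication by \<open>z\<close> and right multiplication by
  \<open>z*\<close>, so they agree once they agree on all pairs \<open>(z*\<^sup>J, z\<^sup>M)\<close>.\<close>

theorem berezin_bidiff: "\<exists>N a. \<forall>f g. berezin k f g = bidiff_pol q N a f g"
proof -
  \<comment> \<open>The coefficients found for the pairs \<open>(z*\<^sup>J, z\<^sup>M)\<close> are those of the operator.\<close>
  obtain c where c: "(\<lambda>J M. rep (berezin k (mono 0 J) (mono M 0))) = bsum c"
    using symbols_bsum[OF symbols_berezin] by blast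
  obtain N a where N: "\<forall>J M. bsum c J M = (\<Sum>i\<le>N. \<Sum>j\<le>N. \<Sum>n\<le>N. \<Sum>m\<le>N. scal (a i j n m) * bterm (i, j, n, m) J M)"
    using bsum_box[of c] by blast
  have a: "rep (berezin k (mono 0 J) (mono M 0)) =
      (\<Sum>i\<le>N. \<Sum>j\<le>N. \<Sum>n\<le>N. \<Sum>m\<le>N. scal (a i j n m) * bterm (i, j, n, m) J M)" for J M
    using fun_cong[OF fun_cong[OF c], of J M] N by simp
  have B: "berezin k (f + f') g = berezin k f g + berezin k f' g" "berezin k g (f + f') = berezin k g f + berezin k g f'"
    "berezin k (pscale c f) g = pscale c (berezin k f g)" "berezin k g (pscale c f) = pscale c (berezin k g f)" for f f' g c
  proof -
    note bil = berezin_bilinear[of k, unfolded bilinear_on_def, rule_format, OF UNIV_I UNIV_I UNIV_I]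
    have L: "berezin k (f + pscale c f') g = berezin k f g + pscale c (berezin k f' g)"
      "berezin k g (f + pscale c f') = berezin k g f + pscale c (berezin k g f')" for f f' g c
      by (rule bil[THEN conjunct1], rule bil[THEN conjunct2])
    show A: "berezin k (f + f') g = berezin k f g + berezin k f' g" "berezin k g (f + f') = berezin k g f + berezin k g f'" for f f' g
      using L(1)[of f 1 f' g] L(2)[of g f 1 f'] by simp_all
    have "berezin k 0 g = 0" "berezin k g 0 = 0" using A(1)[of 0 0 g] A(2)[of g 0 0] by simp_all
    then show "berezin k (pscale c f) g = pscale c (berezin k f g)" "berezin k g (pscale c f) = pscale c (berezin k g f)"
      using L(1)[of 0 c f g] L(2)[of g 0 c f] by simp_all
  qed
  have "rep (berezin k f g) = rep (bidiff_pol q N a f g)" for f g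
  proof (induction f rule: poly_mapping_single_induct)
    case (add f f')
    then show ?case by (simp add: B rep_add rep_bidiff_pol dr_iter_add distrib_right distrib_left sum.distrib)
  next
    case (single w c)
    obtain b J where w: "w = (b, J)" by force
    show ?case
    proof (induction g rule: poly_mapping_single_induct)
      case (add g g')
      then show ?case by (simp add: B rep_add rep_bidiff_pol dl_iter_add distrib_left sum.distrib)
    next
      case (single v d)
      obtain M e where v: "v = (M, e)" by force
      have single: "Poly_Mapping.single w c = pscale c (mono b J)" "Poly_Mapping.single v d = pscale d (mono M e)"
        by (simp_all add: w v mono_def)
      have "rep (berezin k (Poly_Mapping.single w c) (Poly_Mapping.single v d)) =
          scal c * (scal d * (z ^ b * rep (berezin k (mono 0 J) (mono M 0)) * zs ^ e))"
        unfolding single B(3) rep_pscale B(4) berezin_mono[of k b J M e] by (rule scal_left_commute)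
      also have "\<dots> = scal (c * d) * (z ^ b * rep (berezin k (mono 0 J) (mono M 0)) * zs ^ e)"
        by (rule scal_scal)
      also have "\<dots> = (\<Sum>i\<le>N. \<Sum>j\<le>N. \<Sum>n\<le>N. \<Sum>m\<le>N. scal (c * d) * (z ^ b * (scal (a i j n m) * bterm (i, j, n, m) J M) * zs ^ e))"
        unfolding a by (simp only: sum_distrib_left sum_distrib_right)
      also have "\<dots> = rep (bidiff_pol q N a (Poly_Mapping.single w c) (Poly_Mapping.single v d))"
        unfolding rep_bidiff_pol
      proof (intro sum.cong refl)
        fix i j n m
        have "rep ((dr ^^ i) (Poly_Mapping.single w c)) * (zs ^ j * z ^ n) * rep ((dl ^^ m) (Poly_Mapping.single v d))
          = scal c * (z ^ b * du i J) * (zs ^ j * z ^ n) * (scal d * (dv m M * zs ^ e))"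
          unfolding w v rep_dr_iter rep_dl_iter ..
        also have "\<dots> = scal d * (scal c * (z ^ b * du i J) * (zs ^ j * z ^ n) * (dv m M * zs ^ e))"
          by (rule scal_left_commute)
        also have "\<dots> = scal (c * d) * (z ^ b * bterm (i, j, n, m) J M * zs ^ e)"
          by (simp only: bterm_def prod.case mult.assoc scal_scal mult.commute[of d c])
        finally have E: "rep ((dr ^^ i) (Poly_Mapping.single w c)) * (zs ^ j * z ^ n) * rep ((dl ^^ m) (Poly_Mapping.single v d))
          = scal (c * d) * (z ^ b * bterm (i, j, n, m) J M * zs ^ e)" .
        show "scal (c * d) * (z ^ b * (scal (a i j n m) * bterm (i, j, n, m) J M) * zs ^ e) = scal (a i j n m) *
          (rep ((dr ^^ i) (Poly_Mapping.single w c)) * (zs ^ j * z ^ n) * rep ((dl ^^ m) (Poly_Mapping.single v d)))"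
          unfolding E scal_left_commute[of "z ^ b"] mult.assoc[of "scal (a i j n m)"] scal_scal
          by (simp only: mult.commute)
      qed
      finally show ?case .
    qed
  qed
  then show ?thesis by (intro exI[of _ N] exI[of _ a]) (simp add: rep_inj)
qed

end

section \<open>Power series in \<open>t\<close>\<close>

lemma fps_X_series_sums_iff:
  fixes c :: "nat \<Rightarrow> complex fps"
  shows "(\<lambda>k. fps_X ^ Suc k * c (Suc k)) sums S \<longleftrightarrow>
    (\<forall>n. fps_nth S n = (\<Sum>k<n. fps_nth (c (Suc k)) (n - Suc k)))"
proof -
  have nth: "fps_nth (\<Sum>k<N. fps_X ^ Suc k * c (Suc k)) n = (\<Sum>k<n. fps_nth (c (Suc k)) (n - Suc k))"
    if "n \<le> N" for N n
  proof -
    have "fps_nth (\<Sum>k<N. fps_X ^ Suc k * c (Suc k)) n = (\<Sum>k<N. if n < Suc k then 0 else fps_nth (c (Suc k)) (n - Suc k))"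
      unfolding fps_sum_nth fps_X_power_mult_nth ..
    also have "\<dots> = (\<Sum>k<n. fps_nth (c (Suc k)) (n - Suc k))"
      using that by (intro sum.mono_neutral_cong_right) auto
    finally show ?thesis .
  qed
  show ?thesis unfolding sums_def tendsto_fps_iff
  proof safe
    fix n
    assume "\<forall>n. \<forall>\<^sub>F N in sequentially. fps_nth (\<Sum>k<N. fps_X ^ Suc k * c (Suc k)) n = fps_nth S n"
    then have "\<forall>\<^sub>F N in sequentially. fps_nth (\<Sum>k<N. fps_X ^ Suc k * c (Suc k)) n = fps_nth S n" ..
    moreover have "\<forall>\<^sub>F N in sequentially. n \<le> N" by (rule eventually_ge_at_top)
    ultimately have "\<forall>\<^sub>F N in sequentially. fps_nth S n = (\<Sum>k<n. fps_nth (c (Suc k)) (n - Suc k))"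
      by eventually_elim (use nth in simp)
    then show "fps_nth S n = (\<Sum>k<n. fps_nth (c (Suc k)) (n - Suc k))" by simp
  next
    fix n
    assume S: "\<forall>n. fps_nth S n = (\<Sum>k<n. fps_nth (c (Suc k)) (n - Suc k))"
    have "\<forall>\<^sub>F N in sequentially. n \<le> N" by (rule eventually_ge_at_top)
    then show "\<forall>\<^sub>F N in sequentially. fps_nth (\<Sum>k<N. fps_X ^ Suc k * c (Suc k)) n = fps_nth S n"
      by eventually_elim (use nth S in simp)
  qed
qed

context qdisc
begin

definition tval :: "real \<Rightarrow> complex" where
  "tval \<alpha> = of_real (q powr (4 * \<alpha>))"

lemma tval_power: "of_real (q powr (4 * \<alpha> * real k)) = tval \<alpha> ^ k"
proof -
  have "q powr (4 * \<alpha> * real k) = (q powr (4 * \<alpha>)) ^ k"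
    using q_pos by (simp add: powr_powr[symmetric] powr_realpow)
  then show ?thesis by (simp add: tval_def)
qed

lemma t_series_iff: "t_series q F g \<longleftrightarrow> (\<forall>\<alpha>>0. (\<lambda>k. fps_nth g k * tval \<alpha> ^ k) sums F \<alpha>)"
  by (simp add: t_series_def tval_power)

lemma norm_tval: "norm (tval \<alpha>) = q powr (4 * \<alpha>)"
  by (simp add: tval_def)

lemma norm_tval_less_1: "0 < \<alpha> \<Longrightarrow> norm (tval \<alpha>) < 1"
  unfolding norm_tval using q_pos q_less_1 powr_less_mono'[of q 0 "4 * \<alpha>"] by simp

text \<open>The series converges for \<open>\<alpha>/2\<close> as well, which is a larger value of \<open>t\<close>.\<close>

lemma t_series_abs_summable:
  assumes "t_series q F g" "0 < \<alpha>"
  shows "summable (\<lambda>k. norm (fps_nth g k * tval \<alpha> ^ k))"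
proof (rule powser_insidea)
  have "(\<lambda>k. fps_nth g k * tval (\<alpha> / 2) ^ k) sums F (\<alpha> / 2)"
    using assms unfolding t_series_iff by simp
  then show "summable (\<lambda>k. fps_nth g k * tval (\<alpha> / 2) ^ k)"
    by (rule sums_summable)
  show "norm (tval \<alpha>) < norm (tval (\<alpha> / 2))"
    unfolding norm_tval using assms q_pos q_less_1 by (intro powr_less_mono') auto
qed

lemma t_series_const: "t_series q (\<lambda>_. c) (fps_const c)"
  unfolding t_series_iff
proof safe
  fix \<alpha> :: real
  have "(\<lambda>k. fps_nth (fps_const c) k * tval \<alpha> ^ k) = (\<lambda>k. if k = 0 then c else 0)"
    by (auto simp: fun_eq_iff)
  then show "(\<lambda>k. fps_nth (fps_const c) k * tval \<alpha> ^ k) sums c"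
    using sums_single[of 0 "\<lambda>_. c"] by simp
qed

lemma t_series_add: "t_series q F f \<Longrightarrow> t_series q G g \<Longrightarrow> t_series q (\<lambda>\<alpha>. F \<alpha> + G \<alpha>) (f + g)"
  unfolding t_series_iff by (auto simp: distrib_right intro: sums_add)

lemma t_series_diff: "t_series q F f \<Longrightarrow> t_series q G g \<Longrightarrow> t_series q (\<lambda>\<alpha>. F \<alpha> - G \<alpha>) (f - g)"
  unfolding t_series_iff by (auto simp: left_diff_distrib intro: sums_diff)

lemma t_series_mult:
  assumes "t_series q F f" "t_series q G g"
  shows "t_series q (\<lambda>\<alpha>. F \<alpha> * G \<alpha>) (f * g)"
  unfolding t_series_iff
proof safe
  fix \<alpha> :: real assume \<alpha>: "0 < \<alpha>"
  let ?a = "\<lambda>k. fps_nth f k * tval \<alpha> ^ k" and ?b = "\<lambda>k. fps_nth g k * tval \<alpha> ^ k"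
  have "(\<lambda>k. \<Sum>i\<le>k. ?a i * ?b (k - i)) sums (suminf ?a * suminf ?b)"
    using assms \<alpha> by (intro Cauchy_product_sums t_series_abs_summable)
  moreover have "suminf ?a = F \<alpha>" "suminf ?b = G \<alpha>"
    using assms \<alpha> unfolding t_series_iff by (simp_all add: sums_iff)
  moreover have "(\<Sum>i\<le>k. ?a i * ?b (k - i)) = fps_nth (f * g) k * tval \<alpha> ^ k" for k
  proof -
    have "?a i * ?b (k - i) = fps_nth f i * fps_nth g (k - i) * tval \<alpha> ^ k" if "i \<le> k" for i
    proof -
      have "tval \<alpha> ^ k = tval \<alpha> ^ i * tval \<alpha> ^ (k - i)" using that by (simp flip: power_add)
      then show ?thesis by simp
    qed
    then show ?thesis unfolding fps_mult_nth atLeast0AtMost sum_distrib_right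
      by (intro sum.cong) blast+
  qed
  ultimately show "(\<lambda>k. fps_nth (f * g) k * tval \<alpha> ^ k) sums (F \<alpha> * G \<alpha>)" by simp
qed

lemma t_series_sum:
  assumes "\<And>i. i \<in> S \<Longrightarrow> t_series q (F i) (f i)"
  shows "t_series q (\<lambda>\<alpha>. \<Sum>i\<in>S. F i \<alpha>) (\<Sum>i\<in>S. f i)"
  using assms
proof (induction S rule: infinite_finite_induct)
  case (insert x S)
  then show ?case by (simp add: t_series_add)
qed (use t_series_const[of 0] in simp_all)

text \<open>After division by \<open>t\<^sup>k\<close> the series is continuous at \<open>0\<close> and vanishes along \<open>t = q\<^sup>4\<^sup>(\<^sup>N\<^sup>+\<^sup>1\<^sup>)\<close>, a sequence
  tending to \<open>0\<close>.\<close>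

lemma t_series_zero:
  assumes d: "t_series q (\<lambda>_. 0) d"
  shows "d = 0"
proof -
  have "fps_nth d k = 0" for k
  proof (induction k rule: less_induct)
    case (less k)
    have nz: "tval \<alpha> \<noteq> 0" for \<alpha> using q_pos by (simp add: tval_def)
    have shift: "(\<lambda>n. fps_nth d (n + k) * tval \<alpha> ^ n) sums 0" if "0 < \<alpha>" for \<alpha>
    proof -
      have "(\<lambda>n. fps_nth d (n + k) * tval \<alpha> ^ (n + k)) sums (0 - (\<Sum>i<k. fps_nth d i * tval \<alpha> ^ i))"
        using d that unfolding t_series_iff by (intro sums_split_initial_segment) auto
      then have "(\<lambda>n. fps_nth d (n + k) * tval \<alpha> ^ n * tval \<alpha> ^ k) sums 0"
        using less by (simp add: power_add mult.assoc)
      from sums_divide[OF this, of "tval \<alpha> ^ k"] show ?thesis using nz by simp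
    qed
    let ?f = "\<lambda>x. suminf (\<lambda>n. fps_nth d (n + k) * x ^ n)"
    \<comment> \<open>The coefficient of index \<open>k\<close> is the limit at \<open>0\<close> of the shifted series.\<close>
    have "(?f \<longlongrightarrow> fps_nth d (0 + k)) (at 0)"
    proof (rule powser_limit_0)
      show "0 < norm (tval 1)" using nz by simp
      fix x :: complex assume "norm x < norm (tval 1)"
      then show "(\<lambda>n. fps_nth d (n + k) * x ^ n) sums ?f x"
        using powser_inside[OF sums_summable[OF shift[of 1]]] by (auto intro: summable_sums)
    qed
    moreover have "filterlim (\<lambda>N. tval (real (Suc N))) (at 0) sequentially"
    proof -
      have "(\<lambda>N. tval (real (Suc N))) \<longlonglongrightarrow> 0"
      proof -
        have "tval (real (Suc N)) = tval 1 ^ Suc N" for N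
          using tval_power[of 1 "Suc N"] unfolding tval_def by simp
        moreover have "(\<lambda>N. tval 1 ^ Suc N) \<longlonglongrightarrow> 0"
          using LIMSEQ_Suc[OF LIMSEQ_power_zero[OF norm_tval_less_1[of 1]]] by simp
        ultimately show ?thesis by simp
      qed
      then show ?thesis using nz by (simp add: filterlim_at)
    qed
    ultimately have "(\<lambda>N. ?f (tval (real (Suc N)))) \<longlonglongrightarrow> fps_nth d (0 + k)"
      by (rule filterlim_compose)
    moreover have "?f (tval (real (Suc N))) = 0" for N
      using shift[of "real (Suc N)"] by (simp add: sums_iff)
    ultimately have "(\<lambda>N. 0) \<longlonglongrightarrow> fps_nth d k" by simp
    then show ?case by (simp add: LIMSEQ_const_iff)
  qed
  then show ?thesis by (intro fps_ext) simp
qed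

lemma t_series_unique: "t_series q F f \<Longrightarrow> t_series q F g \<Longrightarrow> f = g"
  using t_series_zero[of "f - g"] t_series_diff[of F f F g] by simp

section \<open>Matrix entries of the quantized operators\<close>

definition ent_ser :: "oper fps \<Rightarrow> nat \<Rightarrow> nat \<Rightarrow> complex fps" where
  "ent_ser F m n = Abs_fps (\<lambda>k. ent (fps_nth F k) m n)"

lemma ent_ser_nth [simp]: "fps_nth (ent_ser F m n) k = ent (fps_nth F k) m n"
  by (simp add: ent_ser_def)

text \<open>The bound on the columns is uniform in the coefficients of the series and in \<open>\<alpha>\<close>. It makes the entries
  of a product finite sums of products of convergent series.\<close>

definition expands :: "(real \<Rightarrow> oper) \<Rightarrow> oper fps \<Rightarrow> bool" where
  "expands T F \<longleftrightarrow> (\<forall>n. \<exists>L. \<forall>l>L. ent_ser F l n = 0 \<and> (\<forall>\<alpha>. ent (T \<alpha>) l n = 0)) \<and>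
    (\<forall>m n. t_series q (\<lambda>\<alpha>. ent (T \<alpha>) m n) (ent_ser F m n))"

lemma expands_bound:
  assumes "expands T F"
  obtains L where "\<And>l. L < l \<Longrightarrow> ent_ser F l n = 0" "\<And>l \<alpha>. L < l \<Longrightarrow> ent (T \<alpha>) l n = 0"
  using assms unfolding expands_def by meson

lemma expands_const: "expands (\<lambda>_. X) (fps_const X)"
proof -
  have e: "ent_ser (fps_const X) m n = fps_const (ent X m n)" for m n
    by (rule fps_ext) simp
  show ?thesis unfolding expands_def e using t_series_const ent_bounded[of X] by simp
qed

lemma expands_add:
  assumes "expands T F" "expands S G"
  shows "expands (\<lambda>\<alpha>. T \<alpha> + S \<alpha>) (F + G)"
proof -
  have e: "ent_ser (F + G) m n = ent_ser F m n + ent_ser G m n" for m n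
    by (rule fps_ext) simp
  show ?thesis unfolding expands_def
  proof safe
    fix n
    obtain L L' where "\<And>l. L < l \<Longrightarrow> ent_ser F l n = 0" "\<And>l \<alpha>. L < l \<Longrightarrow> ent (T \<alpha>) l n = 0"
      "\<And>l. L' < l \<Longrightarrow> ent_ser G l n = 0" "\<And>l \<alpha>. L' < l \<Longrightarrow> ent (S \<alpha>) l n = 0"
      using expands_bound[OF assms(1), of n] expands_bound[OF assms(2), of n] by metis
    then show "\<exists>La. \<forall>l>La. ent_ser (F + G) l n = 0 \<and> (\<forall>\<alpha>. ent (T \<alpha> + S \<alpha>) l n = 0)"
      by (intro exI[of _ "max L L'"]) (simp add: e)
  next
    fix m n show "t_series q (\<lambda>\<alpha>. ent (T \<alpha> + S \<alpha>) m n) (ent_ser (F + G) m n)"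
      using assms unfolding expands_def e by (simp add: t_series_add)
  qed
qed

lemma ent_ser_mult:
  assumes "\<And>l. L < l \<Longrightarrow> ent_ser G l n = 0"
  shows "ent_ser (F * G) m n = (\<Sum>l\<le>L. ent_ser F m l * ent_ser G l n)"
proof (rule fps_ext)
  fix k
  have G: "ent (fps_nth G i) l n = 0" if "L < l" for i l
    using arg_cong[OF assms[OF that], of "\<lambda>g. fps_nth g i"] by simp
  have "fps_nth (ent_ser (F * G) m n) k = (\<Sum>i=0..k. \<Sum>l\<le>L. ent (fps_nth F i) m l * ent (fps_nth G (k - i)) l n)"
    by (simp add: fps_mult_nth ent_sum ent_mult[OF G])
  also have "\<dots> = (\<Sum>l\<le>L. \<Sum>i=0..k. ent (fps_nth F i) m l * ent (fps_nth G (k - i)) l n)"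
    by (rule sum.swap)
  finally show "fps_nth (ent_ser (F * G) m n) k = fps_nth (\<Sum>l\<le>L. ent_ser F m l * ent_ser G l n) k"
    by (simp add: fps_sum_nth fps_mult_nth)
qed

lemma expands_mult:
  assumes "expands T F" "expands S G"
  shows "expands (\<lambda>\<alpha>. T \<alpha> * S \<alpha>) (F * G)"
  unfolding expands_def
proof safe
  fix n
  obtain L where L: "\<And>l. L < l \<Longrightarrow> ent_ser G l n = 0" "\<And>l \<alpha>. L < l \<Longrightarrow> ent (S \<alpha>) l n = 0"
    using expands_bound[OF assms(2), of n] by metis
  have e: "ent_ser (F * G) m n = (\<Sum>l\<le>L. ent_ser F m l * ent_ser G l n)"
    "ent (T \<alpha> * S \<alpha>) m n = (\<Sum>l\<le>L. ent (T \<alpha>) m l * ent (S \<alpha>) l n)" for m \<alpha>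
    using ent_ser_mult[of L G n F m] ent_mult[of L "S \<alpha>" n "T \<alpha>" m] L by blast+
  show "t_series q (\<lambda>\<alpha>. ent (T \<alpha> * S \<alpha>) m n) (ent_ser (F * G) m n)" for m
    unfolding e using assms unfolding expands_def by (intro t_series_sum t_series_mult) auto
  have "\<exists>K. \<forall>l\<le>L. \<forall>m>K. ent_ser F m l = 0 \<and> (\<forall>\<alpha>. ent (T \<alpha>) m l = 0)"
  proof -
    have "\<forall>l. \<exists>K. \<forall>m>K. ent_ser F m l = 0 \<and> (\<forall>\<alpha>. ent (T \<alpha>) m l = 0)"
      using assms(1) unfolding expands_def by blast
    then obtain K where K: "\<And>l m. K l < m \<Longrightarrow> ent_ser F m l = 0 \<and> (\<forall>\<alpha>. ent (T \<alpha>) m l = 0)" by metis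
    have "K l \<le> (\<Sum>l\<le>L. K l)" if "l \<le> L" for l using that by (intro member_le_sum) auto
    then show ?thesis using K by (intro exI[of _ "\<Sum>l\<le>L. K l"]) (meson le_less_trans)
  qed
  then obtain K where K: "\<And>l m. l \<le> L \<Longrightarrow> K < m \<Longrightarrow> ent_ser F m l = 0 \<and> (\<forall>\<alpha>. ent (T \<alpha>) m l = 0)" by blast
  then show "\<exists>L. \<forall>l>L. ent_ser (F * G) l n = 0 \<and> (\<forall>\<alpha>. ent (T \<alpha> * S \<alpha>) l n = 0)"
    unfolding e by (intro exI[of _ K]) simp
qed

lemma expands_power: "expands T F \<Longrightarrow> expands (\<lambda>\<alpha>. T \<alpha> ^ n) (F ^ n)"
proof (induction n)
  case 0
  show ?case using expands_const[of 1] by simp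
next
  case (Suc n)
  then show ?case using expands_mult[of T F "\<lambda>\<alpha>. T \<alpha> ^ n" "F ^ n"] by simp
qed

definition zs_op :: "real \<Rightarrow> oper" where
  "zs_op \<alpha> = of_cols (\<lambda>n. monom ((1 - Q ^ n) / (1 - tval \<alpha> * Q ^ n)) (n - 1))"

lemma norm_Q_power_le_1: "norm (Q ^ n) \<le> 1"
  using q_pos q_less_1 by (simp add: Q_def norm_power power_le_one flip: power_mult)

text \<open>On each basis vector this is a geometric series in \<open>t q\<^sup>2\<^sup>n\<close>.\<close>

lemma expands_zs_ser: "expands zs_op zs_ser"
  unfolding expands_def
proof safe
  have e: "ent (fps_nth zs_ser k) m n = (if m = n - 1 then (Q ^ n) ^ k * (1 - Q ^ n) else 0)" for k m n
    by (simp add: zs_ser_def ent_def app_ring app_y_power)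
  have e': "ent (zs_op \<alpha>) m n = (if m = n - 1 then (1 - Q ^ n) / (1 - tval \<alpha> * Q ^ n) else 0)" for \<alpha> m n
    by (simp add: zs_op_def ent_of_cols)
  show "\<exists>L. \<forall>l>L. ent_ser zs_ser l n = 0 \<and> (\<forall>\<alpha>. ent (zs_op \<alpha>) l n = 0)" for n
    by (intro exI[of _ n]) (auto simp: fps_eq_iff e e')
  fix m n
  show "t_series q (\<lambda>\<alpha>. ent (zs_op \<alpha>) m n) (ent_ser zs_ser m n)"
    unfolding t_series_iff
  proof safe
    fix \<alpha> :: real assume "0 < \<alpha>"
    then have "norm (tval \<alpha>) * norm (Q ^ n) < 1 * 1"
      using norm_tval_less_1[of \<alpha>] norm_Q_power_le_1[of n] by (intro mult_less_le_imp_less) auto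
    then have "norm (tval \<alpha> * Q ^ n) < 1" by (simp add: norm_mult)
    from sums_mult[OF geometric_sums[OF this], of "1 - Q ^ n"]
    have "(\<lambda>k. (Q ^ n) ^ k * (1 - Q ^ n) * tval \<alpha> ^ k) sums ((1 - Q ^ n) / (1 - tval \<alpha> * Q ^ n))"
      by (simp add: power_mult_distrib mult_ac)
    then show "(\<lambda>k. fps_nth (ent_ser zs_ser m n) k * tval \<alpha> ^ k) sums ent (zs_op \<alpha>) m n"
      by (simp add: e e')
  qed
qed

definition quant :: "real \<Rightarrow> pol \<Rightarrow> oper" where
  "quant \<alpha> f = ev scal (\<lambda>x. case x of Z \<Rightarrow> z | Zs \<Rightarrow> zs_op \<alpha>) (normal_form Z Zs f)"

lemma quant_single: "quant \<alpha> (Poly_Mapping.single (i, j) c) = scal c * z ^ i * zs_op \<alpha> ^ j"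
  by (simp add: quant_def normal_form_single scal.ev_mult scal.ev_power)

lemma quant_add: "quant \<alpha> (f + g) = quant \<alpha> f + quant \<alpha> g"
  by (simp add: quant_def normal_form_add scal.ev_add)

lemma expands_quant: "expands (\<lambda>\<alpha>. quant \<alpha> f) (quant_ser f)"
proof (induction f rule: poly_mapping_single_induct)
  case (single w c)
  obtain i j where w: "w = (i, j)" by force
  show ?case unfolding w quant_single quant_ser_single
    by (intro expands_mult expands_const expands_power expands_zs_ser)
next
  case (add f g)
  then show ?case unfolding quant_add quant_ser_add by (rule expands_add)
qed

lemma app_funpow: "app (X ^ n) p = (app X ^^ n) p"
  by (induction n) (simp_all add: app_ring)

lemma hat_z_eq: "hat_z = app z"
proof
  fix p :: "complex poly"
  have "app z p = (\<Sum>n\<le>degree p. monom (coeff p n) (Suc n))"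
    by (simp add: z_def app_of_cols smult_monom)
  also have "\<dots> = pCons 0 (\<Sum>n\<le>degree p. monom (coeff p n) n)"
  proof -
    have "pCons 0 (\<Sum>n\<in>S. f n) = (\<Sum>n\<in>S. pCons 0 (f n))" for f :: "nat \<Rightarrow> complex poly" and S
    proof (induction S rule: infinite_finite_induct)
      case (insert x S)
      have "pCons 0 (f x + sum f S) = pCons 0 (f x) + pCons 0 (sum f S)" by simp
      then show ?case by (simp only: sum.insert[OF insert.hyps] insert.IH)
    qed simp_all
    then show ?thesis by (simp add: monom_Suc)
  qed
  finally show "hat_z p = app z p" by (simp add: hat_z_def poly_as_sum_of_monoms)
qed

lemma hat_zs_eq:
  assumes "0 < \<alpha>"
  shows "hat_zs q \<alpha> = app (zs_op \<alpha>)"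
proof
  fix p :: "complex poly"
  have c: "of_real ((1 - q ^ (2 * m)) / (1 - q powr (4 * \<alpha> + 2 * real m))) = (1 - Q ^ m) / (1 - tval \<alpha> * Q ^ m)" for m
  proof -
    have "q powr (4 * \<alpha> + 2 * real m) = q powr (4 * \<alpha>) * q ^ (2 * m)"
      using q_pos by (simp add: powr_add flip: powr_realpow)
    then show ?thesis by (simp add: Q_power tval_def)
  qed
  have "app (zs_op \<alpha>) p = (\<Sum>n\<le>degree p. monom (coeff p n * ((1 - Q ^ n) / (1 - tval \<alpha> * Q ^ n))) (n - 1))"
    by (simp add: zs_op_def app_of_cols smult_monom)
  also have "\<dots> = (\<Sum>n=1..degree p. monom (coeff p n * ((1 - Q ^ n) / (1 - tval \<alpha> * Q ^ n))) (n - 1))"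
    by (rule sum.mono_neutral_right) (auto simp: not_le)
  finally show "hat_zs q \<alpha> p = app (zs_op \<alpha>) p" by (simp only: hat_zs_def c)
qed

lemma hat_eq:
  assumes "0 < \<alpha>"
  shows "hat q \<alpha> f = app (quant \<alpha> f)"
proof
  fix p
  have "quant \<alpha> f = (\<Sum>(i, j)\<in>Poly_Mapping.keys f. scal (Poly_Mapping.lookup f (i, j)) * z ^ i * zs_op \<alpha> ^ j)"
    by (simp add: quant_def scal.ev_normal_form)
  then show "hat q \<alpha> f p = app (quant \<alpha> f) p"
    by (simp add: hat_def app_oper_sum case_prod_beta app_ring app_funpow hat_z_eq hat_zs_eq[OF assms])
qed

lemma t_series_cong: "(\<And>\<alpha>. 0 < \<alpha> \<Longrightarrow> F \<alpha> = G \<alpha>) \<Longrightarrow> t_series q F g \<longleftrightarrow> t_series q G g"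
  by (auto simp: t_series_iff)

lemma t_series_hat: "t_series q (\<lambda>\<alpha>. entry (hat q \<alpha> f) m n) (ent_ser (quant_ser f) m n)"
  using expands_quant[of f] unfolding expands_def
  by (subst t_series_cong[where G = "\<lambda>\<alpha>. ent (quant \<alpha> f) m n"]) (auto simp: entry_def ent_def hat_eq)

lemma t_series_hat_comp: "t_series q (\<lambda>\<alpha>. entry (hat q \<alpha> f \<circ> hat q \<alpha> g) m n) (ent_ser (quant_ser f * quant_ser g) m n)"
  using expands_mult[OF expands_quant[of f] expands_quant[of g]] unfolding expands_def
  by (subst t_series_cong[where G = "\<lambda>\<alpha>. ent (quant \<alpha> f * quant \<alpha> g) m n"]) (auto simp: entry_def ent_def hat_eq app_ring)

section \<open>The Berezin expansion\<close>

lemma quant_seq_nth_shift: "fps_nth (quant_seq c) n = fps_nth (quant_ser (c 0)) n + (\<Sum>k<n. fps_nth (quant_ser (c (Suc k))) (n - Suc k))"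
  unfolding quant_seq_def fps_nth_Abs_fps sum.atMost_shift by simp

lemma berezin_expansion_berezin: "berezin_expansion q berezin"
  unfolding berezin_expansion_def
proof (intro conjI allI impI berezin_bilinear)
  fix f g m n
  have "(\<lambda>k. fps_X ^ Suc k * ent_ser (quant_ser (berezin (Suc k) f g)) m n) sums
      (ent_ser (quant_ser f * quant_ser g) m n - ent_ser (quant_ser (pmul q f g)) m n)"
    unfolding fps_X_series_sums_iff[of "\<lambda>k. ent_ser (quant_ser (berezin k f g)) m n"]
    by (simp add: quant_seq_berezin[symmetric] quant_seq_nth_shift berezin_0 ent_sum)
  then show "\<exists>F H c. t_series q (\<lambda>\<alpha>. entry (hat q \<alpha> f \<circ> hat q \<alpha> g) m n) F \<and>
      t_series q (\<lambda>\<alpha>. entry (hat q \<alpha> (pmul q f g)) m n) H \<and>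
      (\<forall>k\<ge>1. t_series q (\<lambda>\<alpha>. entry (hat q \<alpha> (berezin k f g)) m n) (c k)) \<and>
      (\<lambda>k. fps_X ^ Suc k * c (Suc k)) sums (F - H)"
    using t_series_hat_comp t_series_hat
    by (intro exI[of _ "ent_ser (quant_ser f * quant_ser g) m n"] exI[of _ "ent_ser (quant_ser (pmul q f g)) m n"]
        exI[of _ "\<lambda>k. ent_ser (quant_ser (berezin k f g)) m n"]) blast
qed

text \<open>The entries of the given operators determine their power series, so the sequence with \<open>C\<^sub>k (f, g)\<close> for
  \<open>k \<ge> 1\<close> and the product for \<open>k = 0\<close> has the same quantization as the sequence constructed above.\<close>

lemma berezin_expansion_unique:
  assumes C: "berezin_expansion q C" and k: "1 \<le> k"
  shows "C k = berezin k"
proof (intro ext)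
  fix f g
  \<comment> \<open>The expansion says nothing about \<open>C 0\<close>; its place is taken by the product.\<close>
  define c where "c l = (if l = 0 then pmul q f g else C l f g)" for l
  have "quant_seq c = quant_ser f * quant_ser g"
  proof (rule fps_ext, rule ent_eqI)
    fix N m n
    obtain F H d where F: "t_series q (\<lambda>\<alpha>. entry (hat q \<alpha> f \<circ> hat q \<alpha> g) m n) F"
      and H: "t_series q (\<lambda>\<alpha>. entry (hat q \<alpha> (pmul q f g)) m n) H"
      and d: "\<forall>k\<ge>1. t_series q (\<lambda>\<alpha>. entry (hat q \<alpha> (C k f g)) m n) (d k)"
      and S: "(\<lambda>k. fps_X ^ Suc k * d (Suc k)) sums (F - H)"
      using C unfolding berezin_expansion_def by blast
    have F': "F = ent_ser (quant_ser f * quant_ser g) m n" and H': "H = ent_ser (quant_ser (pmul q f g)) m n"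
      using t_series_unique[OF F t_series_hat_comp] t_series_unique[OF H t_series_hat] .
    have d': "d (Suc k) = ent_ser (quant_ser (C (Suc k) f g)) m n" for k
      using d t_series_unique[OF _ t_series_hat] by simp
    from S have "fps_nth (F - H) N = (\<Sum>k<N. fps_nth (d (Suc k)) (N - Suc k))"
      unfolding fps_X_series_sums_iff by blast
    then show "ent (fps_nth (quant_seq c) N) m n = ent (fps_nth (quant_ser f * quant_ser g) N) m n"
      by (simp add: F' H' d' quant_seq_nth_shift c_def ent_sum diff_eq_eq add.commute)
  qed
  then have "quant_seq c = quant_seq (\<lambda>k. berezin k f g)" by (simp add: quant_seq_berezin)
  from quant_seq_inj[OF this, of k] show "C k f g = berezin k f g" using k by (simp add: c_def)
qed

end

theorem corollary8p5:
  fixes q :: real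
  assumes "0 < q" and "q < 1"
  shows "\<exists>C. berezin_expansion q C \<and>
    (\<forall>C'. berezin_expansion q C' \<longrightarrow> (\<forall>k\<ge>1. C' k = C k)) \<and>
    (\<forall>k\<ge>1. \<exists>N a.
       (\<forall>f1 f2. C k f1 f2 = bidiff_pol q N a f1 f2) \<and>
       (\<exists>B. sep_cont_ext q (C k) B \<and>
            bilinear_on fin_funs gscale B \<and>
            (\<forall>f1\<in>fin_funs. \<forall>f2\<in>fin_funs.
               B f1 f2 \<in> fin_funs \<and> B f1 f2 = bidiff_fin q N a f1 f2)))"
proof -
  interpret qdisc q by standard (use assms in auto)
  show ?thesis
  proof (intro exI[of _ berezin] conjI allI impI berezin_expansion_berezin)
    fix C' k assume "berezin_expansion q C'" "1 \<le> (k::nat)"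
    then show "C' k = berezin k" by (rule berezin_expansion_unique)
  next
    fix k :: nat
    obtain N a where C: "\<forall>f g. berezin k f g = bidiff_pol q N a f g" using berezin_bidiff by blast
    then have "berezin k = bidiff_pol q N a" by (intro ext) simp
    then have "sep_cont_ext q (berezin k) (bidiff_fin q N a)" using bidiff_extension(1) by simp
    then show "\<exists>N a. (\<forall>f1 f2. berezin k f1 f2 = bidiff_pol q N a f1 f2) \<and>
       (\<exists>B. sep_cont_ext q (berezin k) B \<and> bilinear_on fin_funs gscale B \<and>
            (\<forall>f1\<in>fin_funs. \<forall>f2\<in>fin_funs. B f1 f2 \<in> fin_funs \<and> B f1 f2 = bidiff_fin q N a f1 f2))"
      using C bidiff_extension(2,3) by (intro exI[of _ N] exI[of _ a] conjI exI[of _ "bidiff_fin q N a"]) auto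
  qed
qed

end
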